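(* Let $0<C_3<(C_0C_* )^{-1}$ and let $\lambda_h$ be any positive number less than $C_3/h$. Then $I-\lambda_h\,\mathcal U_W$ is invertible, and moreover, for $\eta_h\in M_h$: $\eta_h$ is nontrivial and $\lambda_h$ satisfies $$a_h(\eta_h,\mu)=\lambda_h\,\big((I-\lambda_h\,\mathcal U_W)^{-1}\mathcal U\eta_h,\ \mathcal U\mu\big)_{\mathcal T_h}\qquad\text{for all }\mu\in M_h$$ if and only if the number $\lambda_h$ and the functions $$\eta_h,\qquad u_h=(I-\lambda_h\,\mathcal U_W)^{-1}\mathcal U\eta_h,\qquad \vec q_h=\vec{\mathcal Q}\eta_h+\lambda_h\vec{\mathcal Q}_W u_h$$ together solve the HDG eigenproblem.
   Context: Setting. $\Omega\subset\mathbb R^n$ ($n\ge2$) is a polyhedral domain; $\alpha:\Omega\to\mathbb R^{n\times n}$ is symmetric positive definite at every point, $c=\alpha^{-1}$, and the norms of $\alpha$ and $c$ are bounded by a fixed constant. $\mathcal T_h$ is a mesh of $\Omega$ by simplices, $h_K=\operatorname{diam}K$, $h=\max_Kh_K$. For a fixed integer $k\ge0$, with $P_k(D)$ the polynomials of degree at most $k$ on $D$: $W_h=\{w: w|_K\in P_k(K)\ \forall K\}$; $V_h=\{\vec v:\vec v|_K\in P_k(K)^n\ \forall K\}$; $M_h=\{\mu:\mu|_F\in P_k(F)$ for every mesh face $F$, $\mu|_F=0$ if $F\subseteq\partial\Omega\}$. $(v,w)_K=\int_Kvw$, $\langle v,w\rangle_{\partial K}=\int_{\partial K}vw$ (dot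 products for vector functions), $(\cdot,\cdot)_{\mathcal T_h}=\sum_K(\cdot,\cdot)_K$, $\langle\cdot,\cdot\rangle_{\partial\mathcal T_h}=\sum_K\langle\cdot,\cdot\rangle_{\partial K}$; on $\partial K$ traces are taken from inside $K$ and $\vec n$ is the unit outward normal of $K$. The penalty function $\tau\ge0$ is double-valued on interior faces (one value from each adjacent element, denoted $\tau|_{\partial K}$ from $K$), constant on each face of each $K$, and positive on at least one face of each $K$. For each $K$, $F_{\max}$ is a face where $\tau|_{\partial K}$ is maximal, $\tau_K^{\max}=\max\tau|_{\partial K}$, $\tau_K^*=\max\tau|_{\partial K\setminus F_{\max}}$. HDG eigenproblem. A number $\lambda_h\in\mathbb R$ and a nontrivial (not all zero) triple $(\vec q_h,u_h,\eta_h)\in V_h\times W_h\times M_h$ solve it if, with $\hat q_h=\vec q_h+\tau(u_h-\eta_h)\vec n$, $(c\,\vec q_h,\vec r)_{\mathcal T_h}-(u_h,\nabla\cdot\vec r)_{\mathcal T_h}+\langle\eta_h,\vec r\cdot\vec n\rangle_{\partial\mathcal T_h}=0$ for all $\vec r\in V_h$; $-(\vec q_h,\nabla w)_{\mathcal T_h}+\langle\hat q_h\cdot\vec n,w\rangle_{\partial\mathcal T_h}=\lambda_h(u_h,w)_{\mathcal T_h}$ for all $w\in W_h$; $\langle\mu,\hat q_h\cdot\vec n\rangle_{\partial\mathcal T_h}=0$ for all $\mu\in M_h$. Local solution operators. $\vec{\mathcal Q}:M_h\to V_h$, $\mathcal U:M_h\to W_h$, $\vec{\mathcal Q}_W:L^2(\Omega)\to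 V_h$, $\mathcal U_W:L^2(\Omega)\to W_h$ are defined on each $K$ by $(c\,\vec{\mathcal Q}\mu,\vec r)_K-(\mathcal U\mu,\nabla\cdot\vec r)_K=-\langle\mu,\vec r\cdot\vec n\rangle_{\partial K}$ and $(w,\nabla\cdot\vec{\mathcal Q}\mu)_K+\langle\tau(\mathcal U\mu-\mu),w\rangle_{\partial K}=0$; $(c\,\vec{\mathcal Q}_Wf,\vec r)_K-(\mathcal U_Wf,\nabla\cdot\vec r)_K=0$ and $(w,\nabla\cdot\vec{\mathcal Q}_Wf)_K+\langle\tau\,\mathcal U_Wf,w\rangle_{\partial K}=(f,w)_K$; for all $\vec r\in V_h$, $w\in W_h$. Also $a_h(\eta,\mu)=(c\,\vec{\mathcal Q}\eta,\vec{\mathcal Q}\mu)_{\mathcal T_h}+\langle\tau(\mathcal U\eta-\eta),\mathcal U\mu-\mu\rangle_{\partial\mathcal T_h}$. Constants. Put $d_{h\tau}^K=1+(\tau_K^{\max}h_K)^{-1/2}$ and $c_{h\tau}^K=1+(\tau_K^*h_K)^{1/2}$. It is assumed there is a mesh-independent $C_*>0$ with $(d_{h\tau}^K)^2h_K\le C_*$ and $c_{h\tau}^K\le C_*$ for all $K$. $C_0>0$ is a constant independent of $h_K$ for which $\|\mathcal U_Wf\|_{L^2(K)}\le C_0(d_{h\tau}^K)^2h_K^2\|f\|_{L^2(K)}$ for all $f\in L^2(K)$ and all $K$ (such a constant is known to exist). *)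

theory Defs
  imports "HOL-Analysis.Analysis"
begin

section \<open>Domain and mesh\<close>

definition polyhedral_domain :: "(real^'n) set \<Rightarrow> bool" where
  "polyhedral_domain \<Omega> \<longleftrightarrow>
     open \<Omega> \<and> connected \<Omega> \<and> bounded \<Omega> \<and> \<Omega> \<noteq> {} \<and>
     (\<exists>\<P>. finite \<P> \<and> (\<forall>P\<in>\<P>. polytope P \<and> aff_dim P = int CARD('n) - 1) \<and>
          frontier \<Omega> = \<Union>\<P>)"

text \<open>A conforming mesh: \<^const>\<open>triangulation\<close> says that the intersection of any two elements is a
  (possibly empty) common face.  Elements are closed simplices of full dimension.\<close>

definition simplicial_mesh :: "(real^'n) set \<Rightarrow> (real^'n) set set \<Rightarrow> bool" where
  "simplicial_mesh \<Omega> T \<longleftrightarrow>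
     triangulation T \<and> (\<forall>K\<in>T. int CARD('n) simplex K) \<and>
     \<Union>T = closure \<Omega> \<and> (\<forall>K\<in>T. interior K \<subseteq> \<Omega>)"

definition mesh_faces :: "(real^'n) set set \<Rightarrow> (real^'n) set set" where
  "mesh_faces T = {F. \<exists>K\<in>T. F facet_of K}"

definition mesh_size :: "(real^'n) set set \<Rightarrow> real" where
  "mesh_size T = Max (diameter ` T)"

definition outward_normal :: "(real^'n) set \<Rightarrow> (real^'n) set \<Rightarrow> real^'n" where
  "outward_normal K F = (THE \<nu>. norm \<nu> = 1 \<and> (\<forall>x\<in>K. \<forall>y\<in>F. \<nu> \<bullet> x \<le> \<nu> \<bullet> y))"

section \<open>The coefficient\<close>

definition admissible_coefficient :: "(real^'n) set \<Rightarrow> real \<Rightarrow> (real^'n \<Rightarrow> real^'n^'n) \<Rightarrow> bool" where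
  "admissible_coefficient \<Omega> B \<alpha> \<longleftrightarrow>
     \<alpha> \<in> borel_measurable (lebesgue_on \<Omega>) \<and>
     (\<forall>x\<in>\<Omega>. transpose (\<alpha> x) = \<alpha> x \<and> (\<forall>v. v \<noteq> 0 \<longrightarrow> 0 < v \<bullet> (\<alpha> x *v v)) \<and>
             norm (\<alpha> x) \<le> B \<and> norm (matrix_inv (\<alpha> x)) \<le> B)"

section \<open>Integrals\<close>

text \<open>The inner product \<open>(v,w)\<^sub>D\<close>, for scalar functions (where \<open>\<bullet>\<close> is multiplication) and for
  vector functions.\<close>

definition vol_ip :: "(real^'n) set \<Rightarrow> (real^'n \<Rightarrow> 'b::real_inner) \<Rightarrow> (real^'n \<Rightarrow> 'b) \<Rightarrow> real" where
  "vol_ip D v w = (LINT x|lebesgue_on D. v x \<bullet> w x)"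

definition mesh_ip :: "(real^'n) set set \<Rightarrow> (real^'n \<Rightarrow> 'b::real_inner) \<Rightarrow> (real^'n \<Rightarrow> 'b) \<Rightarrow> real" where
  "mesh_ip T v w = (\<Sum>K\<in>T. vol_ip K v w)"

text \<open>Integration over a face \<open>F\<close> of codimension one with respect to its \<open>(n-1)\<close>-dimensional
  Lebesgue measure.  With \<open>\<pi>\<close> the orthogonal projection onto the hyperplane spanned by \<open>F\<close>, the set
  integrated over is the right prism \<open>F \<times> [-1/2,1/2]\<close> of thickness one in the normal direction, so by
  Fubini the volume integral of \<open>f \<circ> \<pi>\<close> is the surface integral of \<open>f\<close>.\<close>

definition face_integral :: "(real^'n) set \<Rightarrow> (real^'n \<Rightarrow> real) \<Rightarrow> real" where
  "face_integral F f =
     (let \<pi> = closest_point (affine hull F)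
      in LINT y|lebesgue_on {y. \<pi> y \<in> F \<and> dist y (\<pi> y) \<le> 1/2}. f (\<pi> y))"

text \<open>\<open>\<langle>v,w\<rangle>\<close> over the boundary of \<open>K\<close>.  The integrands may depend on the face, as the normal and the
  penalty function do.\<close>

definition bd_ip :: "(real^'n) set \<Rightarrow> ((real^'n) set \<Rightarrow> real^'n \<Rightarrow> real) \<Rightarrow>
    ((real^'n) set \<Rightarrow> real^'n \<Rightarrow> real) \<Rightarrow> real" where
  "bd_ip K v w = (\<Sum>F | F facet_of K. face_integral F (\<lambda>x. v F x * w F x))"

definition L2 :: "(real^'n) set \<Rightarrow> (real^'n \<Rightarrow> real) set" where
  "L2 D = {f. f \<in> borel_measurable (lebesgue_on D) \<and> integrable (lebesgue_on D) (\<lambda>x. (f x)\<^sup>2)}"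

definition L2_norm :: "(real^'n) set \<Rightarrow> (real^'n \<Rightarrow> real) \<Rightarrow> real" where
  "L2_norm D f = sqrt (LINT x|lebesgue_on D. (f x)\<^sup>2)"

text \<open>Invertibility on the space of square-integrable functions.  Elements of \<^const>\<open>L2\<close> are
  functions rather than classes modulo null sets; the second conjunct says that the bijection and its
  inverse respect equality almost everywhere, i.e. that the map on classes is well defined and
  bijective.\<close>

definition L2_invertible :: "(real^'n) set \<Rightarrow> ((real^'n \<Rightarrow> real) \<Rightarrow> real^'n \<Rightarrow> real) \<Rightarrow> bool" where
  "L2_invertible \<Omega> A \<longleftrightarrow>
     bij_betw A (L2 \<Omega>) (L2 \<Omega>) \<and>
     (\<forall>f\<in>L2 \<Omega>. \<forall>g\<in>L2 \<Omega>.
        (AE x in lebesgue_on \<Omega>. A f x = A g x) \<longleftrightarrow> (AE x in lebesgue_on \<Omega>. f x = g x))"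

section \<open>Piecewise polynomial spaces\<close>

definition polynomials :: "nat \<Rightarrow> (real^'n \<Rightarrow> real) set" where
  "polynomials k = {p. \<exists>a :: ('n \<Rightarrow> nat) \<Rightarrow> real.
     \<forall>x. p x = (\<Sum>m | sum m UNIV \<le> k. a m * (\<Prod>i\<in>UNIV. (x $ i) ^ m i))}"

definition poly_on :: "nat \<Rightarrow> (real^'n) set \<Rightarrow> (real^'n \<Rightarrow> real) \<Rightarrow> bool" where
  "poly_on k D f \<longleftrightarrow> (\<exists>p\<in>polynomials k. \<forall>x\<in>D. f x = p x)"

text \<open>Functions in the discrete spaces are polynomial on the (disjoint) interiors of the elements,
  respectively on the relative interiors of the faces.  Their values elsewhere, a null set, are fixed to
  be zero, so that each element of the mathematical space has exactly one representative.\<close>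

definition Wh :: "nat \<Rightarrow> (real^'n) set set \<Rightarrow> (real^'n \<Rightarrow> real) set" where
  "Wh k T = {w. (\<forall>K\<in>T. poly_on k (interior K) w) \<and> (\<forall>x. x \<notin> (\<Union>K\<in>T. interior K) \<longrightarrow> w x = 0)}"

definition Vh :: "nat \<Rightarrow> (real^'n) set set \<Rightarrow> (real^'n \<Rightarrow> real^'n) set" where
  "Vh k T = {v. (\<forall>K\<in>T. \<forall>i. poly_on k (interior K) (\<lambda>x. v x $ i)) \<and>
                (\<forall>x. x \<notin> (\<Union>K\<in>T. interior K) \<longrightarrow> v x = 0)}"

definition Mh :: "(real^'n) set \<Rightarrow> nat \<Rightarrow> (real^'n) set set \<Rightarrow> (real^'n \<Rightarrow> real) set" where
  "Mh \<Omega> k T = {\<mu>. (\<forall>F\<in>mesh_faces T. poly_on k (rel_interior F) \<mu>) \<and>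
                  (\<forall>F\<in>mesh_faces T. F \<subseteq> frontier \<Omega> \<longrightarrow> (\<forall>x\<in>rel_interior F. \<mu> x = 0)) \<and>
                  (\<forall>x. x \<notin> (\<Union>F\<in>mesh_faces T. rel_interior F) \<longrightarrow> \<mu> x = 0)}"

text \<open>Trace from inside \<open>K\<close>.\<close>

definition trace :: "(real^'n) set \<Rightarrow> (real^'n \<Rightarrow> 'b::t2_space) \<Rightarrow> real^'n \<Rightarrow> 'b" where
  "trace K w x = Lim (at x within interior K) w"

text \<open>Pointwise derivatives.  They are only used under integrals over elements, for functions that are
  polynomial in the interior of the element.\<close>

definition grad :: "(real^'n \<Rightarrow> real) \<Rightarrow> real^'n \<Rightarrow> real^'n" where
  "grad w x = (\<chi> i. frechet_derivative w (at x) (axis i 1))"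

definition dive :: "(real^'n \<Rightarrow> real^'n) \<Rightarrow> real^'n \<Rightarrow> real" where
  "dive r x = (\<Sum>i\<in>UNIV. frechet_derivative r (at x) (axis i 1) $ i)"

section \<open>Penalty function\<close>

text \<open>The penalty function is double-valued and constant on each face of each element:
  \<open>\<tau> K F\<close> is its value on the face \<open>F\<close> seen from \<open>K\<close>.\<close>

type_synonym 'n penalty = "(real^'n) set \<Rightarrow> (real^'n) set \<Rightarrow> real"

definition admissible_penalty :: "(real^'n) set set \<Rightarrow> 'n penalty \<Rightarrow> bool" where
  "admissible_penalty T \<tau> \<longleftrightarrow>
     (\<forall>K\<in>T. (\<forall>F. F facet_of K \<longrightarrow> 0 \<le> \<tau> K F) \<and> (\<exists>F. F facet_of K \<and> 0 < \<tau> K F))"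

definition tau_max :: "'n penalty \<Rightarrow> (real^'n) set \<Rightarrow> real" where
  "tau_max \<tau> K = Max {\<tau> K F | F. F facet_of K}"

definition F_max :: "'n penalty \<Rightarrow> (real^'n) set \<Rightarrow> (real^'n) set" where
  "F_max \<tau> K = (SOME F. F facet_of K \<and> \<tau> K F = tau_max \<tau> K)"

definition tau_star :: "'n penalty \<Rightarrow> (real^'n) set \<Rightarrow> real" where
  "tau_star \<tau> K = Max {\<tau> K F | F. F facet_of K \<and> F \<noteq> F_max \<tau> K}"

definition d_const :: "'n penalty \<Rightarrow> (real^'n) set \<Rightarrow> real" where
  "d_const \<tau> K = 1 + (tau_max \<tau> K * diameter K) powr (-1/2)"

definition c_const :: "'n penalty \<Rightarrow> (real^'n) set \<Rightarrow> real" where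
  "c_const \<tau> K = 1 + (tau_star \<tau> K * diameter K) powr (1/2)"

section \<open>The HDG eigenproblem\<close>

text \<open>Normal component on \<open>F\<close>, seen from \<open>K\<close>, of the numerical flux \<open>q + \<tau> (u - \<eta>) n\<close>.\<close>

definition flux_normal :: "'n penalty \<Rightarrow> (real^'n \<Rightarrow> real^'n) \<Rightarrow> (real^'n \<Rightarrow> real) \<Rightarrow>
    (real^'n \<Rightarrow> real) \<Rightarrow> (real^'n) set \<Rightarrow> (real^'n) set \<Rightarrow> real^'n \<Rightarrow> real" where
  "flux_normal \<tau> q u \<eta> K F x =
     (trace K q x + (\<tau> K F * (trace K u x - \<eta> x)) *\<^sub>R outward_normal K F) \<bullet> outward_normal K F"

definition solves_HDG :: "(real^'n) set \<Rightarrow> (real^'n \<Rightarrow> real^'n^'n) \<Rightarrow> 'n penalty \<Rightarrow> nat \<Rightarrow>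
    (real^'n) set set \<Rightarrow> real \<Rightarrow> (real^'n \<Rightarrow> real^'n) \<Rightarrow> (real^'n \<Rightarrow> real) \<Rightarrow> (real^'n \<Rightarrow> real) \<Rightarrow> bool" where
  "solves_HDG \<Omega> \<alpha> \<tau> k T lam q u \<eta> \<longleftrightarrow>
     q \<in> Vh k T \<and> u \<in> Wh k T \<and> \<eta> \<in> Mh \<Omega> k T \<and>
     \<not> (q = (\<lambda>_. 0) \<and> u = (\<lambda>_. 0) \<and> \<eta> = (\<lambda>_. 0)) \<and>
     (\<forall>r\<in>Vh k T.
        mesh_ip T (\<lambda>x. matrix_inv (\<alpha> x) *v q x) r - mesh_ip T u (dive r)
        + (\<Sum>K\<in>T. bd_ip K (\<lambda>F. \<eta>) (\<lambda>F x. trace K r x \<bullet> outward_normal K F)) = 0) \<and>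
     (\<forall>w\<in>Wh k T.
        - mesh_ip T q (grad w)
        + (\<Sum>K\<in>T. bd_ip K (flux_normal \<tau> q u \<eta> K) (\<lambda>F. trace K w)) = lam * mesh_ip T u w) \<and>
     (\<forall>\<mu>\<in>Mh \<Omega> k T. (\<Sum>K\<in>T. bd_ip K (\<lambda>F. \<mu>) (flux_normal \<tau> q u \<eta> K)) = 0)"

section \<open>Local solution operators\<close>

text \<open>The pair \<open>(\<Q> \<mu>, \<U> \<mu>)\<close>.\<close>

definition lift_M :: "(real^'n \<Rightarrow> real^'n^'n) \<Rightarrow> 'n penalty \<Rightarrow> nat \<Rightarrow> (real^'n) set set \<Rightarrow>
    (real^'n \<Rightarrow> real) \<Rightarrow> (real^'n \<Rightarrow> real^'n) \<times> (real^'n \<Rightarrow> real)" where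
  "lift_M \<alpha> \<tau> k T \<mu> = (THE (q, u). q \<in> Vh k T \<and> u \<in> Wh k T \<and>
     (\<forall>K\<in>T.
       (\<forall>r\<in>Vh k T. vol_ip K (\<lambda>x. matrix_inv (\<alpha> x) *v q x) r - vol_ip K u (dive r)
          = - bd_ip K (\<lambda>F. \<mu>) (\<lambda>F x. trace K r x \<bullet> outward_normal K F)) \<and>
       (\<forall>w\<in>Wh k T. vol_ip K w (dive q)
          + bd_ip K (\<lambda>F x. \<tau> K F * (trace K u x - \<mu> x)) (\<lambda>F. trace K w) = 0)))"

definition Q_op :: "(real^'n \<Rightarrow> real^'n^'n) \<Rightarrow> 'n penalty \<Rightarrow> nat \<Rightarrow> (real^'n) set set \<Rightarrow>
    (real^'n \<Rightarrow> real) \<Rightarrow> real^'n \<Rightarrow> real^'n" where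
  "Q_op \<alpha> \<tau> k T \<mu> = fst (lift_M \<alpha> \<tau> k T \<mu>)"

definition U_op :: "(real^'n \<Rightarrow> real^'n^'n) \<Rightarrow> 'n penalty \<Rightarrow> nat \<Rightarrow> (real^'n) set set \<Rightarrow>
    (real^'n \<Rightarrow> real) \<Rightarrow> real^'n \<Rightarrow> real" where
  "U_op \<alpha> \<tau> k T \<mu> = snd (lift_M \<alpha> \<tau> k T \<mu>)"

text \<open>The pair \<open>(\<Q>\<^sub>W f, \<U>\<^sub>W f)\<close>.\<close>

definition lift_W :: "(real^'n \<Rightarrow> real^'n^'n) \<Rightarrow> 'n penalty \<Rightarrow> nat \<Rightarrow> (real^'n) set set \<Rightarrow>
    (real^'n \<Rightarrow> real) \<Rightarrow> (real^'n \<Rightarrow> real^'n) \<times> (real^'n \<Rightarrow> real)" where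
  "lift_W \<alpha> \<tau> k T f = (THE (q, u). q \<in> Vh k T \<and> u \<in> Wh k T \<and>
     (\<forall>K\<in>T.
       (\<forall>r\<in>Vh k T. vol_ip K (\<lambda>x. matrix_inv (\<alpha> x) *v q x) r - vol_ip K u (dive r) = 0) \<and>
       (\<forall>w\<in>Wh k T. vol_ip K w (dive q)
          + bd_ip K (\<lambda>F x. \<tau> K F * trace K u x) (\<lambda>F. trace K w) = vol_ip K f w)))"

definition QW_op :: "(real^'n \<Rightarrow> real^'n^'n) \<Rightarrow> 'n penalty \<Rightarrow> nat \<Rightarrow> (real^'n) set set \<Rightarrow>
    (real^'n \<Rightarrow> real) \<Rightarrow> real^'n \<Rightarrow> real^'n" where
  "QW_op \<alpha> \<tau> k T f = fst (lift_W \<alpha> \<tau> k T f)"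

definition UW_op :: "(real^'n \<Rightarrow> real^'n^'n) \<Rightarrow> 'n penalty \<Rightarrow> nat \<Rightarrow> (real^'n) set set \<Rightarrow>
    (real^'n \<Rightarrow> real) \<Rightarrow> real^'n \<Rightarrow> real" where
  "UW_op \<alpha> \<tau> k T f = snd (lift_W \<alpha> \<tau> k T f)"

definition I_minus_UW :: "(real^'n \<Rightarrow> real^'n^'n) \<Rightarrow> 'n penalty \<Rightarrow> nat \<Rightarrow> (real^'n) set set \<Rightarrow>
    real \<Rightarrow> (real^'n \<Rightarrow> real) \<Rightarrow> real^'n \<Rightarrow> real" where
  "I_minus_UW \<alpha> \<tau> k T lam f = (\<lambda>x. f x - lam * UW_op \<alpha> \<tau> k T f x)"

definition a_h :: "(real^'n \<Rightarrow> real^'n^'n) \<Rightarrow> 'n penalty \<Rightarrow> nat \<Rightarrow> (real^'n) set set \<Rightarrow>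
    (real^'n \<Rightarrow> real) \<Rightarrow> (real^'n \<Rightarrow> real) \<Rightarrow> real" where
  "a_h \<alpha> \<tau> k T \<eta> \<mu> =
     mesh_ip T (\<lambda>x. matrix_inv (\<alpha> x) *v Q_op \<alpha> \<tau> k T \<eta> x) (Q_op \<alpha> \<tau> k T \<mu>)
     + (\<Sum>K\<in>T. bd_ip K (\<lambda>F x. \<tau> K F * (trace K (U_op \<alpha> \<tau> k T \<eta>) x - \<eta> x))
                      (\<lambda>F x. trace K (U_op \<alpha> \<tau> k T \<mu>) x - \<mu> x))"

end

theory Submission
  imports Defs
begin

text \<open>
  The proof revolves around one linear system on each element, with data \<open>\<mu>\<close> on the faces and \<open>f\<close> in the
  interior: \<open>(c q, r) - (u, div r) = - \<langle>\<mu>, r \<bullet> n\<rangle>\<close> and \<open>(w, div q) + \<langle>\<tau> (u - \<mu>), w\<rangle> = (f, w)\<close> for all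
  polynomial \<open>r\<close> and \<open>w\<close>.  The pairs \<open>(\<Q> \<mu>, \<U> \<mu>)\<close> and \<open>(\<Q>\<^sub>W f, \<U>\<^sub>W f)\<close> are its solutions for one kind of
  data each.

  Let \<open>u = (I - \<lambda> \<U>\<^sub>W)\<^sup>-\<^sup>1 \<U> \<eta>\<close>, so \<open>u = \<U> \<eta> + \<lambda> \<U>\<^sub>W u\<close>, and let \<open>q = \<Q> \<eta> + \<lambda> \<Q>\<^sub>W u\<close>.  By linearity \<open>(q, u)\<close> solves
  the system with data \<open>\<eta>\<close> and \<open>\<lambda> u\<close>.  After an integration by parts in the second equation, these are the
  first two equations of the eigenproblem, whatever \<open>\<eta>\<close> is.  What remains is the continuity of the
  normal flux.  Testing it with \<open>\<mu>\<close> and using the equations of \<open>(\<Q> \<mu>, \<U> \<mu>)\<close> turns the sum of the boundary terms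
  into \<open>\<lambda> (u, \<U> \<mu>) - a\<^sub>h(\<eta>, \<mu>)\<close> (\<open>flux_against_face_function\<close> and \<open>lift_W_orthogonal_lift_M\<close>, combined in
  \<open>condensed_iff_HDG\<close>), so it vanishes for all \<open>\<mu>\<close> exactly when the condensed equation holds.

  The bound on \<open>\<lambda>\<close> makes \<open>\<lambda> \<U>\<^sub>W\<close> a contraction in \<open>L\<^sup>2\<close> of each element, hence \<open>I - \<lambda> \<U>\<^sub>W\<close> injective.  It is
  surjective because \<open>f - \<lambda> \<U>\<^sub>W f = g\<close> reduces to the finite-dimensional system with \<open>- \<lambda> (u, w)\<close> added to the
  second equation, whose homogeneous solutions are fixed points of the contraction
  (\<open>I_minus_UW_invertible\<close>).

  Two ingredients are needed.  The first is the unique solvability of the local systems.  A solution of the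
  homogeneous system has \<open>(c q, q) + \<langle>\<tau> u, u\<rangle> = 0\<close>; so \<open>q = 0\<close>, and \<open>u\<close> vanishes on a face and is orthogonal to all
  divergences, which forces \<open>u = 0\<close> (\<open>local_unique\<close>).  Existence is the Fredholm alternative: the
  adjoint system is the system itself with the sign of \<open>q\<close> reversed (\<open>local_solvable\<close>).

  The second is the divergence theorem on a simplex, for face integrals that are defined as volume
  integrals over prisms.  When the simplex is translated along one of its edges, what it gains and
  what it loses are the two slabs swept by the faces opposite to the end points of the edge, and a slab is a
  linear image of the prism.  Dividing by the length of the translation gives the theorem for the
  direction of the edge (\<open>edge_derivative_integral\<close>), and the edges span the space
  (\<open>partial_derivative_integral\<close>).
\<close>

section \<open>Polynomials in several variables\<close>

definition monomial_fun :: "('n \<Rightarrow> nat) \<Rightarrow> real^'n \<Rightarrow> real" where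
  "monomial_fun m x = (\<Prod>i\<in>UNIV. (x $ i) ^ m i)"

lemma finite_exponents: "finite {m :: 'n::finite \<Rightarrow> nat. sum m UNIV \<le> k}"
proof (rule finite_subset)
  have "m i \<le> k" if "sum m UNIV \<le> k" for m :: "'n \<Rightarrow> nat" and i
    using that member_le_sum[of i UNIV m] by auto
  then show "{m :: 'n \<Rightarrow> nat. sum m UNIV \<le> k} \<subseteq> PiE UNIV (\<lambda>_. {..k})"
    by auto
qed (auto intro: finite_PiE)

lemma polynomials_iff:
  "p \<in> polynomials k \<longleftrightarrow> (\<exists>a. p = (\<lambda>x. \<Sum>m | sum m UNIV \<le> k. a m * monomial_fun m x))"
  by (auto simp: polynomials_def monomial_fun_def fun_eq_iff)

lemma polynomials_add:
  assumes "p \<in> polynomials k" "q \<in> polynomials k"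
  shows "(\<lambda>x. p x + q x) \<in> polynomials k"
proof -
  obtain a b where "p = (\<lambda>x. \<Sum>m | sum m UNIV \<le> k. a m * monomial_fun m x)"
    "q = (\<lambda>x. \<Sum>m | sum m UNIV \<le> k. b m * monomial_fun m x)"
    using assms by (auto simp: polynomials_iff)
  then show ?thesis
    unfolding polynomials_iff
    by (intro exI[of _ "\<lambda>m. a m + b m"]) (simp add: sum.distrib distrib_right)
qed

lemma polynomials_scale:
  assumes "p \<in> polynomials k"
  shows "(\<lambda>x. c * p x) \<in> polynomials k"
proof -
  obtain a where "p = (\<lambda>x. \<Sum>m | sum m UNIV \<le> k. a m * monomial_fun m x)"
    using assms by (auto simp: polynomials_iff)
  then show ?thesis
    unfolding polynomials_iff
    by (intro exI[of _ "\<lambda>m. c * a m"]) (simp add: sum_distrib_left mult.assoc)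
qed

lemma polynomials_zero: "(\<lambda>x. 0) \<in> polynomials k"
  unfolding polynomials_iff by (intro exI[of _ "\<lambda>m. 0"]) simp

lemma polynomials_sum:
  assumes "\<And>i. i \<in> I \<Longrightarrow> p i \<in> polynomials k"
  shows "(\<lambda>x. \<Sum>i\<in>I. p i x) \<in> polynomials k"
  using assms by (induction I rule: infinite_finite_induct) (auto intro: polynomials_add polynomials_zero)

lemma polynomials_diff:
  assumes "p \<in> polynomials k" "q \<in> polynomials k"
  shows "(\<lambda>x. p x - q x) \<in> polynomials k"
  using polynomials_add[OF assms(1) polynomials_scale[OF assms(2), of "-1"]] by simp

lemma monomial_fun_in_polynomials:
  fixes m :: "'n::finite \<Rightarrow> nat"
  assumes "sum m UNIV \<le> k"
  shows "monomial_fun m \<in> polynomials k"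
proof -
  have "(\<Sum>m' | sum m' UNIV \<le> k. (if m' = m then 1 else 0) * monomial_fun m' x) = monomial_fun m x" for x
    using assms finite_exponents[of k, where 'n='n] by (simp add: if_distrib[of "\<lambda>c. c * _"] cong: if_cong)
  then show ?thesis
    unfolding polynomials_iff by (intro exI[of _ "\<lambda>m'. if m' = m then 1 else 0"]) simp
qed

text \<open>Linearity reduces a statement about all polynomials to monomials.\<close>

lemma polynomials_monomial_induct [consumes 1, case_names monomial add scale]:
  fixes p :: "real^'n \<Rightarrow> real"
  assumes "p \<in> polynomials k"
    and mono: "\<And>m :: 'n \<Rightarrow> nat. sum m UNIV \<le> k \<Longrightarrow> P (monomial_fun m)"
    and add: "\<And>p q. p \<in> polynomials k \<Longrightarrow> q \<in> polynomials k \<Longrightarrow> P p \<Longrightarrow> P q \<Longrightarrow> P (\<lambda>x. p x + q x)"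
    and scale: "\<And>c p. p \<in> polynomials k \<Longrightarrow> P p \<Longrightarrow> P (\<lambda>x. c * p x)"
  shows "P p"
proof -
  obtain a where p: "p = (\<lambda>x. \<Sum>m | sum m UNIV \<le> k. a m * monomial_fun m x)"
    using assms(1) by (auto simp: polynomials_iff)
  have "P (\<lambda>x. \<Sum>m\<in>M. a m * monomial_fun m x) \<and> (\<lambda>x. \<Sum>m\<in>M. a m * monomial_fun m x) \<in> polynomials k"
    if "finite M" "M \<subseteq> {m. sum m UNIV \<le> k}" for M
    using that
  proof (induction M rule: finite_induct)
    case empty
    have "P (\<lambda>x. 0 * monomial_fun (\<lambda>_. 0) x)"
      by (intro scale mono monomial_fun_in_polynomials) auto
    then show ?case by (simp add: polynomials_zero)
  next
    case (insert m M)
    then have "P (\<lambda>x. a m * monomial_fun m x)" "(\<lambda>x. a m * monomial_fun m x) \<in> polynomials k"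
      by (auto intro: scale mono monomial_fun_in_polynomials polynomials_scale)
    with insert show ?case
      by (auto intro: add polynomials_add)
  qed
  from this[of "{m. sum m UNIV \<le> k}"] finite_exponents show ?thesis
    by (auto simp: p)
qed

lemma polynomials_mono:
  assumes "p \<in> polynomials k" "k \<le> k'"
  shows "p \<in> polynomials k'"
  using assms by (induction rule: polynomials_monomial_induct)
    (auto intro: monomial_fun_in_polynomials polynomials_add polynomials_scale)

lemma monomial_fun_mult: "monomial_fun m x * monomial_fun m' x = monomial_fun (\<lambda>i. m i + m' i) x"
  by (simp add: monomial_fun_def power_add prod.distrib)

lemma polynomials_mult:
  assumes "p \<in> polynomials a" "q \<in> polynomials b"
  shows "(\<lambda>x. p x * q x) \<in> polynomials (a + b)"
  using assms(1)
proof (induction rule: polynomials_monomial_induct)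
  case (monomial m)
  show ?case using assms(2)
  proof (induction rule: polynomials_monomial_induct)
    case (monomial m')
    with \<open>sum m UNIV \<le> a\<close> show ?case
      by (auto simp: monomial_fun_mult[of m _ m'] sum.distrib intro!: monomial_fun_in_polynomials)
  next
    case (add p q)
    then show ?case using polynomials_add[of "\<lambda>x. monomial_fun m x * p x" _ "\<lambda>x. monomial_fun m x * q x"]
      by (simp add: distrib_left)
  next
    case (scale c p)
    then show ?case using polynomials_scale[of "\<lambda>x. monomial_fun m x * p x" _ c]
      by (simp add: mult.left_commute)
  qed
next
  case (add p p')
  then show ?case using polynomials_add[of "\<lambda>x. p x * q x" _ "\<lambda>x. p' x * q x"]
    by (simp add: distrib_right)
next
  case (scale c p)
  then show ?case using polynomials_scale[of "\<lambda>x. p x * q x" _ c]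
    by (simp add: mult.assoc)
qed

lemma polynomials_const: "(\<lambda>x. c) \<in> polynomials k"
proof -
  have "monomial_fun (\<lambda>_. 0) \<in> polynomials k"
    by (rule monomial_fun_in_polynomials) simp
  from polynomials_scale[OF this, of c] show ?thesis by (simp add: monomial_fun_def)
qed

lemma monomial_fun_coord: "monomial_fun (\<lambda>j. if j = i then 1 else 0) x = x $ i"
proof -
  have "(\<Prod>j\<in>UNIV. (x $ j) ^ (if j = i then 1 else 0)) = (\<Prod>j\<in>UNIV. if j = i then x $ j else 1)"
    by (rule prod.cong) auto
  then show ?thesis by (simp add: monomial_fun_def)
qed

lemma polynomials_coord: "(\<lambda>x. x $ i) \<in> polynomials (Suc k)"
proof -
  have "monomial_fun (\<lambda>j. if j = i then 1 else 0) \<in> polynomials (Suc k)"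
    by (rule monomial_fun_in_polynomials) simp
  then show ?thesis by (simp add: monomial_fun_coord[abs_def])
qed

text \<open>Induction along Horner's scheme: it suffices to multiply by one coordinate at a time.\<close>

lemma polynomials_induct [consumes 1, case_names const add scale coord]:
  fixes p :: "real^'n \<Rightarrow> real"
  assumes "p \<in> polynomials k"
    and const: "\<And>k c. P k (\<lambda>_. c)"
    and add: "\<And>k p q. p \<in> polynomials k \<Longrightarrow> q \<in> polynomials k \<Longrightarrow> P k p \<Longrightarrow> P k q \<Longrightarrow> P k (\<lambda>x. p x + q x)"
    and scale: "\<And>k c p. p \<in> polynomials k \<Longrightarrow> P k p \<Longrightarrow> P k (\<lambda>x. c * p x)"
    and coord: "\<And>k i p. p \<in> polynomials k \<Longrightarrow> P k p \<Longrightarrow> P (Suc k) (\<lambda>x. x $ i * p x)"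
  shows "P k p"
  using assms(1)
proof (induction rule: polynomials_monomial_induct)
  case (monomial m)
  then show ?case
  proof (induction k arbitrary: m)
    case 0
    then have "m = (\<lambda>_. 0)" by (auto simp: fun_eq_iff)
    then show ?case using const[of 0 1] by (simp add: monomial_fun_def[abs_def])
  next
    case (Suc k)
    show ?case
    proof (cases "m = (\<lambda>_. 0)")
      case True
      then show ?thesis using const[of _ 1] by (simp add: monomial_fun_def[abs_def])
    next
      case False
      then obtain i where i: "m i \<noteq> 0" by auto
      define m' where "m' = (\<lambda>j. if j = i then m i - 1 else m j)"
      have m: "m = (\<lambda>j. (if j = i then 1 else 0) + m' j)"
        using i by (auto simp: m'_def)
      have "sum m UNIV = 1 + sum m' UNIV"
        by (subst m) (simp only: sum.distrib, simp)
      then have "sum m' UNIV \<le> k" using Suc.prems by simp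
      then have "P (Suc k) (\<lambda>x. x $ i * monomial_fun m' x)"
        by (intro coord monomial_fun_in_polynomials Suc.IH)
      moreover have "(\<lambda>x. x $ i * monomial_fun m' x) = monomial_fun m"
      proof
        fix x :: "real^'n"
        have "x $ i * monomial_fun m' x = monomial_fun (\<lambda>j. if j = i then 1 else 0) x * monomial_fun m' x"
          by (simp only: monomial_fun_coord)
        also have "\<dots> = monomial_fun m x"
          by (simp only: monomial_fun_mult m[symmetric])
        finally show "x $ i * monomial_fun m' x = monomial_fun m x" .
      qed
      ultimately show ?thesis by simp
    qed
  qed
qed (auto intro: add scale)

lemma polynomials_continuous_on: "p \<in> polynomials k \<Longrightarrow> continuous_on S p"
  by (induction rule: polynomials_induct) (auto intro!: continuous_intros)

lemma polynomials_line:
  assumes "p \<in> polynomials k"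
  shows "\<exists>Q. \<forall>t. p (x + t *\<^sub>R d) = poly Q t"
  using assms
proof (induction rule: polynomials_induct)
  case (const k c)
  show ?case by (intro exI[of _ "[:c:]"]) simp
next
  case (add k p q)
  then obtain Q R where "\<forall>t. p (x + t *\<^sub>R d) = poly Q t" "\<forall>t. q (x + t *\<^sub>R d) = poly R t" by blast
  then show ?case by (intro exI[of _ "Q + R"]) simp
next
  case (scale k c p)
  then obtain Q where "\<forall>t. p (x + t *\<^sub>R d) = poly Q t" by blast
  then show ?case by (intro exI[of _ "smult c Q"]) simp
next
  case (coord k i p)
  then obtain Q where "\<forall>t. p (x + t *\<^sub>R d) = poly Q t" by blast
  then show ?case by (intro exI[of _ "[:x $ i, d $ i:] * Q"]) (simp add: algebra_simps)
qed

text \<open>A polynomial in one variable has finitely many zeros, so along every line through the open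
  piece the polynomial vanishes identically.\<close>

lemma polynomials_zero_on_affine:
  fixes p :: "real^'n \<Rightarrow> real"
  assumes p: "p \<in> polynomials k" and A: "affine A"
    and U: "openin (top_of_set A) U" "U \<noteq> {}" and z: "\<And>x. x \<in> U \<Longrightarrow> p x = 0" and y: "y \<in> A"
  shows "p y = 0"
proof -
  obtain x where x: "x \<in> U" using U by blast
  then have "x \<in> A" using U(1) openin_imp_subset by blast
  obtain e where e: "e > 0" "\<And>z. z \<in> A \<Longrightarrow> dist z x < e \<Longrightarrow> z \<in> U"
    using U(1) x by (auto simp: openin_euclidean_subtopology_iff)
  obtain Q where Q: "\<And>t. p (x + t *\<^sub>R (y - x)) = poly Q t" using polynomials_line[OF p] by metis
  define d where "d = e / (norm (y - x) + 1)"
  have d: "d > 0" using e by (simp add: d_def add_nonneg_pos)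
  have "poly Q t = 0" if t: "0 < t" "t < d" for t
  proof -
    have "x + t *\<^sub>R (y - x) = (1 - t) *\<^sub>R x + t *\<^sub>R y" by (simp add: algebra_simps)
    then have "x + t *\<^sub>R (y - x) \<in> A" using A \<open>x \<in> A\<close> y by (simp add: affine_alt)
    moreover have "t * norm (y - x) < e"
    proof -
      have "t * norm (y - x) \<le> t * (norm (y - x) + 1)" using t by simp
      also have "\<dots> < d * (norm (y - x) + 1)" using t by (intro mult_strict_right_mono add_nonneg_pos) auto
      also have "\<dots> = e"
        using norm_ge_zero[of "y - x"] by (simp add: d_def add_nonneg_eq_0_iff)
      finally show ?thesis .
    qed
    ultimately show ?thesis
      using e(2)[of "x + t *\<^sub>R (y - x)"] z[of "x + t *\<^sub>R (y - x)"] Q[of t] t by (simp add: dist_norm)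
  qed
  then have "{0<..<d} \<subseteq> {t. poly Q t = 0}" by auto
  then have "infinite {t. poly Q t = 0}" using d infinite_Ioo[of 0 d] finite_subset by blast
  then have "Q = 0" using poly_roots_finite by blast
  then show ?thesis using Q[of 1] by simp
qed

lemma polynomials_derivative:
  fixes p :: "real^'n \<Rightarrow> real"
  assumes "p \<in> polynomials k"
  shows "\<exists>D. (\<forall>i. D i \<in> polynomials k) \<and> (\<forall>x. (p has_derivative (\<lambda>h. \<Sum>i\<in>UNIV. h $ i * D i x)) (at x))"
  using assms
proof (induction rule: polynomials_induct)
  case (const k c)
  show ?case by (intro exI[of _ "\<lambda>i x. 0"]) (auto intro: polynomials_zero)
next
  case (add k p q)
  then obtain D E where "\<forall>i. D i \<in> polynomials k" "\<forall>x. (p has_derivative (\<lambda>h. \<Sum>i\<in>UNIV. h $ i * D i x)) (at x)"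
    "\<forall>i. E i \<in> polynomials k" "\<forall>x. (q has_derivative (\<lambda>h. \<Sum>i\<in>UNIV. h $ i * E i x)) (at x)" by blast
  then show ?case
    by (intro exI[of _ "\<lambda>i x. D i x + E i x"])
       (auto simp: distrib_left sum.distrib intro: polynomials_add intro!: has_derivative_add)
next
  case (scale k c p)
  then obtain D where D: "\<forall>i. D i \<in> polynomials k" "\<forall>x. (p has_derivative (\<lambda>h. \<Sum>i\<in>UNIV. h $ i * D i x)) (at x)" by blast
  have "((\<lambda>x. c * p x) has_derivative (\<lambda>h. \<Sum>i\<in>UNIV. h $ i * (c * D i x))) (at x)" for x
    by (rule has_derivative_eq_rhs, rule has_derivative_mult_right, rule D(2)[rule_format])
       (simp add: sum_distrib_left mult.left_commute)
  then show ?case using D(1)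
    by (intro exI[of _ "\<lambda>i x. c * D i x"]) (auto intro: polynomials_scale)
next
  case (coord k i p)
  then obtain D where D: "\<forall>i. D i \<in> polynomials k" "\<forall>x. (p has_derivative (\<lambda>h. \<Sum>i\<in>UNIV. h $ i * D i x)) (at x)" by blast
  define E where "E j x = (if j = i then p x else 0) + x $ i * D j x" for j x
  have "E j \<in> polynomials (Suc k)" for j
  proof -
    have 1: "(\<lambda>x. x $ i * D j x) \<in> polynomials (Suc k)"
      using polynomials_mult[OF polynomials_coord[of i 0], of "D j" k] D(1) by simp
    have 2: "(\<lambda>x. if j = i then p x else 0) \<in> polynomials (Suc k)"
      using polynomials_mono[OF coord.hyps, of "Suc k"] polynomials_zero by (cases "j = i") auto
    show ?thesis unfolding E_def[abs_def] by (rule polynomials_add[OF 2 1])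
  qed
  moreover have "((\<lambda>x. x $ i * p x) has_derivative (\<lambda>h. \<Sum>j\<in>UNIV. h $ j * E j x)) (at x)" for x
  proof (rule has_derivative_eq_rhs)
    show "((\<lambda>x. x $ i * p x) has_derivative (\<lambda>h. x $ i * (\<Sum>j\<in>UNIV. h $ j * D j x) + h $ i * p x)) (at x)"
      by (intro has_derivative_mult D(2)[rule_format] bounded_linear.has_derivative[OF bounded_linear_vec_nth] has_derivative_ident)
    have "h $ j * E j x = (if j = i then h $ i * p x else 0) + x $ i * (h $ j * D j x)" for h j
      by (auto simp: E_def algebra_simps)
    then show "(\<lambda>h. x $ i * (\<Sum>j\<in>UNIV. h $ j * D j x) + h $ i * p x) = (\<lambda>h. \<Sum>j\<in>UNIV. h $ j * E j x)"
      by (simp add: sum.distrib sum_distrib_left add.commute)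
  qed
  ultimately show ?case by blast
qed

text \<open>Only monomials need to be integrated: in \<open>x\<^sub>i\<close>, the one with exponent \<open>m\<^sub>i\<close> has the primitive with
  exponent \<open>m\<^sub>i + 1\<close>.\<close>

lemma polynomials_antiderivative:
  fixes p :: "real^'n \<Rightarrow> real"
  assumes "p \<in> polynomials k"
  shows "\<exists>P\<in>polynomials (Suc k). \<forall>x. ((\<lambda>t. P (x + t *\<^sub>R axis i 1)) has_real_derivative p x) (at 0)"
  using assms
proof (induction rule: polynomials_monomial_induct)
  case (monomial m)
  define P where "P x = (1 / real (Suc (m i))) * (x $ i * monomial_fun m x)" for x :: "real^'n"
  have "P \<in> polynomials (Suc k)"
    unfolding P_def[abs_def]
    using polynomials_scale[OF polynomials_mult[OF polynomials_coord[of i 0] monomial_fun_in_polynomials[OF monomial]],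
        of "1 / real (Suc (m i))"]
    by (simp only: plus_nat.add_Suc plus_nat.add_0)
  moreover have "((\<lambda>t. P (x + t *\<^sub>R axis i 1)) has_real_derivative monomial_fun m x) (at 0)" for x
  proof -
    define C where "C = (\<Prod>j\<in>UNIV - {i}. (x $ j) ^ m j)"
    have mf: "monomial_fun m (x + t *\<^sub>R axis i 1) = (x $ i + t) ^ m i * C" for t
      unfolding monomial_fun_def C_def
      by (subst prod.remove[of UNIV i]) (auto simp: axis_def intro!: prod.cong)
    have "P (x + t *\<^sub>R axis i 1) = (1 / real (Suc (m i))) * ((x $ i + t) ^ Suc (m i) * C)" for t
      unfolding P_def mf by (simp add: mult_ac)
    then have "(\<lambda>t. P (x + t *\<^sub>R axis i 1)) = (\<lambda>t. (1 / real (Suc (m i))) * ((x $ i + t) ^ Suc (m i) * C))"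
      by blast
    moreover have "((\<lambda>t. (1 / real (Suc (m i))) * ((x $ i + t) ^ Suc (m i) * C)) has_real_derivative
        (x $ i) ^ m i * C) (at 0)"
      by (auto intro!: derivative_eq_intros simp del: power_Suc simp: divide_simps)
    ultimately show ?thesis using mf[of 0] by simp
  qed
  ultimately show ?case by blast
next
  case (add p q)
  then obtain P Q where "P \<in> polynomials (Suc k)" "\<forall>x. ((\<lambda>t. P (x + t *\<^sub>R axis i 1)) has_real_derivative p x) (at 0)"
    "Q \<in> polynomials (Suc k)" "\<forall>x. ((\<lambda>t. Q (x + t *\<^sub>R axis i 1)) has_real_derivative q x) (at 0)" by blast
  then show ?case
    by (intro bexI[of _ "\<lambda>x. P x + Q x"]) (auto intro: polynomials_add intro!: derivative_intros)
next
  case (scale c p)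
  then obtain P where "P \<in> polynomials (Suc k)" "\<forall>x. ((\<lambda>t. P (x + t *\<^sub>R axis i 1)) has_real_derivative p x) (at 0)" by blast
  then show ?case
    by (intro bexI[of _ "\<lambda>x. c * P x"]) (auto intro: polynomials_scale intro!: derivative_intros DERIV_cmult)
qed

text \<open>With \<open>s\<close> the projection along the \<open>i\<close>-th axis onto the hyperplane \<open>\<nu> \<bullet> x = b\<close>, the difference
  \<open>p x - p (s x)\<close> is divisible by \<open>\<nu> \<bullet> x - b\<close>; if \<open>p\<close> vanishes on the hyperplane, this difference is
  \<open>p x\<close>.\<close>

lemma polynomials_factor_hyperplane:
  fixes p :: "real^'n \<Rightarrow> real"
  assumes p: "p \<in> polynomials k" and nu: "\<nu> \<noteq> 0" and z: "\<And>x. \<nu> \<bullet> x = b \<Longrightarrow> p x = 0"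
  shows "\<exists>g. (if k = 0 then g = (\<lambda>_. 0) else g \<in> polynomials (k - 1)) \<and> (\<forall>x. p x = (\<nu> \<bullet> x - b) * g x)"
proof -
  obtain i where i: "\<nu> $ i \<noteq> 0" using nu by (auto simp: vec_eq_iff)
  define s where "s x = x - ((\<nu> \<bullet> x - b) / \<nu> $ i) *\<^sub>R axis i 1" for x :: "real^'n"
  have nus: "\<nu> \<bullet> s x = b" for x
    using i by (simp add: s_def inner_diff_right inner_axis)
  have lin: "(\<lambda>x. \<nu> \<bullet> x - b) \<in> polynomials (Suc 0)"
  proof -
    have "(\<lambda>x. (\<Sum>j\<in>UNIV. \<nu> $ j * x $ j) - b) \<in> polynomials (Suc 0)"
      by (intro polynomials_diff polynomials_sum polynomials_scale polynomials_coord polynomials_const)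
    then show ?thesis by (simp add: inner_vec_def)
  qed
  have sj: "(\<lambda>x. s x $ j) \<in> polynomials (Suc 0)" for j
  proof -
    have "(\<lambda>x. x $ j - (axis i 1 $ j / \<nu> $ i) * (\<nu> \<bullet> x - b)) \<in> polynomials (Suc 0)"
      by (intro polynomials_diff polynomials_coord polynomials_scale lin)
    then show ?thesis by (simp add: s_def field_simps)
  qed
  have "\<exists>g. (if k = 0 then g = (\<lambda>_. 0) else g \<in> polynomials (k - 1)) \<and> (\<forall>x. p x - p (s x) = (\<nu> \<bullet> x - b) * g x)"
    using p
  proof (induction rule: polynomials_induct)
    case (const k c)
    show ?case by (intro exI[of _ "\<lambda>_. 0"]) (auto intro: polynomials_zero)
  next
    case (add k p q)
    then obtain g h where "if k = 0 then g = (\<lambda>_. 0) else g \<in> polynomials (k - 1)" "\<forall>x. p x - p (s x) = (\<nu> \<bullet> x - b) * g x"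
      "if k = 0 then h = (\<lambda>_. 0) else h \<in> polynomials (k - 1)" "\<forall>x. q x - q (s x) = (\<nu> \<bullet> x - b) * h x" by blast
    then show ?case
      by (intro exI[of _ "\<lambda>x. g x + h x"]) (auto intro: polynomials_add simp: algebra_simps split: if_splits)
  next
    case (scale k c p)
    then obtain g where "if k = 0 then g = (\<lambda>_. 0) else g \<in> polynomials (k - 1)" "\<forall>x. p x - p (s x) = (\<nu> \<bullet> x - b) * g x" by blast
    then show ?case
      by (intro exI[of _ "\<lambda>x. c * g x"])
        (auto intro: polynomials_scale simp: mult.left_commute simp flip: right_diff_distrib split: if_splits)
  next
    case (coord k j p)
    then obtain g where g: "if k = 0 then g = (\<lambda>_. 0) else g \<in> polynomials (k - 1)" "\<And>x. p x - p (s x) = (\<nu> \<bullet> x - b) * g x" by blast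
    have "(\<lambda>x. s x $ j * g x) \<in> polynomials k"
      using polynomials_mult[OF sj, of g "k - 1" j] g(1) by (auto simp: polynomials_zero split: if_splits)
    then have "(\<lambda>x. (axis i 1 $ j / \<nu> $ i) * p x + s x $ j * g x) \<in> polynomials k"
      by (intro polynomials_add polynomials_scale coord.hyps)
    moreover have "x $ j * p x - s x $ j * p (s x) = (\<nu> \<bullet> x - b) * ((axis i 1 $ j / \<nu> $ i) * p x + s x $ j * g x)" for x
    proof -
      have "x $ j * p x - s x $ j * p (s x) = (x $ j - s x $ j) * p x + s x $ j * (p x - p (s x))"
        by (simp add: algebra_simps)
      also have "x $ j - s x $ j = (\<nu> \<bullet> x - b) * (axis i 1 $ j / \<nu> $ i)"
        by (simp add: s_def)
      finally show ?thesis unfolding g(2) by (simp add: algebra_simps)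
    qed
    ultimately show ?case by (intro exI[of _ "\<lambda>x. (axis i 1 $ j / \<nu> $ i) * p x + s x $ j * g x"]) simp
  qed
  then show ?thesis using z[OF nus] by simp
qed

section \<open>Integration over convex bodies\<close>

text \<open>The boundary of a convex set is a null set.  Functions in the discrete spaces are only controlled in
  the interior of the elements, and everything below rests on the fact that this suffices.\<close>

lemma AE_on_convex:
  fixes S :: "'a::euclidean_space set"
  assumes "convex S" "bounded S" "\<And>x. x \<in> interior S \<Longrightarrow> P x"
  shows "AE x in lebesgue_on S. P x"
proof -
  have "frontier S \<in> null_sets lebesgue"
    using negligible_convex_frontier[OF assms(1)] by (simp add: negligible_iff_null_sets)
  moreover have "S \<in> sets lebesgue"
    using measurable_convex[OF assms(1,2)] by blast
  moreover have "{x \<in> S. \<not> P x} \<subseteq> frontier S"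
    using assms(3) by (auto simp: frontier_def intro: closure_subset[THEN subsetD])
  ultimately show ?thesis
    by (auto simp: AE_restrict_space_iff intro: AE_I'[of "frontier S"])
qed

lemma integrable_on_convex:
  fixes S :: "'a::euclidean_space set" and f :: "'a \<Rightarrow> real"
  assumes S: "convex S" "compact S" and g: "continuous_on S g" and fg: "\<And>x. x \<in> interior S \<Longrightarrow> f x = g x"
  shows "integrable (lebesgue_on S) f"
proof -
  have m: "S \<in> lmeasurable" using S by (simp add: measurable_convex compact_imp_bounded)
  then have Ss: "S \<in> sets lebesgue" by blast
  have N: "frontier S \<in> null_sets lebesgue"
    using negligible_convex_frontier[OF S(1)] by (simp add: negligible_iff_null_sets)
  have "bounded (g ` S)"
    by (intro compact_imp_bounded compact_continuous_image g S)
  then obtain B where B: "\<And>x. x \<in> S \<Longrightarrow> \<bar>g x\<bar> \<le> B"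
    unfolding bounded_real by blast
  have gm: "g \<in> borel_measurable (lebesgue_on S)"
    using continuous_imp_measurable_on_sets_lebesgue[OF g Ss] .
  have int_g: "integrable (lebesgue_on S) g"
  proof -
    have "AE x in lebesgue_on S. norm (g x) \<le> B" using B by (intro AE_I2) auto
    then show ?thesis
      using finite_measure.integrable_const_bound[OF finite_measure_lebesgue_on[OF m] _ gm] by blast
  qed
  have ae: "AE x in lebesgue_on S. f x = g x"
    by (rule AE_on_convex[OF S(1) compact_imp_bounded[OF S(2)] fg])
  have "f \<in> borel_measurable (lebesgue_on (S - frontier S))"
  proof -
    have "g \<in> borel_measurable (lebesgue_on (S - frontier S))"
      using gm by (rule measurable_restrict_mono) auto
    moreover have "S - frontier S \<subseteq> interior S"
      using closure_subset by (auto simp: frontier_def)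
    ultimately show ?thesis
      using fg by (subst measurable_cong[where g=g]) auto
  qed
  then have "f \<in> borel_measurable (lebesgue_on S)"
  proof -
    have "frontier S \<subseteq> S" using S(2) by (simp add: compact_imp_closed frontier_subset_closed)
    then have "frontier S \<in> null_sets (lebesgue_on S)"
      using N Ss by (simp add: null_sets_restrict_space)
    then show "f \<in> borel_measurable (lebesgue_on (S - frontier S)) \<Longrightarrow> ?thesis"
      using borel_measurable_diff_null[OF _ Ss] by blast
  qed
  then show ?thesis
    using integrable_cong_AE[OF _ gm ae] int_g by blast
qed

text \<open>The points of the interior where a continuous function differs from zero form an open set, and a
  nonempty open set is not a null set.\<close>

lemma AE_zero_imp_zero_interior:
  fixes S :: "'a::euclidean_space set" and f :: "'a \<Rightarrow> 'b::real_normed_vector"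
  assumes S: "S \<in> sets lebesgue" and f: "continuous_on (interior S) f" and ae: "AE x in lebesgue_on S. f x = 0"
    and x: "x \<in> interior S"
  shows "f x = 0"
proof -
  have "open {x \<in> interior S. f x \<noteq> 0}"
  proof -
    have "open (interior S \<inter> f -` (- {0}))"
      by (intro continuous_open_preimage f) auto
    moreover have "interior S \<inter> f -` (- {0}) = {x \<in> interior S. f x \<noteq> 0}" by auto
    ultimately show ?thesis by simp
  qed
  moreover have "negligible {x \<in> interior S. f x \<noteq> 0}"
  proof -
    have "AE x in lebesgue. x \<in> S \<longrightarrow> f x = 0"
      using ae S by (simp add: AE_restrict_space_iff)
    then obtain N where N: "N \<in> null_sets lebesgue" "{x. \<not> (x \<in> S \<longrightarrow> f x = 0)} \<subseteq> N"
      by (auto simp: eventually_ae_filter)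
    then have "{x \<in> interior S. f x \<noteq> 0} \<subseteq> N" using interior_subset[of S] by blast
    then show ?thesis
      using N(1) negligible_subset by (metis negligible_iff_null_sets)
  qed
  ultimately have "{x \<in> interior S. f x \<noteq> 0} = {}"
    using open_not_negligible by blast
  then show ?thesis using x by blast
qed

lemma nonneg_integral_zero_imp_zero:
  fixes S :: "'a::euclidean_space set" and f :: "'a \<Rightarrow> real"
  assumes S: "convex S" "compact S" and g: "continuous_on S g" and fg: "\<And>x. x \<in> interior S \<Longrightarrow> f x = g x"
    and nn: "\<And>x. x \<in> S \<Longrightarrow> 0 \<le> g x"
    and z: "(LINT x|lebesgue_on S. f x) = 0" and x: "x \<in> interior S"
  shows "f x = 0"
proof -
  have Ss: "S \<in> sets lebesgue" using S by (simp add: measurable_convex compact_imp_bounded fmeasurableD)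
  have "AE x in lebesgue_on S. 0 \<le> f x"
    by (rule AE_on_convex[OF S(1) compact_imp_bounded[OF S(2)]]) (use fg nn interior_subset in auto)
  then have "AE x in lebesgue_on S. f x = 0"
    using integral_nonneg_eq_0_iff_AE[OF integrable_on_convex[OF S g fg]] z by blast
  moreover have "continuous_on (interior S) f"
    using continuous_on_subset[OF g interior_subset] fg by (subst continuous_on_cong[where g=g]) auto
  ultimately show ?thesis using AE_zero_imp_zero_interior[OF Ss] x by blast
qed

section \<open>Traces and derivatives of functions that are polynomial inside a convex body\<close>

text \<open>The interior of a convex body is dense in it, so limits from the interior determine a continuous
  extension.\<close>

lemma trace_eq:
  fixes K :: "(real^'n) set" and w :: "real^'n \<Rightarrow> 'b::t2_space"
  assumes K: "convex K" "interior K \<noteq> {}" and w: "\<And>y. y \<in> interior K \<Longrightarrow> w y = p y"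
    and p: "isCont p x" and x: "x \<in> K"
  shows "trace K w x = p x"
proof -
  have "x \<in> closure (interior K)"
    using x convex_closure_interior[OF K] closure_subset by blast
  then have lim: "x islimpt interior K"
    using open_imp_islimpt[OF open_interior, of x K] unfolding closure_def by blast
  have "(p \<longlongrightarrow> p x) (at x within interior K)"
    using p unfolding continuous_at by (rule filterlim_mono[OF _ order_refl at_le]) simp
  moreover have "\<forall>\<^sub>F y in at x within interior K. p y = w y"
    using w by (simp add: eventually_at_filter)
  ultimately have "(w \<longlongrightarrow> p x) (at x within interior K)"
    using tendsto_cong by blast
  then show ?thesis
    unfolding trace_def using lim by (intro tendsto_Lim) (auto simp: trivial_limit_within)
qed

lemma grad_eq:
  fixes w p :: "real^'n \<Rightarrow> real"
  assumes "\<And>y. y \<in> interior K \<Longrightarrow> w y = p y" and "x \<in> interior K"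
    and "(p has_derivative (\<lambda>h. \<Sum>i\<in>UNIV. h $ i * D i)) (at x)"
  shows "grad w x = (\<chi> i. D i)"
proof -
  have "(w has_derivative (\<lambda>h. \<Sum>i\<in>UNIV. h $ i * D i)) (at x)"
    using has_derivative_transform_within_open[OF assms(3) open_interior assms(2)] assms(1) by simp
  then have "frechet_derivative w (at x) = (\<lambda>h. \<Sum>i\<in>UNIV. h $ i * D i)"
    by (rule frechet_derivative_at[symmetric])
  then show ?thesis
    by (simp add: grad_def axis_def vec_eq_iff if_distrib[of "\<lambda>c. c * _"] cong: if_cong)
qed

lemma dive_eq:
  fixes r p :: "real^'n \<Rightarrow> real^'n"
  assumes "\<And>y. y \<in> interior K \<Longrightarrow> r y = p y" and "x \<in> interior K"
    and "\<And>j. ((\<lambda>x. p x $ j) has_derivative (\<lambda>h. \<Sum>i\<in>UNIV. h $ i * D j i)) (at x)"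
  shows "dive r x = (\<Sum>i\<in>UNIV. D i i)"
proof -
  have "(p has_derivative (\<lambda>h. \<chi> j. \<Sum>i\<in>UNIV. h $ i * D j i)) (at x)"
    by (subst has_derivative_componentwise_within)
       (auto simp: Basis_vec_def inner_axis intro: assms(3))
  then have "(r has_derivative (\<lambda>h. \<chi> j. \<Sum>i\<in>UNIV. h $ i * D j i)) (at x)"
    using has_derivative_transform_within_open[OF _ open_interior assms(2)] assms(1) by (metis (no_types, lifting))
  then have "frechet_derivative r (at x) = (\<lambda>h. \<chi> j. \<Sum>i\<in>UNIV. h $ i * D j i)"
    by (rule frechet_derivative_at[symmetric])
  then show ?thesis
    by (simp add: dive_def axis_def if_distrib[of "\<lambda>c. c * _"] cong: if_cong)
qed

section \<open>Linear maps that fix a hyperplane, and Lebesgue measure\<close>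

text \<open>A copy of a finite type, ordered by an enumeration.  The determinant formula for the volume of a
  linear image is applied to vectors indexed by the copy; renaming the coordinates is an isometry that
  preserves Lebesgue measure and carries the result back.\<close>

typedef 'n ordered_index = "UNIV :: 'n set" by blast

instantiation ordered_index :: (finite) "{finite, wellorder}"
begin

definition less_eq_ordered_index :: "'a ordered_index \<Rightarrow> 'a ordered_index \<Rightarrow> bool" where
  "less_eq_ordered_index i j \<longleftrightarrow> to_nat (Rep_ordered_index i) \<le> to_nat (Rep_ordered_index j)"

definition less_ordered_index :: "'a ordered_index \<Rightarrow> 'a ordered_index \<Rightarrow> bool" where
  "less_ordered_index i j \<longleftrightarrow> to_nat (Rep_ordered_index i) < to_nat (Rep_ordered_index j)"

instance
proof
  have "(UNIV :: 'a ordered_index set) = Abs_ordered_index ` UNIV"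
    by (metis Rep_ordered_index_inverse surj_def)
  then show "finite (UNIV :: 'a ordered_index set)"
    by (metis finite finite_imageI)
next
  fix P :: "'a ordered_index \<Rightarrow> bool" and a
  assume "\<And>x. (\<And>y. y < x \<Longrightarrow> P y) \<Longrightarrow> P x"
  then show "P a"
  proof (induction "to_nat (Rep_ordered_index a)" arbitrary: a rule: less_induct)
    case less
    then show ?case unfolding less_ordered_index_def by blast
  qed
qed (auto simp: less_eq_ordered_index_def less_ordered_index_def Rep_ordered_index_inject)

end

definition reindex :: "real^'n \<Rightarrow> real^('n::finite ordered_index)" where
  "reindex x = (\<chi> i. x $ Rep_ordered_index i)"

definition unindex :: "real^('n::finite ordered_index) \<Rightarrow> real^'n" where
  "unindex x = (\<chi> i. x $ Abs_ordered_index i)"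

lemma unindex_reindex [simp]: "unindex (reindex x) = x"
  by (simp add: reindex_def unindex_def vec_eq_iff Abs_ordered_index_inverse)

lemma reindex_unindex [simp]: "reindex (unindex x) = x"
  by (simp add: reindex_def unindex_def vec_eq_iff Rep_ordered_index_inverse)

lemma bij_Abs_ordered_index: "bij (Abs_ordered_index :: 'n \<Rightarrow> 'n ordered_index)"
  by (rule bij_betwI[of _ _ _ Rep_ordered_index]) (auto simp: Abs_ordered_index_inverse Rep_ordered_index_inverse)

lemma reindex_inner: "reindex x \<bullet> reindex y = x \<bullet> y"
  unfolding inner_vec_def
  by (subst sum.reindex_bij_betw[OF bij_Abs_ordered_index, symmetric])
     (simp add: reindex_def Abs_ordered_index_inverse)

lemma linear_unindex: "linear unindex"
  by (rule linearI) (auto simp: unindex_def vec_eq_iff)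

lemma prod_Basis_cart: "(\<Prod>b\<in>Basis. x \<bullet> b) = (\<Prod>i\<in>UNIV. (x :: real^'n) $ i)"
proof -
  have B: "(Basis :: (real^'n) set) = range (\<lambda>i. axis i 1)"
    unfolding Basis_vec_def by simp blast
  have "inj (\<lambda>i :: 'n. axis i (1::real))"
    by (auto simp: inj_def axis_eq_axis)
  then show ?thesis
    unfolding B by (subst prod.reindex) (auto simp: inner_axis)
qed

lemma lborel_unindex: "(lborel :: (real^'n) measure) = distr lborel borel unindex"
proof (rule lborel_eqI)
  have [measurable]: "unindex \<in> borel_measurable borel"
    by (intro borel_measurable_continuous_onI linear_continuous_on linear_conv_bounded_linear[THEN iffD1] linear_unindex)
  fix l u :: "real^'n"
  assume le: "\<And>b. b \<in> Basis \<Longrightarrow> l \<bullet> b \<le> u \<bullet> b"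
  have le': "l $ i \<le> u $ i" for i
    using le[of "axis i 1"] by (auto simp: inner_axis Basis_vec_def)
  have "unindex -` box l u = box (reindex l) (reindex u)"
  proof (intro set_eqI)
    fix x :: "real^'n ordered_index"
    have all: "(\<forall>i. Q (Rep_ordered_index i)) \<longleftrightarrow> (\<forall>j. Q j)" for Q :: "'n \<Rightarrow> bool"
      by (metis UNIV_I Abs_ordered_index_inverse)
    show "x \<in> unindex -` box l u \<longleftrightarrow> x \<in> box (reindex l) (reindex u)"
      using all[of "\<lambda>j. l $ j < x $ Abs_ordered_index j \<and> x $ Abs_ordered_index j < u $ j"]
      by (simp add: mem_box_cart reindex_def unindex_def Rep_ordered_index_inverse)
  qed
  moreover have "emeasure lborel (box (reindex l) (reindex u)) = (\<Prod>b\<in>Basis. (reindex u - reindex l) \<bullet> b)"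
    using le' by (intro emeasure_lborel_box) (auto simp: Basis_vec_def inner_axis reindex_def)
  moreover have "(\<Prod>b\<in>Basis. (reindex u - reindex l) \<bullet> b) = (\<Prod>b\<in>Basis. (u - l) \<bullet> b)"
    unfolding prod_Basis_cart
    by (subst prod.reindex_bij_betw[OF bij_Abs_ordered_index, symmetric])
       (simp add: reindex_def Abs_ordered_index_inverse)
  ultimately show "emeasure (distr lborel borel unindex) (box l u) = (\<Prod>b\<in>Basis. (u - l) \<bullet> b)"
    by (simp add: emeasure_distr)
qed simp

text \<open>The map that fixes the hyperplane orthogonal to \<open>a\<close> and sends \<open>a\<close> to \<open>e\<close>.\<close>

definition tilt :: "'a::real_inner \<Rightarrow> 'a \<Rightarrow> 'a \<Rightarrow> 'a" where
  "tilt a e y = y + (a \<bullet> y) *\<^sub>R (e - a)"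

lemma linear_tilt: "linear (tilt a e)"
  by (rule linearI) (auto simp: tilt_def algebra_simps inner_add_right)

text \<open>After a rotation that takes \<open>a\<close> to a coordinate axis, the matrix is the identity with one column
  replaced, as in Cramer's rule.\<close>

lemma det_tilt:
  fixes a e :: "real^'m"
  assumes "norm a = 1"
  shows "det (matrix (tilt a e)) = a \<bullet> e"
proof -
  define k :: 'm where "k = undefined"
  obtain Q where Q: "orthogonal_transformation Q" "Q a = (axis k 1 :: real^'m)"
    by (rule orthogonal_transformation_exists[of a "axis k 1"]) (use assms in auto)
  have lQ: "linear Q" using Q(1) orthogonal_transformation_linear by blast
  define M where "M y = y + (y $ k) *\<^sub>R (Q e - axis k 1)" for y :: "real^'m"
  have lM: "linear M"
    by (rule linearI) (auto simp: M_def algebra_simps)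
  have "a \<bullet> y = Q y $ k" for y
    using Q unfolding orthogonal_transformation_def by (metis inner_axis_axis inner_axis inner_commute inner_real_def mult.right_neutral)
  then have "M (Q y) = Q (tilt a e y)" for y
    by (simp add: M_def tilt_def linear_add[OF lQ] linear_cmul[OF lQ] linear_diff[OF lQ] Q(2))
  then have "matrix M ** matrix Q = matrix Q ** matrix (tilt a e)"
    unfolding matrix_compose[OF lQ lM, symmetric] matrix_compose[OF linear_tilt lQ, symmetric]
    by (simp add: comp_def)
  then have "det (matrix M) * det (matrix Q) = det (matrix Q) * det (matrix (tilt a e))"
    by (metis det_mul)
  moreover have "det (matrix Q) \<noteq> 0"
    using det_orthogonal_matrix[of "matrix Q"] Q(1) by (auto simp: orthogonal_transformation_matrix)
  ultimately have "det (matrix (tilt a e)) = det (matrix M)" by simp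
  also have "matrix M = (\<chi> i j. if j = k then (mat 1 *v Q e) $ i else mat 1 $ i $ j)"
    unfolding matrix_vector_mul_lid by (auto simp: matrix_def M_def vec_eq_iff axis_def mat_def)
  also have "det \<dots> = Q e $ k"
    by (simp add: cramer_lemma)
  also have "\<dots> = a \<bullet> e"
    using \<open>\<And>y. a \<bullet> y = Q y $ k\<close> by simp
  finally show ?thesis .
qed

lemma lborel_tilt_wellorder:
  fixes a e :: "real^'m::{finite,wellorder}"
  assumes a: "norm a = 1" and c: "a \<bullet> e \<noteq> 0"
  shows "lborel = density (distr lborel borel (tilt a e)) (\<lambda>_. ennreal \<bar>a \<bullet> e\<bar>)"
proof (rule lborel_eqI)
  have [measurable]: "tilt a e \<in> borel_measurable borel"
    by (intro borel_measurable_continuous_onI linear_continuous_on linear_conv_bounded_linear[THEN iffD1] linear_tilt)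
  fix l u :: "real^'m::{finite,wellorder}"
  assume le: "\<And>b. b \<in> Basis \<Longrightarrow> l \<bullet> b \<le> u \<bullet> b"
  let ?S = "tilt a e -` box l u"
  obtain h where h: "linear h" "\<And>x. h (tilt a e x) = x" "\<And>x. tilt a e (h x) = x"
    using linear_injective_isomorphism[OF linear_tilt, of a e] det_nz_iff_inj[OF linear_tilt] det_tilt[OF a] c by metis
  have S: "?S = h ` box l u" using h(2,3) by (auto simp: image_iff) metis
  then have lm: "?S \<in> lmeasurable"
    using measurable_linear_image[OF h(1)] by auto
  have "measure lebesgue (tilt a e ` ?S) = \<bar>a \<bullet> e\<bar> * measure lebesgue ?S"
    using measure_linear_image[OF linear_tilt lm, of a e] by (simp add: det_tilt[OF a])
  moreover have "tilt a e ` ?S = box l u" using h(3) by (auto simp: image_iff) metis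
  moreover have Sb: "?S \<in> sets borel"
    using measurable_sets_borel[of "tilt a e" borel "box l u"] by simp
  ultimately have m: "measure lborel (box l u) = \<bar>a \<bullet> e\<bar> * measure lborel ?S"
    by (simp add: measure_completion)
  have fin: "emeasure lborel ?S = ennreal (measure lborel ?S)"
    using lm Sb by (intro emeasure_eq_ennreal_measure) (auto simp: fmeasurable_def)
  have "emeasure (density (distr lborel borel (tilt a e)) (\<lambda>_. ennreal \<bar>a \<bullet> e\<bar>)) (box l u)
      = ennreal \<bar>a \<bullet> e\<bar> * emeasure lborel ?S"
    by (simp add: emeasure_density_const emeasure_distr)
  also have "\<dots> = ennreal (measure lborel (box l u))"
    unfolding fin m by (simp add: ennreal_mult)
  also have "\<dots> = emeasure lborel (box l u)"
    by (metis emeasure_eq_ennreal_measure emeasure_lborel_box_finite infinity_ennreal_def less_irrefl)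
  finally show "emeasure (density (distr lborel borel (tilt a e)) (\<lambda>_. ennreal \<bar>a \<bullet> e\<bar>)) (box l u)
      = (\<Prod>b\<in>Basis. (u - l) \<bullet> b)"
    using emeasure_lborel_box[OF le] by simp
qed simp

lemma lborel_tilt:
  fixes a e :: "real^'n"
  assumes a: "norm a = 1" and c: "a \<bullet> e \<noteq> 0"
  shows "lborel = density (distr lborel borel (tilt a e)) (\<lambda>_. ennreal \<bar>a \<bullet> e\<bar>)"
proof (rule measure_eqI)
  let ?a = "reindex a" and ?e = "reindex e"
  have [measurable]: "tilt a e \<in> borel_measurable borel" "tilt ?a ?e \<in> borel_measurable borel"
    "unindex \<in> borel_measurable borel"
    by (auto intro!: borel_measurable_continuous_onI linear_continuous_on linear_conv_bounded_linear[THEN iffD1] linear_tilt linear_unindex)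
  fix B :: "(real^'n) set" assume "B \<in> sets lborel"
  then have [measurable]: "B \<in> sets borel" by simp
  have [measurable]: "unindex -` B \<in> sets borel" "tilt a e -` B \<in> sets borel"
    by (metis \<open>B \<in> sets borel\<close> \<open>unindex \<in> borel_measurable borel\<close> measurable_sets_borel)
       (metis \<open>B \<in> sets borel\<close> \<open>tilt a e \<in> borel_measurable borel\<close> measurable_sets_borel)
  have a': "norm ?a = 1" using a by (simp add: norm_eq_sqrt_inner reindex_inner)
  have c': "?a \<bullet> ?e \<noteq> 0" using c by (simp add: reindex_inner)
  have conj: "unindex -` (tilt a e -` B) = tilt ?a ?e -` (unindex -` B)"
  proof -
    have "a \<bullet> unindex y = ?a \<bullet> y" for y
      by (metis reindex_inner reindex_unindex)
    then have "tilt a e (unindex y) = unindex (tilt ?a ?e y)" for y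
      by (simp add: tilt_def linear_add[OF linear_unindex] linear_diff[OF linear_unindex] linear_cmul[OF linear_unindex])
    then show ?thesis by auto
  qed
  have "emeasure (density (distr lborel borel (tilt a e)) (\<lambda>_. ennreal \<bar>a \<bullet> e\<bar>)) B
      = ennreal \<bar>a \<bullet> e\<bar> * emeasure lborel (tilt a e -` B)"
    by (simp add: emeasure_density_const emeasure_distr)
  also have "emeasure lborel (tilt a e -` B) = emeasure lborel (unindex -` (tilt a e -` B))"
    by (subst lborel_unindex) (simp add: emeasure_distr)
  also have "ennreal \<bar>a \<bullet> e\<bar> * \<dots> = emeasure (density (distr lborel borel (tilt ?a ?e)) (\<lambda>_. ennreal \<bar>?a \<bullet> ?e\<bar>)) (unindex -` B)"
    unfolding conj by (simp add: emeasure_density_const emeasure_distr reindex_inner)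
  also have "\<dots> = emeasure lborel (unindex -` B)"
    using lborel_tilt_wellorder[OF a' c'] by simp
  also have "\<dots> = emeasure lborel B"
    by (subst (2) lborel_unindex) (simp add: emeasure_distr)
  finally show "emeasure lborel B = emeasure (density (distr lborel borel (tilt a e)) (\<lambda>_. ennreal \<bar>a \<bullet> e\<bar>)) B" ..
qed simp

lemma integral_tilt:
  fixes a e p :: "real^'n" and G :: "real^'n \<Rightarrow> real"
  assumes a: "norm a = 1" and c: "a \<bullet> e \<noteq> 0" and G [measurable]: "G \<in> borel_measurable borel"
  shows "(LINT x|lborel. G x) = \<bar>a \<bullet> e\<bar> * (LINT y|lborel. G (p + tilt a e y))"
proof -
  have [measurable]: "tilt a e \<in> borel_measurable borel"
    by (intro borel_measurable_continuous_onI linear_continuous_on linear_conv_bounded_linear[THEN iffD1] linear_tilt)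
  have "(LINT x|lborel. G x) = (LINT x|distr lborel borel ((+) p). G x)"
    by (simp add: lborel_distr_plus)
  also have "\<dots> = (LINT x|lborel. G (p + x))"
    by (subst integral_distr) auto
  also have "\<dots> = (LINT x|density (distr lborel borel (tilt a e)) (\<lambda>_. ennreal \<bar>a \<bullet> e\<bar>). G (p + x))"
    using lborel_tilt[OF a c] by simp
  also have "\<dots> = \<bar>a \<bullet> e\<bar> * (LINT x|distr lborel borel (tilt a e). G (p + x))"
    by (subst integral_real_density) auto
  also have "(LINT x|distr lborel borel (tilt a e). G (p + x)) = (LINT y|lborel. G (p + tilt a e y))"
    by (subst integral_distr) auto
  finally show ?thesis .
qed

section \<open>Integration over faces\<close>

definition hyperplane_proj :: "'a::real_inner \<Rightarrow> real \<Rightarrow> 'a \<Rightarrow> 'a" where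
  "hyperplane_proj a b y = y - (a \<bullet> y - b) *\<^sub>R a"

definition prism :: "'a::real_inner \<Rightarrow> real \<Rightarrow> 'a set \<Rightarrow> 'a set" where
  "prism a b F = {y. hyperplane_proj a b y \<in> F \<and> \<bar>a \<bullet> y - b\<bar> \<le> 1/2}"

lemma inner_hyperplane_proj: "norm a = 1 \<Longrightarrow> a \<bullet> hyperplane_proj a b y = b"
  by (simp add: hyperplane_proj_def inner_diff_right power2_norm_eq_inner[symmetric])

lemma closest_point_hyperplane:
  fixes a :: "'a::euclidean_space"
  assumes a: "norm a = 1"
  shows "closest_point {x. a \<bullet> x = b} y = hyperplane_proj a b y"
proof (rule closest_point_unique[symmetric])
  show "convex {x. a \<bullet> x = b}" "closed {x. a \<bullet> x = b}"
    by (auto simp: convex_hyperplane closed_hyperplane)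
  show "hyperplane_proj a b y \<in> {x. a \<bullet> x = b}"
    using inner_hyperplane_proj[OF a] by simp
  show "\<forall>z\<in>{x. a \<bullet> x = b}. dist y (hyperplane_proj a b y) \<le> dist y z"
  proof
    fix z assume "z \<in> {x. a \<bullet> x = b}"
    then have "a \<bullet> y - b = a \<bullet> (y - z)" by (simp add: inner_diff_right)
    then have "\<bar>a \<bullet> y - b\<bar> \<le> norm (y - z)"
      using Cauchy_Schwarz_ineq2[of a "y - z"] a by simp
    then show "dist y (hyperplane_proj a b y) \<le> dist y z"
      using a by (simp add: hyperplane_proj_def dist_norm)
  qed
qed

text \<open>What integration over a face of a simplex depends on: a convex body that spans the hyperplane with
  unit normal \<open>a\<close> and offset \<open>b\<close>.\<close>

definition flat_body :: "'a::euclidean_space \<Rightarrow> real \<Rightarrow> 'a set \<Rightarrow> bool" where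
  "flat_body a b F \<longleftrightarrow> norm a = 1 \<and> convex F \<and> compact F \<and> F \<noteq> {} \<and> affine hull F = {x. a \<bullet> x = b}"

lemma flat_bodyD:
  assumes "flat_body a b F"
  shows "norm a = 1" "convex F" "compact F" "F \<noteq> {}" "affine hull F = {x. a \<bullet> x = b}"
    "\<And>x. x \<in> F \<Longrightarrow> a \<bullet> x = b"
  using assms hull_inc[of _ F affine] unfolding flat_body_def by auto

lemma face_integral_flat:
  assumes F: "flat_body a b F"
  shows "face_integral F f = (LINT y|lebesgue_on (prism a b F). f (hyperplane_proj a b y))"
proof -
  note a = flat_bodyD(1)[OF F]
  have "dist y (hyperplane_proj a b y) = \<bar>a \<bullet> y - b\<bar>" for y
    using a by (simp add: hyperplane_proj_def dist_norm)
  then show ?thesis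
    unfolding face_integral_def Let_def flat_bodyD(5)[OF F] closest_point_hyperplane[OF a] prism_def by simp
qed

lemma prism_image:
  assumes F: "flat_body a b F"
  shows "prism a b F = (\<lambda>(z, s). z + s *\<^sub>R a) ` (F \<times> {-1/2..1/2})"
proof (intro set_eqI iffI)
  fix y assume "y \<in> prism a b F"
  then have y: "hyperplane_proj a b y \<in> F" "\<bar>a \<bullet> y - b\<bar> \<le> 1/2" by (auto simp: prism_def)
  have "-1/2 \<le> a \<bullet> y - b" "a \<bullet> y - b \<le> 1/2"
    using y(2) unfolding abs_le_iff by linarith+
  then have "(hyperplane_proj a b y, a \<bullet> y - b) \<in> F \<times> {-1/2..1/2}" "y = hyperplane_proj a b y + (a \<bullet> y - b) *\<^sub>R a"
    using y(1) by (auto simp: hyperplane_proj_def)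
  then show "y \<in> (\<lambda>(z, s). z + s *\<^sub>R a) ` (F \<times> {-1/2..1/2})"
    by (metis (mono_tags, lifting) image_eqI case_prod_conv)
next
  fix y assume "y \<in> (\<lambda>(z, s). z + s *\<^sub>R a) ` (F \<times> {-1/2..1/2})"
  then obtain z s where y: "y = z + s *\<^sub>R a" "z \<in> F" "-1/2 \<le> s" "s \<le> 1/2" by auto
  have "a \<bullet> a = 1" using flat_bodyD(1)[OF F] by (simp add: norm_eq_1)
  then have "a \<bullet> y - b = s" using y flat_bodyD(6)[OF F] by (simp add: inner_add_right)
  then show "y \<in> prism a b F" using y by (auto simp: prism_def hyperplane_proj_def)
qed

lemma continuous_on_hyperplane_proj [continuous_intros]: "continuous_on S (hyperplane_proj a b)"
  unfolding hyperplane_proj_def by (intro continuous_intros)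

lemma compact_prism: "flat_body a b F \<Longrightarrow> compact (prism a b F)"
  unfolding prism_image
  by (intro compact_continuous_image compact_Times)
     (auto simp: case_prod_unfold dest: flat_bodyD(3) intro!: continuous_intros)

lemma convex_prism: "flat_body a b F \<Longrightarrow> convex (prism a b F)"
  unfolding prism_image
  by (intro convex_linear_image convex_Times)
     (auto simp: case_prod_unfold algebra_simps dest: flat_bodyD(2) intro!: linearI)

lemma interior_prism:
  assumes F: "flat_body a b F" and y: "y \<in> interior (prism a b F)"
  shows "hyperplane_proj a b y \<in> rel_interior F"
proof -
  obtain e where e: "e > 0" "ball y e \<subseteq> prism a b F"
    using y by (auto simp: mem_interior)
  have "ball (hyperplane_proj a b y) e \<inter> affine hull F \<subseteq> F"
  proof
    fix z assume z: "z \<in> ball (hyperplane_proj a b y) e \<inter> affine hull F"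
    let ?y = "y + (z - hyperplane_proj a b y)"
    have az: "a \<bullet> z = b" using z flat_bodyD(5)[OF F] by auto
    have "dist y ?y = dist (hyperplane_proj a b y) z" by (simp add: dist_norm norm_minus_commute)
    then have "?y \<in> prism a b F" using e(2) z by auto
    moreover have "a \<bullet> ?y = a \<bullet> y"
      using az inner_hyperplane_proj[OF flat_bodyD(1)[OF F]] by (simp add: inner_add_right inner_diff_right)
    then have "hyperplane_proj a b ?y = z"
      unfolding hyperplane_proj_def[of a b ?y] by (simp add: hyperplane_proj_def)
    ultimately show "z \<in> F" by (simp add: prism_def)
  qed
  moreover have "hyperplane_proj a b y \<in> F"
    using y interior_subset by (auto simp: prism_def)
  ultimately show ?thesis using e(1) unfolding mem_rel_interior_ball by blast
qed

lemma rel_interior_subset_interior_prism: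
  assumes F: "flat_body a b F" and z: "z \<in> rel_interior F"
  shows "z \<in> interior (prism a b F)"
proof -
  obtain e where e: "e > 0" "z \<in> F" "ball z e \<inter> affine hull F \<subseteq> F"
    using z by (auto simp: mem_rel_interior_ball)
  have az: "a \<bullet> z = b" using flat_bodyD(6)[OF F] e by blast
  have a: "norm a = 1" by (rule flat_bodyD(1)[OF F])
  have "ball z (min (e/2) (1/2)) \<subseteq> prism a b F"
  proof
    fix y assume "y \<in> ball z (min (e/2) (1/2))"
    then have d: "norm (y - z) < e/2" "norm (y - z) < 1/2" by (auto simp: dist_norm norm_minus_commute)
    have "\<bar>a \<bullet> y - b\<bar> \<le> norm (y - z)"
      using Cauchy_Schwarz_ineq2[of a "y - z"] a az by (simp add: inner_diff_right)
    moreover have "norm (hyperplane_proj a b y - z) \<le> norm (y - z) + \<bar>a \<bullet> y - b\<bar>"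
    proof -
      have "hyperplane_proj a b y - z = (y - z) - (a \<bullet> y - b) *\<^sub>R a" by (simp add: hyperplane_proj_def)
      moreover have "norm ((a \<bullet> y - b) *\<^sub>R a) = \<bar>a \<bullet> y - b\<bar>" using a by simp
      ultimately show ?thesis using norm_triangle_ineq4[of "y - z" "(a \<bullet> y - b) *\<^sub>R a"] by metis
    qed
    ultimately show "y \<in> prism a b F"
      using d e(3) inner_hyperplane_proj[OF a, of b y] flat_bodyD(5)[OF F]
      by (auto simp: prism_def dist_norm norm_minus_commute)
  qed
  then show ?thesis
    using e(1) by (auto simp: mem_interior intro!: exI[of _ "min (e/2) (1/2)"])
qed

text \<open>Only the values in the relative interior matter: the part of the prism over the relative
  boundary of the face lies in the boundary of the prism.\<close>

lemma integrable_face: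
  fixes f g :: "'a::euclidean_space \<Rightarrow> real"
  assumes F: "flat_body a b F" and g: "continuous_on F g" and fg: "\<And>x. x \<in> rel_interior F \<Longrightarrow> f x = g x"
  shows "integrable (lebesgue_on (prism a b F)) (\<lambda>y. f (hyperplane_proj a b y))"
proof (rule integrable_on_convex[OF convex_prism[OF F] compact_prism[OF F]])
  show "continuous_on (prism a b F) (\<lambda>y. g (hyperplane_proj a b y))"
    by (rule continuous_on_compose2[OF g continuous_on_hyperplane_proj]) (auto simp: prism_def)
  show "f (hyperplane_proj a b y) = g (hyperplane_proj a b y)" if "y \<in> interior (prism a b F)" for y
    using fg interior_prism[OF F that] by blast
qed

lemma face_integral_cong:
  fixes f g :: "real^'n \<Rightarrow> real"
  assumes F: "flat_body a b F" and g: "continuous_on F g" and fg: "\<And>x. x \<in> rel_interior F \<Longrightarrow> f x = g x"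
  shows "face_integral F f = face_integral F g"
  unfolding face_integral_flat[OF F]
proof (rule integral_cong_AE)
  show "AE y in lebesgue_on (prism a b F). f (hyperplane_proj a b y) = g (hyperplane_proj a b y)"
    using fg interior_prism[OF F]
    by (intro AE_on_convex convex_prism[OF F] compact_imp_bounded compact_prism[OF F]) blast
qed (use integrable_face[OF F g] fg in \<open>auto intro: borel_measurable_integrable\<close>)

lemma face_integral_zero_imp_zero:
  fixes g :: "real^'n \<Rightarrow> real"
  assumes F: "flat_body a b F" and g: "continuous_on F g"
    and nn: "\<And>x. x \<in> F \<Longrightarrow> 0 \<le> g x" and z: "face_integral F g = 0" and x: "x \<in> rel_interior F"
  shows "g x = 0"
proof -
  have "g (hyperplane_proj a b x) = 0"
  proof (rule nonneg_integral_zero_imp_zero[OF convex_prism[OF F] compact_prism[OF F],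
        where f="\<lambda>y. g (hyperplane_proj a b y)" and g="\<lambda>y. g (hyperplane_proj a b y)" and x=x])
    show "continuous_on (prism a b F) (\<lambda>y. g (hyperplane_proj a b y))"
      by (rule continuous_on_compose2[OF g continuous_on_hyperplane_proj]) (auto simp: prism_def)
    show "(LINT y|lebesgue_on (prism a b F). g (hyperplane_proj a b y)) = 0"
      using z by (simp add: face_integral_flat[OF F])
    show "x \<in> interior (prism a b F)"
      by (rule rel_interior_subset_interior_prism[OF F x])
  qed (use nn in \<open>auto simp: prism_def\<close>)
  moreover have "hyperplane_proj a b x = x"
    using x rel_interior_subset flat_bodyD(6)[OF F] by (auto simp: hyperplane_proj_def)
  ultimately show ?thesis by simp
qed

lemma face_integral_nonneg:
  fixes g :: "real^'n \<Rightarrow> real"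
  assumes F: "flat_body a b F" and nn: "\<And>x. x \<in> F \<Longrightarrow> 0 \<le> g x"
  shows "0 \<le> face_integral F g"
  unfolding face_integral_flat[OF F] using nn by (intro Bochner_Integration.integral_nonneg) (auto simp: prism_def)

section \<open>Normals and half-space description of a simplex\<close>

text \<open>A vector whose inner product is constant on the face is constant on its affine hull, a hyperplane,
  hence a multiple of \<open>a\<close>; the vertex off the face fixes the sign.\<close>

lemma outward_normal_eq:
  fixes a :: "real^'n"
  assumes a: "norm a = 1" and F: "affine hull F = {x. a \<bullet> x = b}" "F \<subseteq> K"
    and K: "\<And>x. x \<in> K \<Longrightarrow> a \<bullet> x \<le> b" and u: "u \<in> K" "a \<bullet> u < b"
  shows "outward_normal K F = a"
  unfolding outward_normal_def
proof (rule the_equality)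
  have "a \<bullet> y = b" if "y \<in> F" for y using F(1) hull_inc[of y F affine] that by auto
  then show "norm a = 1 \<and> (\<forall>x\<in>K. \<forall>y\<in>F. a \<bullet> x \<le> a \<bullet> y)" using a K by auto
next
  fix \<nu> assume nu: "norm \<nu> = 1 \<and> (\<forall>x\<in>K. \<forall>y\<in>F. \<nu> \<bullet> x \<le> \<nu> \<bullet> y)"
  have aa: "a \<bullet> a = 1" using a by (simp add: norm_eq_1)
  have "b *\<^sub>R a \<in> affine hull F" using aa by (simp add: F(1))
  then have "F \<noteq> {}" by auto
  then obtain y0 where y0: "y0 \<in> F" by blast
  define \<beta> where "\<beta> = \<nu> \<bullet> y0"
  have "\<nu> \<bullet> y = \<beta>" if "y \<in> F" for y
    using nu F(2) y0 that unfolding \<beta>_def by (meson antisym subsetD)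
  then have "F \<subseteq> {x. \<nu> \<bullet> x = \<beta>}" by blast
  then have sub: "affine hull F \<subseteq> {x. \<nu> \<bullet> x = \<beta>}"
    by (rule hull_minimal) (rule affine_hyperplane)
  define v where "v = \<nu> - (\<nu> \<bullet> a) *\<^sub>R a"
  have av: "a \<bullet> v = 0" using aa by (simp add: v_def inner_diff_right inner_commute)
  have "b *\<^sub>R a + v \<in> affine hull F" "b *\<^sub>R a \<in> affine hull F"
    using aa av by (simp_all add: F(1) inner_add_right)
  then have "\<nu> \<bullet> (b *\<^sub>R a + v) = \<beta>" "\<nu> \<bullet> (b *\<^sub>R a) = \<beta>" using sub by blast+
  then have "\<nu> \<bullet> v = 0" by (simp add: inner_add_right)
  moreover have "v \<bullet> v = \<nu> \<bullet> v - (\<nu> \<bullet> a) * (a \<bullet> v)" by (simp add: v_def inner_diff_left)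
  ultimately have "v = 0" using av by simp
  then have nua: "\<nu> = (\<nu> \<bullet> a) *\<^sub>R a" by (simp add: v_def)
  then have "\<bar>\<nu> \<bullet> a\<bar> = 1" using nu a by (metis norm_scaleR mult.right_neutral)
  moreover have "\<nu> \<bullet> a \<noteq> -1"
  proof
    assume "\<nu> \<bullet> a = -1"
    then have "\<nu> = - a" using nua by simp
    moreover have "a \<bullet> y0 = b" using y0 F(1) hull_inc[of y0 F affine] by auto
    ultimately show False using nu u y0 by force
  qed
  ultimately have "\<nu> \<bullet> a = 1" by linarith
  then show "\<nu> = a" using nua by simp
qed

locale full_simplex =
  fixes C :: "(real^'n) set"
  assumes indep: "\<not> affine_dependent C" and card_vertices: "card C = Suc CARD('n)"
begin

abbreviation "body \<equiv> convex hull C"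

definition face :: "real^'n \<Rightarrow> (real^'n) set" where "face u = convex hull (C - {u})"

definition normal :: "real^'n \<Rightarrow> real^'n" where "normal u = outward_normal body (face u)"

text \<open>The normal component of the points of the face; any of its vertices gives the value.\<close>

definition offset :: "real^'n \<Rightarrow> real" where "offset u = normal u \<bullet> (SOME v. v \<in> C - {u})"

lemma finite_vertices: "finite C" using card_vertices by (metis card.infinite nat.distinct(1))

lemma vertices_minus_nonempty: "C - {u} \<noteq> {}"
proof
  assume "C - {u} = {}"
  then have "C \<subseteq> {u}" by blast
  then have "card C \<le> 1" using card_mono[of "{u}" C] by simp
  then show False using card_vertices by simp
qed

lemma affine_hull_vertices: "affine hull C = UNIV"
  using aff_dim_affine_independent[OF indep] card_vertices aff_dim_eq_full[of C] by simp

text \<open>By affine independence the other vertices span a hyperplane that misses \<open>u\<close>.  Its normal is scaled to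
  length one and oriented away from \<open>u\<close>.\<close>

lemma normal_facts:
  assumes u: "u \<in> C"
  shows "norm (normal u) = 1" "affine hull (face u) = {x. normal u \<bullet> x = offset u}" "normal u \<bullet> u < offset u"
proof -
  have "\<not> affine_dependent (C - {u})" using indep by (meson Diff_subset affine_independent_subset)
  from aff_dim_affine_independent[OF this] have "aff_dim (C - {u}) = int (card (C - {u})) - 1" by simp
  then have "aff_dim (face u) = int CARD('n) - 1"
    using u card_vertices finite_vertices by (simp add: face_def aff_dim_convex_hull card_Diff_singleton)
  then obtain a b where ab: "a \<noteq> 0" "affine hull (face u) = {x. a \<bullet> x = b}"
    using aff_dim_eq_hyperplane[of "face u"] by auto
  have "u \<notin> affine hull (C - {u})" using u indep unfolding affine_dependent_def by blast
  then have nu: "a \<bullet> u \<noteq> b" using ab(2) by (simp add: face_def affine_hull_convex_hull)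
  define c where "c = (if a \<bullet> u < b then 1 else -1) / norm a"
  have c0: "c \<noteq> 0" using ab by (simp add: c_def)
  have 1: "norm (c *\<^sub>R a) = 1" using ab(1) by (simp add: c_def)
  have 2: "affine hull (face u) = {x. (c *\<^sub>R a) \<bullet> x = c * b}" using ab(2) c0 by simp
  have "c * (a \<bullet> u) < c * b" using nu ab(1) by (auto simp: c_def divide_simps)
  then have 3: "(c *\<^sub>R a) \<bullet> u < c * b" by simp
  have vtx: "(c *\<^sub>R a) \<bullet> v = c * b" if "v \<in> C - {u}" for v
    using 2 that hull_inc[of v "face u" affine] hull_inc[of v "C - {u}" convex] by (auto simp: face_def)
  have K: "(c *\<^sub>R a) \<bullet> x \<le> c * b" if "x \<in> body" for x
  proof -
    have "C \<subseteq> {x. (c *\<^sub>R a) \<bullet> x \<le> c * b}" using vtx 3 by fastforce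
    then have "body \<subseteq> {x. (c *\<^sub>R a) \<bullet> x \<le> c * b}" by (rule hull_minimal) (rule convex_halfspace_le)
    then show ?thesis using that by blast
  qed
  have n: "normal u = c *\<^sub>R a"
    unfolding normal_def
    by (rule outward_normal_eq[OF 1 2 _ K _ 3]) (auto simp: face_def hull_mono hull_inc u)
  have "(SOME v. v \<in> C - {u}) \<in> C - {u}" using vertices_minus_nonempty[of u] by (metis all_not_in_conv someI)
  then have o: "offset u = c * b" unfolding offset_def n using vtx by blast
  show "norm (normal u) = 1" "affine hull (face u) = {x. normal u \<bullet> x = offset u}" "normal u \<bullet> u < offset u"
    using 1 2 3 unfolding n o by auto
qed

lemma normal_other_vertex: "u \<in> C \<Longrightarrow> v \<in> C \<Longrightarrow> v \<noteq> u \<Longrightarrow> normal u \<bullet> v = offset u"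
  using normal_facts(2)[of u] hull_inc[of v "face u" affine] hull_inc[of v "C - {u}" convex] by (auto simp: face_def)

lemma flat_face:
  assumes "u \<in> C" shows "flat_body (normal u) (offset u) (face u)"
  using normal_facts[OF assms] vertices_minus_nonempty finite_vertices
  by (auto simp: flat_body_def face_def finite_imp_compact_convex_hull)

text \<open>The signed distance to a face is an affine function that vanishes at all vertices but one, so it is
  a multiple of the barycentric coordinate of that vertex.\<close>

lemma barycentric_inner:
  assumes l: "sum l C = 1" and u: "u \<in> C"
  shows "normal u \<bullet> (\<Sum>v\<in>C. l v *\<^sub>R v) - offset u = l u * (normal u \<bullet> u - offset u)"
proof -
  have "normal u \<bullet> (\<Sum>v\<in>C. l v *\<^sub>R v) - offset u = (\<Sum>v\<in>C. l v * (normal u \<bullet> v)) - (\<Sum>v\<in>C. l v * offset u)"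
    using l by (simp flip: sum_distrib_right add: inner_sum_right)
  also have "\<dots> = (\<Sum>v\<in>C. l v * (normal u \<bullet> v - offset u))"
    by (simp add: sum_subtractf right_diff_distrib)
  also have "\<dots> = (\<Sum>v\<in>C. if v = u then l u * (normal u \<bullet> u - offset u) else 0)"
    by (rule sum.cong) (auto simp: normal_other_vertex u)
  also have "\<dots> = l u * (normal u \<bullet> u - offset u)" using u finite_vertices by simp
  finally show ?thesis .
qed

lemma mem_body_iff: "x \<in> body \<longleftrightarrow> (\<forall>u\<in>C. normal u \<bullet> x \<le> offset u)"
proof
  assume "x \<in> body"
  moreover have "body \<subseteq> {x. normal u \<bullet> x \<le> offset u}" if u: "u \<in> C" for u
  proof (rule hull_minimal)
    show "C \<subseteq> {x. normal u \<bullet> x \<le> offset u}"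
      using normal_other_vertex[OF u] normal_facts(3)[OF u] by fastforce
  qed (rule convex_halfspace_le)
  ultimately show "\<forall>u\<in>C. normal u \<bullet> x \<le> offset u" by blast
next
  assume le: "\<forall>u\<in>C. normal u \<bullet> x \<le> offset u"
  obtain l where l: "sum l C = 1" "(\<Sum>v\<in>C. l v *\<^sub>R v) = x"
    using affine_hull_vertices affine_hull_finite[OF finite_vertices] by auto
  have "0 \<le> l u" if u: "u \<in> C" for u
  proof (rule ccontr)
    assume "\<not> 0 \<le> l u"
    then have "l u * (normal u \<bullet> u - offset u) > 0"
      using normal_facts(3)[OF u] by (intro mult_neg_neg) auto
    moreover have "l u * (normal u \<bullet> u - offset u) \<le> 0" using barycentric_inner[OF l(1) u] le u l(2) by (metis diff_le_0_iff_le)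
    ultimately show False by simp
  qed
  then show "x \<in> body" using l(1,2) unfolding convex_hull_finite[OF finite_vertices] by blast
qed

lemma mem_face_iff:
  assumes u: "u \<in> C"
  shows "x \<in> face u \<longleftrightarrow> x \<in> body \<and> normal u \<bullet> x = offset u"
proof
  assume "x \<in> face u"
  then show "x \<in> body \<and> normal u \<bullet> x = offset u"
    using flat_bodyD(6)[OF flat_face[OF u]] hull_mono[of "C - {u}" C convex] by (auto simp: face_def)
next
  assume x: "x \<in> body \<and> normal u \<bullet> x = offset u"
  obtain l where l: "sum l C = 1" "(\<Sum>v\<in>C. l v *\<^sub>R v) = x" "\<And>v. v \<in> C \<Longrightarrow> 0 \<le> l v"
    using x unfolding convex_hull_finite[OF finite_vertices] by auto
  have lu: "l u = 0" using barycentric_inner[OF l(1) u] x normal_facts(3)[OF u] l(2) by simp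
  have "sum l (C - {u}) = 1" "(\<Sum>v\<in>C - {u}. l v *\<^sub>R v) = x"
    using l(1,2) lu finite_vertices u by (simp_all add: sum_diff1)
  then show "x \<in> face u"
    using l(3) unfolding face_def convex_hull_finite[OF finite_Diff[OF finite_vertices]] by blast
qed

lemma facets: "{F. F facet_of body} = face ` C"
  using vertices_minus_nonempty by (auto simp: facet_of_convex_hull_affine_independent[OF indep] face_def)

lemma inj_on_face: "inj_on face C"
proof (rule inj_onI)
  fix u v assume uv: "u \<in> C" "v \<in> C" "face u = face v"
  show "u = v"
  proof (rule ccontr)
    assume "u \<noteq> v"
    then have "u \<in> face v" using uv by (auto simp: face_def intro: hull_inc)
    then have "normal u \<bullet> u = offset u" using uv flat_bodyD(6)[OF flat_face] by metis
    then show False using normal_facts(3)[OF uv(1)] by simp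
  qed
qed

lemma sum_facets: "(\<Sum>F | F facet_of body. f F) = (\<Sum>u\<in>C. f (face u))"
  unfolding facets by (rule sum.reindex_cong[OF inj_on_face]) auto

lemma compact_body: "compact body" and convex_body: "convex body"
  using finite_vertices by (auto simp: finite_imp_compact_convex_hull)

lemma interior_body: "interior body \<noteq> {}"
proof -
  have "affine hull body = UNIV" by (simp add: affine_hull_convex_hull affine_hull_vertices)
  then have "interior body = rel_interior body" by (simp add: rel_interior_interior)
  moreover have "body \<noteq> {}" using vertices_minus_nonempty by auto
  ultimately show ?thesis using rel_interior_eq_empty[OF convex_body] by simp
qed

end

section \<open>The divergence theorem on a simplex\<close>

text \<open>The region swept by the face \<open>F\<close> when it moves by \<open>t e\<close>; the quotient is the time at which a point is
  reached.\<close>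

definition slab :: "'a::real_inner \<Rightarrow> real \<Rightarrow> 'a set \<Rightarrow> 'a \<Rightarrow> real \<Rightarrow> 'a set" where
  "slab a b F e t = {x. 0 \<le> (a \<bullet> x - b) / (a \<bullet> e) \<and> (a \<bullet> x - b) / (a \<bullet> e) \<le> t \<and>
                       x - ((a \<bullet> x - b) / (a \<bullet> e)) *\<^sub>R e \<in> F}"

lemma compact_slab:
  assumes F: "flat_body a b F" and c: "a \<bullet> e \<noteq> 0"
  shows "compact (slab a b F e t)"
proof -
  have "slab a b F e t = (\<lambda>(z, s). z + s *\<^sub>R e) ` (F \<times> {0..t})"
  proof (intro set_eqI iffI)
    fix x assume x: "x \<in> slab a b F e t"
    let ?s = "(a \<bullet> x - b) / (a \<bullet> e)"
    have "(x - ?s *\<^sub>R e, ?s) \<in> F \<times> {0..t}" "x = (x - ?s *\<^sub>R e) + ?s *\<^sub>R e"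
      using x by (auto simp: slab_def)
    then show "x \<in> (\<lambda>(z, s). z + s *\<^sub>R e) ` (F \<times> {0..t})"
      by (metis (mono_tags, lifting) image_eqI case_prod_conv)
  next
    fix x assume "x \<in> (\<lambda>(z, s). z + s *\<^sub>R e) ` (F \<times> {0..t})"
    then obtain z s where x: "x = z + s *\<^sub>R e" "z \<in> F" "0 \<le> s" "s \<le> t" by auto
    then have "a \<bullet> x - b = s * (a \<bullet> e)" using flat_bodyD(6)[OF F] by (simp add: inner_add_right)
    then have "(a \<bullet> x - b) / (a \<bullet> e) = s" using c by simp
    then show "x \<in> slab a b F e t" using x by (simp add: slab_def)
  qed
  moreover have "compact ((\<lambda>(z, s). z + s *\<^sub>R e) ` (F \<times> {0..t}))"
    using flat_bodyD(3)[OF F] unfolding case_prod_unfold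
    by (intro compact_continuous_image compact_Times continuous_intros) simp_all
  ultimately show ?thesis by simp
qed

text \<open>The slab is the image of the prism over the face under an affine map that fixes the directions of the
  face and stretches the unit normal to \<open>t e\<close>, which multiplies volumes by \<open>t \<bar>a \<bullet> e\<bar>\<close>.\<close>

lemma slab_integral:
  fixes a e :: "real^'n" and g :: "real^'n \<Rightarrow> real"
  assumes F: "flat_body a b F" and c: "a \<bullet> e \<noteq> 0" and t: "0 < t" and g: "continuous_on UNIV g"
  shows "(LINT x|lborel. indicator (slab a b F e t) x * g x) =
    t * \<bar>a \<bullet> e\<bar> * (LINT y|lborel. indicator (prism a b F) y * g (hyperplane_proj a b y + ((a \<bullet> y - b + 1/2) * t) *\<^sub>R e))"
proof -
  have a: "norm a = 1" "a \<bullet> a = 1" using flat_bodyD(1)[OF F] by (auto simp: norm_eq_1)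
  \<comment> \<open>the translation that puts height \<open>-1/2\<close> of the prism to time zero of the slab\<close>
  define p where "p = b *\<^sub>R a + ((1/2 - b) * t) *\<^sub>R e"
  have map: "p + tilt a (t *\<^sub>R e) y = hyperplane_proj a b y + ((a \<bullet> y - b + 1/2) * t) *\<^sub>R e" for y
    by (simp add: p_def tilt_def hyperplane_proj_def algebra_simps)
  have ind: "indicator (slab a b F e t) (p + tilt a (t *\<^sub>R e) y) = (indicator (prism a b F) y :: real)" for y
  proof -
    let ?x = "p + tilt a (t *\<^sub>R e) y"
    have "a \<bullet> ?x - b = (a \<bullet> y - b + 1/2) * t * (a \<bullet> e)"
      unfolding map by (simp add: inner_add_right inner_hyperplane_proj[OF a(1)])
    then have s: "(a \<bullet> ?x - b) / (a \<bullet> e) = (a \<bullet> y - b + 1/2) * t" using c by simp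
    have "?x - ((a \<bullet> ?x - b) / (a \<bullet> e)) *\<^sub>R e = hyperplane_proj a b y"
      unfolding s by (simp add: map)
    moreover have "0 \<le> (a \<bullet> y - b + 1/2) * t \<and> (a \<bullet> y - b + 1/2) * t \<le> t \<longleftrightarrow> \<bar>a \<bullet> y - b\<bar> \<le> 1/2"
    proof -
      have "0 \<le> (a \<bullet> y - b + 1/2) * t \<longleftrightarrow> 0 \<le> a \<bullet> y - b + 1/2" using t by (simp add: zero_le_mult_iff)
      moreover have "(a \<bullet> y - b + 1/2) * t \<le> t \<longleftrightarrow> a \<bullet> y - b + 1/2 \<le> 1" using t by simp
      ultimately show ?thesis unfolding abs_le_iff by linarith
    qed
    ultimately have "?x \<in> slab a b F e t \<longleftrightarrow> y \<in> prism a b F"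
      unfolding slab_def prism_def mem_Collect_eq s by metis
    then show ?thesis by (simp add: indicator_def)
  qed
  have [measurable]: "g \<in> borel_measurable borel" using g by (rule borel_measurable_continuous_onI)
  have [measurable]: "slab a b F e t \<in> sets borel" by (intro borel_closed compact_imp_closed compact_slab[OF F c])
  have "(LINT x|lborel. indicator (slab a b F e t) x * g x) =
      \<bar>a \<bullet> (t *\<^sub>R e)\<bar> * (LINT y|lborel. indicator (slab a b F e t) (p + tilt a (t *\<^sub>R e) y) * g (p + tilt a (t *\<^sub>R e) y))"
    using t c by (intro integral_tilt[OF a(1), where G="\<lambda>x. indicator (slab a b F e t) x * g x"]) simp_all
  then show ?thesis using t unfolding ind unfolding map by (simp add: abs_mult)
qed

lemma integral_lebesgue_on_compact:
  fixes g :: "'a::euclidean_space \<Rightarrow> real"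
  assumes S: "compact S" and g: "continuous_on UNIV g"
  shows "(LINT x|lebesgue_on S. g x) = (LINT x|lborel. indicator S x * g x)"
    and "integrable lborel (\<lambda>x. indicator S x * g x)"
proof -
  have [measurable]: "g \<in> borel_measurable borel" using g by (rule borel_measurable_continuous_onI)
  have Sb [measurable]: "S \<in> sets borel" using S by (intro borel_closed compact_imp_closed)
  show "(LINT x|lebesgue_on S. g x) = (LINT x|lborel. indicator S x * g x)"
    by (subst integral_restrict_space) (auto simp: integral_completion Sb)
  show "integrable lborel (\<lambda>x. indicator S x * g x)"
    using borel_integrable_compact[OF S continuous_on_subset[OF g]] by simp
qed

text \<open>Divided by its thickness, the integral over a thin slab approaches the face integral, up to the
  factor by which moving along \<open>e\<close> instead of along the normal changes the thickness.\<close>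

lemma slab_limit:
  fixes a e :: "real^'n" and g :: "real^'n \<Rightarrow> real"
  assumes F: "flat_body a b F" and c: "a \<bullet> e \<noteq> 0" and g: "continuous_on UNIV g"
  shows "(\<lambda>m. (LINT x|lborel. indicator (slab a b F e (inverse (real (Suc m)))) x * g x) * real (Suc m))
    \<longlonglongrightarrow> \<bar>a \<bullet> e\<bar> * face_integral F g"
proof -
  let ?t = "\<lambda>m. inverse (real (Suc m))"
  let ?h = "\<lambda>t y. hyperplane_proj a b y + ((a \<bullet> y - b + 1/2) * t) *\<^sub>R e"
  have eq: "(LINT x|lborel. indicator (slab a b F e (?t m)) x * g x) * real (Suc m)
      = \<bar>a \<bullet> e\<bar> * (LINT y|lborel. indicator (prism a b F) y * g (?h (?t m) y))" for m
    by (subst slab_integral[OF F c _ g]) auto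
  have [measurable]: "g \<in> borel_measurable borel" using g by (rule borel_measurable_continuous_onI)
  have Pc: "compact (prism a b F)" by (rule compact_prism[OF F])
  have P [measurable]: "prism a b F \<in> sets borel" using Pc by (intro borel_closed compact_imp_closed)
  have hm [measurable]: "?h t \<in> borel_measurable borel" for t
    by (intro borel_measurable_continuous_onI continuous_intros)
  define X where "X = (\<lambda>(y, t). ?h t y) ` (prism a b F \<times> {0..1})"
  have "compact X"
    unfolding X_def
    by (intro compact_continuous_image compact_Times Pc)
       (auto simp: case_prod_unfold hyperplane_proj_def intro!: continuous_intros)
  then have "bounded (g ` X)"
    by (intro compact_imp_bounded compact_continuous_image continuous_on_subset[OF g]) auto
  then obtain B where B: "\<And>x. x \<in> X \<Longrightarrow> \<bar>g x\<bar> \<le> B"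
    unfolding bounded_real by blast
  have "(\<lambda>m. LINT y|lborel. indicator (prism a b F) y * g (?h (?t m) y))
      \<longlonglongrightarrow> (LINT y|lborel. indicator (prism a b F) y * g (?h 0 y))"
  proof (rule integral_dominated_convergence[where w="\<lambda>y. indicator (prism a b F) y * B"])
    show "integrable lborel (\<lambda>y. indicator (prism a b F) y * B)"
      by (rule integral_lebesgue_on_compact(2)[OF Pc]) auto
    have "(\<lambda>m. g (?h (?t m) y)) \<longlonglongrightarrow> g (?h 0 y)" for y
    proof (rule isCont_tendsto_compose[of _ g])
      show "isCont g (?h 0 y)" using g by (simp add: continuous_on_eq_continuous_at)
      show "(\<lambda>m. ?h (?t m) y) \<longlonglongrightarrow> ?h 0 y"
        by (intro tendsto_intros LIMSEQ_inverse_real_of_nat)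
    qed
    then show "AE y in lborel. (\<lambda>m. indicator (prism a b F) y * g (?h (?t m) y)) \<longlonglongrightarrow> indicator (prism a b F) y * g (?h 0 y)"
      by (intro AE_I2 tendsto_intros)
    show "AE y in lborel. norm (indicator (prism a b F) y * g (?h (?t m) y)) \<le> indicator (prism a b F) y * B" for m
    proof (intro AE_I2)
      fix y
      show "norm (indicator (prism a b F) y * g (?h (?t m) y)) \<le> indicator (prism a b F) y * B"
      proof (cases "y \<in> prism a b F")
        case True
        have "?t m \<le> 1" by (simp add: inverse_le_1_iff)
        then have "(y, ?t m) \<in> prism a b F \<times> {0..1}" using True by simp
        then have "?h (?t m) y \<in> X" unfolding X_def by (metis (mono_tags, lifting) image_eqI case_prod_conv)
        then show ?thesis using B True by simp
      qed simp
    qed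
  qed measurable
  moreover have "(LINT y|lborel. indicator (prism a b F) y * g (?h 0 y)) = face_integral F g"
    unfolding face_integral_flat[OF F]
    by (subst integral_lebesgue_on_compact(1)[OF Pc])
       (auto intro!: continuous_on_compose2[OF g] continuous_intros)
  ultimately show ?thesis unfolding eq by (intro tendsto_intros) simp
qed

text \<open>Dominated convergence; the mean value theorem bounds the difference quotients by the values of the
  derivative on the compact set that the body sweeps in unit time.\<close>

lemma difference_quotient_integral_limit:
  fixes g :: "real^'n \<Rightarrow> real"
  assumes K: "compact K" and g: "continuous_on UNIV g" and G: "continuous_on UNIV G"
    and deriv: "\<And>x t. ((\<lambda>t. g (x + t *\<^sub>R e)) has_real_derivative G (x + t *\<^sub>R e)) (at t)"
  shows "(\<lambda>m. (LINT x|lborel. indicator K x * (g (x + inverse (real (Suc m)) *\<^sub>R e) - g x)) * real (Suc m))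
    \<longlonglongrightarrow> (LINT x|lebesgue_on K. G x)"
proof -
  let ?t = "\<lambda>m. inverse (real (Suc m))"
  have [measurable]: "g \<in> borel_measurable borel" "G \<in> borel_measurable borel"
    using g G by (auto intro: borel_measurable_continuous_onI)
  have Kb [measurable]: "K \<in> sets borel" using K by (intro borel_closed compact_imp_closed)
  define X where "X = (\<lambda>(y, t). y + t *\<^sub>R e) ` (K \<times> {0..1})"
  have "compact X"
    unfolding X_def
    by (intro compact_continuous_image compact_Times K)
       (auto simp: case_prod_unfold intro!: continuous_intros)
  then have "bounded (G ` X)"
    by (intro compact_imp_bounded compact_continuous_image continuous_on_subset[OF G]) auto
  then obtain B where B: "\<And>x. x \<in> X \<Longrightarrow> \<bar>G x\<bar> \<le> B"
    unfolding bounded_real by blast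
  have "(\<lambda>m. LINT x|lborel. indicator K x * ((g (x + ?t m *\<^sub>R e) - g x) * real (Suc m)))
      \<longlonglongrightarrow> (LINT x|lborel. indicator K x * G x)"
  proof (rule integral_dominated_convergence[where w="\<lambda>y. indicator K y * B"])
    show "integrable lborel (\<lambda>y. indicator K y * B)"
      by (rule integral_lebesgue_on_compact(2)[OF K]) auto
    have "(\<lambda>m. (g (x + ?t m *\<^sub>R e) - g x) * real (Suc m)) \<longlonglongrightarrow> G x" for x
    proof -
      have "((\<lambda>t. (g (x + t *\<^sub>R e) - g (x + 0 *\<^sub>R e)) / (t - 0)) \<longlongrightarrow> G (x + 0 *\<^sub>R e)) (at 0)"
        using deriv[of x 0] unfolding has_field_derivative_iff by simp
      then have "((\<lambda>t. (g (x + t *\<^sub>R e) - g x) / t) \<longlongrightarrow> G x) (at 0)" by simp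
      moreover have "filterlim ?t (at 0) sequentially"
        using LIMSEQ_inverse_real_of_nat by (auto simp: filterlim_at)
      ultimately have "(\<lambda>m. (g (x + ?t m *\<^sub>R e) - g x) / ?t m) \<longlonglongrightarrow> G x"
        by (rule filterlim_compose)
      then show ?thesis by (simp add: divide_inverse)
    qed
    then show "AE x in lborel. (\<lambda>m. indicator K x * ((g (x + ?t m *\<^sub>R e) - g x) * real (Suc m))) \<longlonglongrightarrow> indicator K x * G x"
      by (intro AE_I2 tendsto_intros)
    show "AE x in lborel. norm (indicator K x * ((g (x + ?t m *\<^sub>R e) - g x) * real (Suc m))) \<le> indicator K x * B" for m
    proof (intro AE_I2)
      fix x
      show "norm (indicator K x * ((g (x + ?t m *\<^sub>R e) - g x) * real (Suc m))) \<le> indicator K x * B"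
      proof (cases "x \<in> K")
        case True
        have t: "0 < ?t m" "?t m \<le> 1" by (simp_all add: inverse_le_1_iff)
        obtain z where z: "0 < z" "z < ?t m"
          "g (x + ?t m *\<^sub>R e) - g (x + 0 *\<^sub>R e) = (?t m - 0) * G (x + z *\<^sub>R e)"
          using MVT2[OF t(1), of "\<lambda>t. g (x + t *\<^sub>R e)" "\<lambda>t. G (x + t *\<^sub>R e)"] deriv by blast
        have "(x, z) \<in> K \<times> {0..1}" using True z t by simp
        then have "x + z *\<^sub>R e \<in> X" unfolding X_def by (metis (mono_tags, lifting) image_eqI case_prod_conv)
        moreover have "(g (x + ?t m *\<^sub>R e) - g x) * real (Suc m) = G (x + z *\<^sub>R e)"
          using z(3) by simp
        ultimately show ?thesis using B True by simp
      qed simp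
    qed
  qed measurable
  moreover have "(LINT x|lborel. indicator K x * ((g (x + ?t m *\<^sub>R e) - g x) * real (Suc m)))
      = (LINT x|lborel. indicator K x * (g (x + ?t m *\<^sub>R e) - g x)) * real (Suc m)" for m
    by (simp flip: mult.assoc)
  ultimately show ?thesis unfolding integral_lebesgue_on_compact(1)[OF K G] by simp
qed

context full_simplex
begin

text \<open>Move the simplex by \<open>t e\<close> with \<open>e = v - w\<close>. Every other face moves within its own hyperplane, so on
  each line parallel to \<open>e\<close> the simplex is an interval between the faces opposite to \<open>v\<close> and \<open>w\<close>, and
  the interval plus what is swept at its exit is what is swept at its entry plus the moved interval.\<close>

lemma translated_simplex_indicator:
  assumes vw: "v \<in> C" "w \<in> C" "v \<noteq> w" and t: "0 < t"
    and x: "normal w \<bullet> x \<noteq> offset w" "normal v \<bullet> (x - t *\<^sub>R (v - w)) \<noteq> offset v"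
  shows "indicator body x + indicator (slab (normal w) (offset w) (face w) (v - w) t) x =
    (indicator (slab (normal v) (offset v) (face v) (v - w) t) x + indicator body (x - t *\<^sub>R (v - w)) :: real)"
proof -
  define e where "e = v - w"
  have other: "normal u \<bullet> e = 0" if "u \<in> C" "u \<noteq> v" "u \<noteq> w" for u
    using that vw normal_other_vertex[of u v] normal_other_vertex[of u w] by (simp add: e_def inner_diff_right)
  have ew: "normal w \<bullet> e > 0"
    using vw normal_other_vertex[of w v] normal_facts(3)[of w] by (simp add: e_def inner_diff_right)
  have ev: "normal v \<bullet> e < 0"
    using vw normal_other_vertex[of v w] normal_facts(3)[of v] by (simp add: e_def inner_diff_right)
  define p where "p = (normal w \<bullet> x - offset w) / (normal w \<bullet> e)"
  define r where "r = (normal v \<bullet> x - offset v) / (normal v \<bullet> e)"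
  define Z where "Z \<longleftrightarrow> (\<forall>u\<in>C. u \<noteq> v \<longrightarrow> u \<noteq> w \<longrightarrow> normal u \<bullet> x \<le> offset u)"
  have w: "normal w \<bullet> (x - s *\<^sub>R e) \<le> offset w \<longleftrightarrow> p \<le> s" "normal w \<bullet> (x - s *\<^sub>R e) = offset w \<longleftrightarrow> s = p" for s
    using ew by (auto simp: p_def inner_diff_right field_simps)
  have v: "normal v \<bullet> (x - s *\<^sub>R e) \<le> offset v \<longleftrightarrow> s \<le> r" "normal v \<bullet> (x - s *\<^sub>R e) = offset v \<longleftrightarrow> s = r" for s
    using ev by (auto simp: r_def inner_diff_right field_simps)
  have o: "normal u \<bullet> (x - s *\<^sub>R e) = normal u \<bullet> x" if "u \<in> C" "u \<noteq> v" "u \<noteq> w" for u s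
    using other[OF that] by (simp add: inner_diff_right)
  have body: "x - s *\<^sub>R e \<in> body \<longleftrightarrow> Z \<and> p \<le> s \<and> s \<le> r" for s
  proof
    assume "x - s *\<^sub>R e \<in> body"
    then have le: "normal u \<bullet> (x - s *\<^sub>R e) \<le> offset u" if "u \<in> C" for u using mem_body_iff that by blast
    show "Z \<and> p \<le> s \<and> s \<le> r"
      using le[OF vw(1)] le[OF vw(2)] le o unfolding v(1) w(1) Z_def by metis
  next
    assume "Z \<and> p \<le> s \<and> s \<le> r"
    then show "x - s *\<^sub>R e \<in> body"
      unfolding mem_body_iff using o v(1) w(1) unfolding Z_def by metis
  qed
  have K: "x \<in> body \<longleftrightarrow> Z \<and> p \<le> 0 \<and> 0 \<le> r" using body[of 0] by simp
  have sw: "x \<in> slab (normal w) (offset w) (face w) e t \<longleftrightarrow> 0 \<le> p \<and> p \<le> t \<and> Z \<and> p \<le> r"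
    unfolding slab_def mem_Collect_eq p_def[symmetric] mem_face_iff[OF vw(2)] body w(2) by auto
  have sv: "x \<in> slab (normal v) (offset v) (face v) e t \<longleftrightarrow> 0 \<le> r \<and> r \<le> t \<and> Z \<and> p \<le> r"
    unfolding slab_def mem_Collect_eq r_def[symmetric] mem_face_iff[OF vw(1)] body v(2) by auto
  have "p \<noteq> 0" using x(1) w(2)[of 0] by auto
  moreover have "r \<noteq> t" using x(2) v(2)[of t] unfolding e_def by auto
  ultimately show ?thesis
    unfolding e_def[symmetric] indicator_def K sw sv body using t by auto
qed

text \<open>Integrating the identity of indicators against \<open>g\<close>, dividing by \<open>t\<close> and letting \<open>t\<close> tend to zero gives the
  divergence theorem for an edge direction.  The faces that contain the whole edge may be added to the
  sum because their normals are orthogonal to it.\<close>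

lemma edge_derivative_integral:
  fixes g :: "real^'n \<Rightarrow> real"
  assumes vw: "v \<in> C" "w \<in> C" "v \<noteq> w" and g: "continuous_on UNIV g" and G: "continuous_on UNIV G"
    and deriv: "\<And>x t. ((\<lambda>t. g (x + t *\<^sub>R (v - w))) has_real_derivative G (x + t *\<^sub>R (v - w))) (at t)"
  shows "(LINT x|lebesgue_on body. G x) = (\<Sum>u\<in>C. (normal u \<bullet> (v - w)) * face_integral (face u) g)"
proof -
  define e where "e = v - w"
  let ?t = "\<lambda>m. inverse (real (Suc m))"
  let ?S = "\<lambda>u t. slab (normal u) (offset u) (face u) e t"
  have other: "normal u \<bullet> e = 0" if "u \<in> C" "u \<noteq> v" "u \<noteq> w" for u
    using that vw normal_other_vertex[of u v] normal_other_vertex[of u w] by (simp add: e_def inner_diff_right)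
  have ew: "normal w \<bullet> e > 0"
    using vw normal_other_vertex[of w v] normal_facts(3)[of w] by (simp add: e_def inner_diff_right)
  have ev: "normal v \<bullet> e < 0"
    using vw normal_other_vertex[of v w] normal_facts(3)[of v] by (simp add: e_def inner_diff_right)
  have sweep: "(LINT x|lborel. indicator body x * (g (x + t *\<^sub>R e) - g x)) =
      (LINT x|lborel. indicator (?S w t) x * g x) - (LINT x|lborel. indicator (?S v t) x * g x)" if t: "0 < t" for t
  proof -
    have [measurable]: "g \<in> borel_measurable borel" using g by (rule borel_measurable_continuous_onI)
    have [measurable]: "body \<in> sets borel" using compact_body by (intro borel_closed compact_imp_closed)
    have gt: "continuous_on UNIV (\<lambda>x. g (x + t *\<^sub>R e))"
      by (rule continuous_on_compose2[OF g]) (auto intro!: continuous_intros)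
    note int = integral_lebesgue_on_compact(2)[OF _ g]
    have i1: "integrable lborel (\<lambda>x. indicator body x * g x)" by (rule int[OF compact_body])
    have i2: "integrable lborel (\<lambda>x. indicator body x * g (x + t *\<^sub>R e))"
      by (rule integral_lebesgue_on_compact(2)[OF compact_body gt])
    have iw: "integrable lborel (\<lambda>x. indicator (?S w t) x * g x)"
      using compact_slab[OF flat_face[OF vw(2)]] ew by (intro int) auto
    have iv: "integrable lborel (\<lambda>x. indicator (?S v t) x * g x)"
      using compact_slab[OF flat_face[OF vw(1)]] ev by (intro int) auto
    have tr: "has_bochner_integral lborel (\<lambda>x. indicator body (x - t *\<^sub>R e) * g x) (LINT x|lborel. indicator body x * g (x + t *\<^sub>R e))"
    proof -
      have "has_bochner_integral (distr lborel borel ((+) (t *\<^sub>R e))) (\<lambda>x. indicator body (x - t *\<^sub>R e) * g x)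
          (LINT x|lborel. indicator body x * g (x + t *\<^sub>R e))"
        using i2 by (subst has_bochner_integral_distr) (auto simp: add.commute has_bochner_integral_iff)
      then show ?thesis by (simp add: lborel_distr_plus)
    qed
    have ae: "AE x in lborel. indicator body x * g x + indicator (?S w t) x * g x =
        indicator (?S v t) x * g x + indicator body (x - t *\<^sub>R e) * g x"
    proof -
      have hyp: "{x. a \<bullet> x = b} \<in> null_sets lborel" if "a \<noteq> 0" for a :: "real^'n" and b
        using negligible_hyperplane[of a b] that
        by (auto simp: negligible_iff_null_sets null_sets_completion_iff closed_hyperplane)
      have nz: "normal u \<noteq> 0" if "u \<in> C" for u using normal_facts(1)[OF that] by auto
      have "AE x in lborel. normal w \<bullet> x \<noteq> offset w"
        using AE_not_in[OF hyp[OF nz[OF vw(2)]]] by simp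
      moreover have "AE x in lborel. normal v \<bullet> x \<noteq> offset v + t * (normal v \<bullet> e)"
        using AE_not_in[OF hyp[OF nz[OF vw(1)]]] by simp
      ultimately show ?thesis
      proof eventually_elim
        case (elim x)
        then have "normal v \<bullet> (x - t *\<^sub>R (v - w)) \<noteq> offset v" by (simp add: e_def inner_diff_right)
        from translated_simplex_indicator[OF vw t elim(1) this]
        show ?case by (simp flip: distrib_right add: e_def)
      qed
    qed
    have "(LINT x|lborel. indicator body x * g x) + (LINT x|lborel. indicator (?S w t) x * g x) =
        (LINT x|lborel. indicator body x * g x + indicator (?S w t) x * g x)"
      using i1 iw by simp
    also have "\<dots> = (LINT x|lborel. indicator (?S v t) x * g x + indicator body (x - t *\<^sub>R e) * g x)"
      using ae i1 iw iv tr by (intro integral_cong_AE)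
        (auto intro!: borel_measurable_integrable simp: has_bochner_integral_iff simp del: borel_measurable_indicator_iff)
    also have "\<dots> = (LINT x|lborel. indicator (?S v t) x * g x) + (LINT x|lborel. indicator body x * g (x + t *\<^sub>R e))"
      using iv tr by (simp add: has_bochner_integral_iff)
    finally show ?thesis using i1 i2 by (simp add: right_diff_distrib)
  qed
  have "(\<lambda>m. (LINT x|lborel. indicator body x * (g (x + ?t m *\<^sub>R e) - g x)) * real (Suc m))
      \<longlonglongrightarrow> \<bar>normal w \<bullet> e\<bar> * face_integral (face w) g - \<bar>normal v \<bullet> e\<bar> * face_integral (face v) g"
  proof -
    have "(\<lambda>m. (LINT x|lborel. indicator (?S w (?t m)) x * g x) * real (Suc m)
          - (LINT x|lborel. indicator (?S v (?t m)) x * g x) * real (Suc m))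
      \<longlonglongrightarrow> \<bar>normal w \<bullet> e\<bar> * face_integral (face w) g - \<bar>normal v \<bullet> e\<bar> * face_integral (face v) g"
      using ew ev by (intro tendsto_diff slab_limit flat_face vw g) auto
    then show ?thesis using sweep[of "?t _"] by (simp add: left_diff_distrib)
  qed
  moreover have "(\<lambda>m. (LINT x|lborel. indicator body x * (g (x + ?t m *\<^sub>R e) - g x)) * real (Suc m))
      \<longlonglongrightarrow> (LINT x|lebesgue_on body. G x)"
    using difference_quotient_integral_limit[OF compact_body g G] deriv unfolding e_def by blast
  ultimately have "(LINT x|lebesgue_on body. G x) =
      (normal w \<bullet> e) * face_integral (face w) g + (normal v \<bullet> e) * face_integral (face v) g"
    using LIMSEQ_unique ew ev by fastforce
  also have "\<dots> = (\<Sum>u\<in>{v, w}. (normal u \<bullet> e) * face_integral (face u) g)" using vw by simp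
  also have "\<dots> = (\<Sum>u\<in>C. (normal u \<bullet> e) * face_integral (face u) g)"
    using vw other finite_vertices by (intro sum.mono_neutral_left) auto
  finally show ?thesis by (simp add: e_def)
qed

text \<open>The edges issuing from one vertex span the whole space, and both sides are linear in the
  direction of differentiation.\<close>

theorem partial_derivative_integral:
  fixes g :: "real^'n \<Rightarrow> real"
  assumes g: "continuous_on UNIV g" and D: "\<And>i. continuous_on UNIV (D i)"
    and deriv: "\<And>x. (g has_derivative (\<lambda>h. \<Sum>i\<in>UNIV. h $ i * D i x)) (at x)"
  shows "(LINT x|lebesgue_on body. D i x) = (\<Sum>u\<in>C. normal u $ i * face_integral (face u) g)"
proof -
  define L where "L h = (LINT x|lebesgue_on body. (\<Sum>i\<in>UNIV. h $ i * D i x))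
      - (\<Sum>u\<in>C. (normal u \<bullet> h) * face_integral (face u) g)" for h
  have int: "integrable (lebesgue_on body) (D i)" for i
    by (rule integrable_on_convex[OF convex_body compact_body continuous_on_subset[OF D]]) auto
  have L: "L h = (\<Sum>i\<in>UNIV. h $ i * (LINT x|lebesgue_on body. D i x))
      - (\<Sum>u\<in>C. (normal u \<bullet> h) * face_integral (face u) g)" for h
    unfolding L_def using int by (simp add: Bochner_Integration.integral_sum)
  have lin: "linear L"
    by (rule linearI) (simp_all add: L algebra_simps inner_add_right sum.distrib sum_distrib_left)
  have edge: "L (v - w) = 0" if "v \<in> C" "w \<in> C" for v w
  proof (cases "v = w")
    case True then show ?thesis using linear_0[OF lin] by simp
  next
    case False
    have "((\<lambda>t. g (x + t *\<^sub>R h)) has_real_derivative (\<Sum>i\<in>UNIV. h $ i * D i (x + t *\<^sub>R h))) (at t)" for x h t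
    proof -
      have "((\<lambda>t. x + t *\<^sub>R h) has_derivative (\<lambda>s. s *\<^sub>R h)) (at t)"
        by (auto intro!: derivative_eq_intros)
      from has_derivative_compose[OF this deriv]
      show ?thesis
        unfolding has_field_derivative_def
        by (rule has_derivative_eq_rhs) (simp add: fun_eq_iff sum_distrib_left sum_distrib_right mult_ac)
    qed
    then have "(LINT x|lebesgue_on body. (\<Sum>i\<in>UNIV. (v - w) $ i * D i x)) =
        (\<Sum>u\<in>C. (normal u \<bullet> (v - w)) * face_integral (face u) g)"
      by (intro edge_derivative_integral[OF that False g]) (intro continuous_intros D)
    then show ?thesis by (simp add: L_def)
  qed
  obtain w where w: "w \<in> C" using vertices_minus_nonempty by blast
  have "L h = 0" for h
  proof -
    obtain l where l: "sum l C = 1" "(\<Sum>v\<in>C. l v *\<^sub>R v) = w + h"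
      using affine_hull_vertices affine_hull_finite[OF finite_vertices] by auto
    have "(\<Sum>v\<in>C. l v *\<^sub>R (v - w)) = (w + h) - (\<Sum>v\<in>C. l v) *\<^sub>R w"
      by (simp add: scaleR_diff_right sum_subtractf l(2) scaleR_left.sum)
    then have "h = (\<Sum>v\<in>C. l v *\<^sub>R (v - w))" using l(1) by simp
    then have "L h = (\<Sum>v\<in>C. l v *\<^sub>R L (v - w))"
      by (metis (no_types, lifting) linear_sum[OF lin] linear_cmul[OF lin] sum.cong)
    then show ?thesis using edge w by simp
  qed
  from this[of "axis i 1"] show ?thesis
    unfolding L inner_axis by (simp add: axis_def if_distrib[of "\<lambda>c. c * _"] cong: if_cong)
qed

end

section \<open>Square linear systems\<close>

text \<open>Gram--Schmidt, one column at a time: the part \<open>g\<close> of the new column that is orthogonal to the earlier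
  ones takes its share \<open>\<alpha>\<close> of the residual.  If \<open>g\<close> is zero, then \<open>\<alpha>\<close> is zero as well, because division
  by zero gives zero.\<close>

lemma least_squares_exists:
  fixes v :: "'j \<Rightarrow> 'i \<Rightarrow> real" and b :: "'i \<Rightarrow> real"
  assumes "finite J" and I: "finite I"
  shows "\<exists>x. \<forall>n\<in>J. (\<Sum>i\<in>I. (b i - (\<Sum>j\<in>J. x j * v j i)) * v n i) = 0"
  using assms(1)
proof (induction J arbitrary: b rule: finite_induct)
  case empty
  then show ?case by simp
next
  case (insert m J)
  obtain x where x: "\<And>n. n \<in> J \<Longrightarrow> (\<Sum>i\<in>I. (b i - (\<Sum>j\<in>J. x j * v j i)) * v n i) = 0"
    using insert.IH[of b] by blast
  obtain y where y: "\<And>n. n \<in> J \<Longrightarrow> (\<Sum>i\<in>I. (v m i - (\<Sum>j\<in>J. y j * v j i)) * v n i) = 0"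
    using insert.IH[of "v m"] by blast
  define r where "r i = b i - (\<Sum>j\<in>J. x j * v j i)" for i
  define g where "g i = v m i - (\<Sum>j\<in>J. y j * v j i)" for i
  define \<alpha> where "\<alpha> = (\<Sum>i\<in>I. r i * g i) / (\<Sum>i\<in>I. g i * g i)"
  define z where "z j = (if j = m then \<alpha> else x j - \<alpha> * y j)" for j
  have res: "b i - (\<Sum>j\<in>insert m J. z j * v j i) = r i - \<alpha> * g i" for i
  proof -
    have "(\<Sum>j\<in>J. z j * v j i) = (\<Sum>j\<in>J. x j * v j i) - \<alpha> * (\<Sum>j\<in>J. y j * v j i)"
    proof -
      have "(\<Sum>j\<in>J. z j * v j i) = (\<Sum>j\<in>J. x j * v j i - \<alpha> * (y j * v j i))"
        using insert.hyps(2) by (intro sum.cong) (auto simp: z_def algebra_simps)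
      then show ?thesis by (simp add: sum_subtractf sum_distrib_left)
    qed
    then show ?thesis using insert.hyps by (simp add: r_def g_def z_def algebra_simps)
  qed
  have perp: "(\<Sum>i\<in>I. (r i - \<alpha> * g i) * v n i) = 0" if "n \<in> J" for n
  proof -
    have "(\<Sum>i\<in>I. (r i - \<alpha> * g i) * v n i) = (\<Sum>i\<in>I. r i * v n i) - \<alpha> * (\<Sum>i\<in>I. g i * v n i)"
      by (simp add: left_diff_distrib sum_subtractf sum_distrib_left mult.assoc)
    then show ?thesis using x[OF that] y[OF that] by (simp add: r_def g_def)
  qed
  have "(\<Sum>i\<in>I. (r i - \<alpha> * g i) * g i) = 0"
  proof -
    have "(\<Sum>i\<in>I. (r i - \<alpha> * g i) * g i) = (\<Sum>i\<in>I. r i * g i) - \<alpha> * (\<Sum>i\<in>I. g i * g i)"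
      by (simp add: left_diff_distrib sum_subtractf sum_distrib_left mult.assoc)
    moreover have "(\<Sum>i\<in>I. r i * g i) = 0" if "(\<Sum>i\<in>I. g i * g i) = 0"
    proof -
      have "\<forall>i\<in>I. g i * g i = 0" using that I by (subst (asm) sum_nonneg_eq_0_iff) auto
      then show ?thesis by (intro sum.neutral) auto
    qed
    ultimately show ?thesis by (simp add: \<alpha>_def)
  qed
  moreover have "(\<Sum>i\<in>I. (r i - \<alpha> * g i) * (\<Sum>j\<in>J. y j * v j i)) = 0"
  proof -
    have "(\<Sum>i\<in>I. (r i - \<alpha> * g i) * (\<Sum>j\<in>J. y j * v j i)) = (\<Sum>j\<in>J. y j * (\<Sum>i\<in>I. (r i - \<alpha> * g i) * v j i))"
      unfolding sum_distrib_left by (subst sum.swap) (simp add: mult_ac)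
    then show ?thesis using perp by simp
  qed
  ultimately have "(\<Sum>i\<in>I. (r i - \<alpha> * g i) * (g i + (\<Sum>j\<in>J. y j * v j i))) = 0"
    by (simp add: distrib_left sum.distrib)
  then have "(\<Sum>i\<in>I. (r i - \<alpha> * g i) * v m i) = 0"
    by (simp add: g_def)
  then have "\<forall>n\<in>insert m J. (\<Sum>i\<in>I. (b i - (\<Sum>j\<in>insert m J. z j * v j i)) * v n i) = 0"
    unfolding res using perp by blast
  then show ?case by blast
qed

definition lin_on :: "('a \<Rightarrow> 'b::real_vector) set \<Rightarrow> (('a \<Rightarrow> 'b) \<Rightarrow> real) \<Rightarrow> bool" where
  "lin_on X \<phi> \<longleftrightarrow> (\<forall>f\<in>X. \<forall>g\<in>X. \<forall>s t. \<phi> (\<lambda>x. s *\<^sub>R f x + t *\<^sub>R g x) = s * \<phi> f + t * \<phi> g)"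

lemma lin_onD: "lin_on X \<phi> \<Longrightarrow> f \<in> X \<Longrightarrow> g \<in> X \<Longrightarrow> \<phi> (\<lambda>x. s *\<^sub>R f x + t *\<^sub>R g x) = s * \<phi> f + t * \<phi> g"
  unfolding lin_on_def by blast

lemma lin_on_scale: "lin_on X \<phi> \<Longrightarrow> f \<in> X \<Longrightarrow> \<phi> (\<lambda>x. s *\<^sub>R f x) = s * \<phi> f"
  using lin_onD[of X \<phi> f f s 0] by simp

lemma lin_on_zero: "lin_on X \<phi> \<Longrightarrow> f \<in> X \<Longrightarrow> \<phi> (\<lambda>x. 0) = 0"
  using lin_onD[of X \<phi> f f 0 0] by simp

text \<open>Coefficients are total functions, of which only the restriction to \<open>I\<close> matters; hence the
  congruence assumption.\<close>

lemma lin_on_expand: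
  fixes \<phi> :: "('i \<Rightarrow> real) \<Rightarrow> real"
  assumes lin: "lin_on UNIV \<phi>" and I: "finite I" and cong: "\<And>a a'. (\<And>i. i \<in> I \<Longrightarrow> a i = a' i) \<Longrightarrow> \<phi> a = \<phi> a'"
  shows "\<phi> a = (\<Sum>i\<in>I. a i * \<phi> (\<lambda>j. if j = i then 1 else 0))"
proof -
  have "\<phi> (\<lambda>j. if j \<in> X then a j else 0) = (\<Sum>i\<in>X. a i * \<phi> (\<lambda>j. if j = i then 1 else 0))" if "finite X" for X
    using that
  proof (induction X rule: finite_induct)
    case empty
    then show ?case using lin_on_zero[OF lin] by simp
  next
    case (insert i X)
    have "(\<lambda>j. if j \<in> insert i X then a j else 0) =
        (\<lambda>j. a i *\<^sub>R (if j = i then 1 else 0) + 1 *\<^sub>R (if j \<in> X then a j else 0))"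
      using insert.hyps by auto
    then show ?case
      using insert lin_onD[OF lin, of "\<lambda>j. if j = i then 1 else 0" "\<lambda>j. if j \<in> X then a j else 0" "a i" 1] by simp
  qed
  from this[OF I] show ?thesis using cong[of a "\<lambda>j. if j \<in> I then a j else 0"] by simp
qed

text \<open>The Fredholm alternative for a bilinear form: the residual of a least squares solution lies in the
  kernel of the transposed form, where the right-hand side vanishes, so the residual is orthogonal to
  itself.\<close>

lemma bilinear_solvable:
  fixes \<beta> :: "('i \<Rightarrow> real) \<Rightarrow> ('i \<Rightarrow> real) \<Rightarrow> real" and rhs :: "('i \<Rightarrow> real) \<Rightarrow> real"
  assumes I: "finite I"
    and lin1: "\<And>b. lin_on UNIV (\<lambda>a. \<beta> a b)" and lin2: "\<And>a. lin_on UNIV (\<beta> a)" and lin3: "lin_on UNIV rhs"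
    and cong1: "\<And>a a' b. (\<And>i. i \<in> I \<Longrightarrow> a i = a' i) \<Longrightarrow> \<beta> a b = \<beta> a' b"
    and cong2: "\<And>a b b'. (\<And>i. i \<in> I \<Longrightarrow> b i = b' i) \<Longrightarrow> \<beta> a b = \<beta> a b'"
    and cong3: "\<And>b b'. (\<And>i. i \<in> I \<Longrightarrow> b i = b' i) \<Longrightarrow> rhs b = rhs b'"
    and ker: "\<And>b. (\<And>a. \<beta> a b = 0) \<Longrightarrow> rhs b = 0"
  shows "\<exists>a. \<forall>b. \<beta> a b = rhs b"
proof -
  let ?e = "\<lambda>i j. if j = i then 1 else (0::real)"
  have x1: "\<beta> a b = (\<Sum>i\<in>I. a i * \<beta> (?e i) b)" for a b
    by (rule lin_on_expand[OF lin1 I cong1])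
  have x2: "\<beta> a b = (\<Sum>i\<in>I. b i * \<beta> a (?e i))" for a b
    by (rule lin_on_expand[OF lin2 I cong2])
  have x3: "rhs b = (\<Sum>i\<in>I. b i * rhs (?e i))" for b
    by (rule lin_on_expand[OF lin3 I cong3])
  obtain x where x: "\<And>n. n \<in> I \<Longrightarrow> (\<Sum>i\<in>I. (rhs (?e i) - (\<Sum>j\<in>I. x j * \<beta> (?e j) (?e i))) * \<beta> (?e n) (?e i)) = 0"
    using least_squares_exists[OF I I, of "\<lambda>i. rhs (?e i)" "\<lambda>j i. \<beta> (?e j) (?e i)"] by blast
  define r where "r i = rhs (?e i) - \<beta> x (?e i)" for i
  have r: "r i = rhs (?e i) - (\<Sum>j\<in>I. x j * \<beta> (?e j) (?e i))" for i
    unfolding r_def by (subst x1) simp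
  have "\<beta> (?e n) r = 0" if "n \<in> I" for n
    using x[OF that] unfolding x2[of "?e n" r] r by simp
  then have kr: "\<beta> a r = 0" for a unfolding x1[of a r] by simp
  then have "rhs r - \<beta> x r = 0" using ker by simp
  then have "(\<Sum>i\<in>I. r i * r i) = 0"
    unfolding x3[of r] x2[of x r] by (simp add: r_def right_diff_distrib sum_subtractf)
  then have "\<forall>i\<in>I. r i * r i = 0" using I by (subst (asm) sum_nonneg_eq_0_iff) auto
  then have "\<forall>i\<in>I. rhs (?e i) = \<beta> x (?e i)" by (simp add: r_def)
  then have "(\<Sum>i\<in>I. b i * \<beta> x (?e i)) = (\<Sum>i\<in>I. b i * rhs (?e i))" for b
    by (intro sum.cong) auto
  then have "\<forall>b. \<beta> x b = rhs b" using x2[of x] x3 by metis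
  then show ?thesis by blast
qed

section \<open>Functions that are polynomial on a set\<close>

lemma poly_on_add:
  assumes "poly_on k D f" "poly_on k D g"
  shows "poly_on k D (\<lambda>x. f x + g x)"
proof -
  obtain p q where "p \<in> polynomials k" "\<forall>x\<in>D. f x = p x" "q \<in> polynomials k" "\<forall>x\<in>D. g x = q x"
    using assms unfolding poly_on_def by blast
  then show ?thesis
    unfolding poly_on_def by (intro bexI[of _ "\<lambda>x. p x + q x"] polynomials_add) auto
qed

lemma poly_on_scale: "poly_on k D f \<Longrightarrow> poly_on k D (\<lambda>x. c * f x)"
  unfolding poly_on_def by (elim bexE, rule bexI[OF _ polynomials_scale]) auto

lemma poly_on_mult: "poly_on i D f \<Longrightarrow> poly_on j D g \<Longrightarrow> poly_on (i + j) D (\<lambda>x. f x * g x)"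
  unfolding poly_on_def by (elim bexE, rule bexI[OF _ polynomials_mult]) auto

lemma poly_on_mono: "poly_on k D f \<Longrightarrow> k \<le> k' \<Longrightarrow> poly_on k' D f"
  unfolding poly_on_def using polynomials_mono by blast

lemma poly_on_zero: "poly_on k D (\<lambda>x. 0)"
  unfolding poly_on_def by (rule bexI[OF _ polynomials_zero]) auto

lemma poly_on_cong: "poly_on k D f \<Longrightarrow> (\<And>x. x \<in> D \<Longrightarrow> g x = f x) \<Longrightarrow> poly_on k D g"
  unfolding poly_on_def by (elim bexE, rule bexI) auto

lemma poly_on_polynomials: "p \<in> polynomials k \<Longrightarrow> poly_on k D p"
  unfolding poly_on_def by blast

lemma integrable_poly_on:
  assumes "convex K" "compact K" "poly_on k (interior K) f"
  shows "integrable (lebesgue_on K) f"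
proof -
  obtain p where "p \<in> polynomials k" "\<And>x. x \<in> interior K \<Longrightarrow> f x = p x"
    using assms(3) unfolding poly_on_def by blast
  then show ?thesis by (intro integrable_on_convex[OF assms(1,2)] polynomials_continuous_on) auto
qed

lemma borel_measurable_interior:
  fixes f :: "'a::euclidean_space \<Rightarrow> real"
  assumes S: "convex S" "compact S"
  shows "f \<in> borel_measurable (lebesgue_on S) \<longleftrightarrow> f \<in> borel_measurable (lebesgue_on (interior S))"
proof -
  have Ss: "S \<in> sets lebesgue" using S by (simp add: measurable_convex compact_imp_bounded fmeasurableD)
  have "frontier S \<subseteq> S" using S(2) by (simp add: compact_imp_closed frontier_subset_closed)
  then have N: "frontier S \<in> null_sets (lebesgue_on S)"
    using negligible_convex_frontier[OF S(1)] Ss by (simp add: null_sets_restrict_space negligible_iff_null_sets)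
  have "S - frontier S = interior S"
    using closure_subset interior_subset by (auto simp: frontier_def)
  then show ?thesis using borel_measurable_diff_null[OF N Ss, of f] by simp
qed

text \<open>By completeness of the measure both functions are measurable or neither is, and a function that is not
  integrable has integral zero; so the values agree in every case.\<close>

lemma integral_cong_interior:
  fixes f g :: "'a::euclidean_space \<Rightarrow> real"
  assumes S: "convex S" "compact S" and fg: "\<And>x. x \<in> interior S \<Longrightarrow> f x = g x"
  shows "(LINT x|lebesgue_on S. f x) = (LINT x|lebesgue_on S. g x)"
proof -
  have "f \<in> borel_measurable (lebesgue_on (interior S)) \<longleftrightarrow> g \<in> borel_measurable (lebesgue_on (interior S))"
    using fg by (intro measurable_cong) auto
  then have m: "f \<in> borel_measurable (lebesgue_on S) \<longleftrightarrow> g \<in> borel_measurable (lebesgue_on S)"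
    by (simp add: borel_measurable_interior[OF S])
  have ae: "AE x in lebesgue_on S. f x = g x"
    by (rule AE_on_convex[OF S(1) compact_imp_bounded[OF S(2)] fg])
  show ?thesis
  proof (cases "f \<in> borel_measurable (lebesgue_on S)")
    case True
    then show ?thesis using m ae by (intro integral_cong_AE) auto
  next
    case False
    then have "\<not> integrable (lebesgue_on S) f" "\<not> integrable (lebesgue_on S) g"
      using m borel_measurable_integrable by blast+
    then show ?thesis by (simp add: not_integrable_integral_eq)
  qed
qed

section \<open>Bilinear forms on one element\<close>

text \<open>The conditions on the coefficient concern the interior of the element, because the boundary of the
  element may lie in the boundary of the domain, where the coefficient is arbitrary.\<close>

locale hdg_element = full_simplex C for C :: "(real^'n) set" +
  fixes c :: "real^'n \<Rightarrow> real^'n^'n" and tau :: "(real^'n) set \<Rightarrow> real" and k :: nat and B :: real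
  assumes c_measurable: "\<And>i j. (\<lambda>x. c x $ i $ j) \<in> borel_measurable (lebesgue_on (interior body))"
    and c_symmetric: "\<And>x. x \<in> interior body \<Longrightarrow> transpose (c x) = c x"
    and c_positive: "\<And>x v. x \<in> interior body \<Longrightarrow> v \<noteq> 0 \<Longrightarrow> 0 < v \<bullet> (c x *v v)"
    and c_bounded: "\<And>x. x \<in> interior body \<Longrightarrow> norm (c x) \<le> B"
    and tau_nonneg: "\<And>u. u \<in> C \<Longrightarrow> 0 \<le> tau (face u)"
    and tau_positive: "\<exists>u\<in>C. 0 < tau (face u)"
begin

definition W :: "(real^'n \<Rightarrow> real) set" where "W = {w. poly_on k (interior body) w}"
definition V :: "(real^'n \<Rightarrow> real^'n) set" where "V = {v. \<forall>i. poly_on k (interior body) (\<lambda>x. v x $ i)}"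
definition M :: "(real^'n \<Rightarrow> real) set" where "M = {\<mu>. \<forall>u\<in>C. poly_on k (rel_interior (face u)) \<mu>}"

lemma V_comb: "f \<in> V \<Longrightarrow> g \<in> V \<Longrightarrow> (\<lambda>x. s *\<^sub>R f x + t *\<^sub>R g x) \<in> V"
  by (simp add: V_def poly_on_add poly_on_scale)

lemma W_rep:
  assumes "w \<in> W" obtains p where "p \<in> polynomials k" "\<And>x. x \<in> interior body \<Longrightarrow> w x = p x"
  using assms unfolding W_def poly_on_def by blast

lemma V_rep:
  assumes "v \<in> V"
  obtains p where "\<And>i. (\<lambda>x. p x $ i) \<in> polynomials k" "\<And>x. x \<in> interior body \<Longrightarrow> v x = p x"
proof -
  have "\<forall>i. \<exists>P\<in>polynomials k. \<forall>x\<in>interior body. v x $ i = P x"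
    using assms unfolding V_def poly_on_def by blast
  then obtain P where P: "\<And>i. P i \<in> polynomials k" "\<And>i x. x \<in> interior body \<Longrightarrow> v x $ i = P i x" by metis
  show ?thesis
  proof (rule that[of "\<lambda>x. \<chi> i. P i x"])
    show "(\<lambda>x. (\<chi> i. P i x) $ i) \<in> polynomials k" for i using P(1)[of i] by simp
    show "v x = (\<chi> i. P i x)" if "x \<in> interior body" for x using P(2)[OF that] by (simp add: vec_eq_iff)
  qed
qed

lemma polynomial_vector_isCont:
  fixes p :: "real^'n \<Rightarrow> real^'n"
  assumes "\<And>i. (\<lambda>x. p x $ i) \<in> polynomials k"
  shows "isCont p x"
proof -
  have "continuous_on UNIV (\<lambda>x. \<chi> i. p x $ i)"
    by (intro continuous_on_vec_lambda polynomials_continuous_on[OF assms])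
  then show ?thesis by (simp add: continuous_on_eq_continuous_at)
qed

lemma trace_W:
  assumes "p \<in> polynomials k" "\<And>y. y \<in> interior body \<Longrightarrow> w y = p y" "x \<in> body"
  shows "trace body w x = p x"
proof (rule trace_eq[OF convex_body interior_body assms(2) _ assms(3)])
  show "isCont p x"
    using polynomials_continuous_on[OF assms(1), of UNIV] by (simp add: continuous_on_eq_continuous_at)
qed

lemma trace_V:
  fixes p v :: "real^'n \<Rightarrow> real^'n"
  assumes "\<And>i. (\<lambda>x. p x $ i) \<in> polynomials k" "\<And>y. y \<in> interior body \<Longrightarrow> v y = p y" "x \<in> body"
  shows "trace body v x = p x"
  by (rule trace_eq[OF convex_body interior_body assms(2) polynomial_vector_isCont[OF assms(1)] assms(3)])

lemma trace_W_comb: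
  assumes "f \<in> W" "g \<in> W" "x \<in> body"
  shows "trace body (\<lambda>x. s *\<^sub>R f x + t *\<^sub>R g x) x = s * trace body f x + t * trace body g x"
proof -
  obtain p where p: "p \<in> polynomials k" "\<And>x. x \<in> interior body \<Longrightarrow> f x = p x" by (rule W_rep[OF assms(1)]) blast
  obtain q where q: "q \<in> polynomials k" "\<And>x. x \<in> interior body \<Longrightarrow> g x = q x" by (rule W_rep[OF assms(2)]) blast
  have "trace body (\<lambda>x. s *\<^sub>R f x + t *\<^sub>R g x) x = s * p x + t * q x"
    by (rule trace_W[OF _ _ assms(3)])
       (auto intro!: polynomials_add[OF polynomials_scale[OF p(1)] polynomials_scale[OF q(1)]] simp: p(2) q(2))
  then show ?thesis using trace_W[OF p assms(3)] trace_W[OF q assms(3)] by simp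
qed

lemma trace_V_comb:
  assumes "f \<in> V" "g \<in> V" "x \<in> body"
  shows "trace body (\<lambda>x. s *\<^sub>R f x + t *\<^sub>R g x) x = s *\<^sub>R trace body f x + t *\<^sub>R trace body g x"
proof -
  obtain p where p: "\<And>i. (\<lambda>x. p x $ i) \<in> polynomials k" "\<And>x. x \<in> interior body \<Longrightarrow> f x = p x" by (rule V_rep[OF assms(1)]) blast
  obtain q where q: "\<And>i. (\<lambda>x. q x $ i) \<in> polynomials k" "\<And>x. x \<in> interior body \<Longrightarrow> g x = q x" by (rule V_rep[OF assms(2)]) blast
  have "trace body (\<lambda>x. s *\<^sub>R f x + t *\<^sub>R g x) x = s *\<^sub>R p x + t *\<^sub>R q x"
    by (rule trace_V[OF _ _ assms(3)])
       (auto intro!: polynomials_add[OF polynomials_scale[OF p(1)] polynomials_scale[OF q(1)]] simp: p(2) q(2))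
  then show ?thesis using trace_V[OF p assms(3)] trace_V[OF q assms(3)] by simp
qed

lemma trace_W_cong:
  assumes "f \<in> W" "\<And>y. y \<in> interior body \<Longrightarrow> g y = f y" "x \<in> body"
  shows "trace body g x = trace body f x"
proof -
  obtain p where p: "p \<in> polynomials k" "\<And>x. x \<in> interior body \<Longrightarrow> f x = p x" by (rule W_rep[OF assms(1)]) blast
  then show ?thesis using trace_W[OF p(1) _ assms(3)] assms(2) by metis
qed

lemma trace_V_cong:
  assumes "f \<in> V" "\<And>y. y \<in> interior body \<Longrightarrow> g y = f y" "x \<in> body"
  shows "trace body g x = trace body f x"
proof -
  obtain p where p: "\<And>i. (\<lambda>x. p x $ i) \<in> polynomials k" "\<And>x. x \<in> interior body \<Longrightarrow> f x = p x" by (rule V_rep[OF assms(1)]) blast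
  then show ?thesis using trace_V[OF p(1) _ assms(3)] assms(2) by metis
qed

subsection \<open>Derivatives\<close>

lemma V_has_derivative:
  assumes "v \<in> V"
  obtains D where "\<And>i j. D i j \<in> polynomials k" and "\<And>x. x \<in> interior body \<Longrightarrow> dive v x = (\<Sum>i\<in>UNIV. D i i x)"
    and "\<And>x. x \<in> interior body \<Longrightarrow> (v has_derivative (\<lambda>h. \<chi> i. \<Sum>j\<in>UNIV. h $ j * D i j x)) (at x)"
proof -
  obtain p where p: "\<And>i. (\<lambda>x. p x $ i) \<in> polynomials k" "\<And>x. x \<in> interior body \<Longrightarrow> v x = p x" by (rule V_rep[OF assms]) blast
  have "\<forall>i. \<exists>D. (\<forall>j. D j \<in> polynomials k) \<and> (\<forall>x. ((\<lambda>x. p x $ i) has_derivative (\<lambda>h. \<Sum>j\<in>UNIV. h $ j * D j x)) (at x))"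
    using polynomials_derivative[OF p(1)] by blast
  from choice[OF this] obtain D where "\<forall>i. (\<forall>j. D i j \<in> polynomials k) \<and>
      (\<forall>x. ((\<lambda>x. p x $ i) has_derivative (\<lambda>h. \<Sum>j\<in>UNIV. h $ j * D i j x)) (at x))" by (elim exE)
  then have D: "\<And>i j. D i j \<in> polynomials k"
    "\<And>i x. ((\<lambda>x. p x $ i) has_derivative (\<lambda>h. \<Sum>j\<in>UNIV. h $ j * D i j x)) (at x)" by simp_all
  show ?thesis
  proof (rule that[of D, OF D(1)])
    show "dive v x = (\<Sum>i\<in>UNIV. D i i x)" if "x \<in> interior body" for x
      by (rule dive_eq[OF p(2) that D(2)])
    fix x assume x: "x \<in> interior body"
    have "(p has_derivative (\<lambda>h. \<chi> i. \<Sum>j\<in>UNIV. h $ j * D i j x)) (at x)"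
      by (subst has_derivative_componentwise_within)
         (auto simp: Basis_vec_def inner_axis intro: D(2))
    then show "(v has_derivative (\<lambda>h. \<chi> i. \<Sum>j\<in>UNIV. h $ j * D i j x)) (at x)"
      by (rule has_derivative_transform_within_open[OF _ open_interior x]) (simp add: p(2))
  qed
qed

lemma dive_poly_on: "v \<in> V \<Longrightarrow> poly_on k (interior body) (dive v)"
proof -
  assume "v \<in> V"
  then obtain D :: "'n \<Rightarrow> 'n \<Rightarrow> real^'n \<Rightarrow> real" where
    D: "\<And>i j. D i j \<in> polynomials k" "\<And>x. x \<in> interior body \<Longrightarrow> dive v x = (\<Sum>i\<in>UNIV. D i i x)"
    by (rule V_has_derivative) blast
  have "(\<lambda>x. \<Sum>i\<in>UNIV. D i i x) \<in> polynomials k" by (intro polynomials_sum D(1))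
  from poly_on_polynomials[OF this] show ?thesis by (rule poly_on_cong) (rule D(2))
qed

lemma dive_V_comb:
  assumes "f \<in> V" "g \<in> V" "x \<in> interior body"
  shows "dive (\<lambda>x. s *\<^sub>R f x + t *\<^sub>R g x) x = s * dive f x + t * dive g x"
proof -
  obtain D where D: "(f has_derivative D) (at x)" by (rule V_has_derivative[OF assms(1)]) (use assms(3) in blast)
  obtain E where E: "(g has_derivative E) (at x)" by (rule V_has_derivative[OF assms(2)]) (use assms(3) in blast)
  have "((\<lambda>x. s *\<^sub>R f x + t *\<^sub>R g x) has_derivative (\<lambda>h. s *\<^sub>R D h + t *\<^sub>R E h)) (at x)"
    by (intro has_derivative_add has_derivative_scaleR_right D E)
  then show ?thesis
    unfolding dive_def
    by (simp add: frechet_derivative_at[OF D, symmetric] frechet_derivative_at[OF E, symmetric]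
        frechet_derivative_at[symmetric] sum.distrib sum_distrib_left)
qed

lemma dive_V_cong:
  assumes "f \<in> V" "\<And>y. y \<in> interior body \<Longrightarrow> g y = f y" "x \<in> interior body"
  shows "dive g x = dive f x"
proof -
  obtain D where D: "(f has_derivative D) (at x)" by (rule V_has_derivative[OF assms(1)]) (use assms(3) in blast)
  have "(g has_derivative D) (at x)"
    by (rule has_derivative_transform_within_open[OF D open_interior assms(3)]) (simp add: assms(2))
  then show ?thesis unfolding dive_def using frechet_derivative_at[OF D] frechet_derivative_at[of g D x] by simp
qed

subsection \<open>Boundary integrals\<close>

text \<open>Integrands on the boundary may differ from face to face, and products raise the degree, so neither a
  common polynomial nor a common degree is prescribed.\<close>

definition face_polynomials :: "((real^'n) set \<Rightarrow> real^'n \<Rightarrow> real) set" where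
  "face_polynomials = {f. \<forall>u\<in>C. \<exists>j. poly_on j (rel_interior (face u)) (f (face u))}"

lemma face_polynomialsE:
  assumes "f \<in> face_polynomials" "u \<in> C" obtains j where "poly_on j (rel_interior (face u)) (f (face u))"
  using assms unfolding face_polynomials_def by blast

lemma rel_interior_face_subset: "u \<in> C \<Longrightarrow> x \<in> rel_interior (face u) \<Longrightarrow> x \<in> body"
  using rel_interior_subset mem_face_iff by blast

lemma face_polynomials_M: "\<mu> \<in> M \<Longrightarrow> (\<lambda>F. \<mu>) \<in> face_polynomials"
  unfolding face_polynomials_def M_def by blast

lemma face_polynomials_trace:
  assumes "w \<in> W" shows "(\<lambda>F. trace body w) \<in> face_polynomials"
proof -
  obtain p where p: "p \<in> polynomials k" "\<And>x. x \<in> interior body \<Longrightarrow> w x = p x" by (rule W_rep[OF assms]) blast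
  have "poly_on k (rel_interior (face u)) (trace body w)" if "u \<in> C" for u
    using poly_on_polynomials[OF p(1)] by (rule poly_on_cong) (use trace_W[OF p] rel_interior_face_subset[OF that] in blast)
  then show ?thesis unfolding face_polynomials_def by blast
qed

lemma face_polynomials_normal_trace:
  assumes "r \<in> V" shows "(\<lambda>F x. trace body r x \<bullet> outward_normal body F) \<in> face_polynomials"
proof -
  obtain p where p: "\<And>i. (\<lambda>x. p x $ i) \<in> polynomials k" "\<And>x. x \<in> interior body \<Longrightarrow> r x = p x" by (rule V_rep[OF assms]) blast
  have "poly_on k (rel_interior (face u)) (\<lambda>x. trace body r x \<bullet> outward_normal body (face u))" if u: "u \<in> C" for u
  proof -
    have "(\<lambda>x. \<Sum>i\<in>UNIV. outward_normal body (face u) $ i * p x $ i) \<in> polynomials k"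
      by (intro polynomials_sum polynomials_scale p(1))
    from poly_on_polynomials[OF this] show ?thesis
      by (rule poly_on_cong)
         (use trace_V[OF p] rel_interior_face_subset[OF u] in \<open>simp add: inner_vec_def mult.commute\<close>)
  qed
  then show ?thesis unfolding face_polynomials_def by blast
qed

lemma face_polynomials_tau: "f \<in> face_polynomials \<Longrightarrow> (\<lambda>F x. tau F * f F x) \<in> face_polynomials"
  unfolding face_polynomials_def by (auto intro: poly_on_scale)

lemma face_polynomials_comb:
  assumes f: "f \<in> face_polynomials" and g: "g \<in> face_polynomials"
  shows "(\<lambda>F x. s * f F x + t * g F x) \<in> face_polynomials"
  unfolding face_polynomials_def
proof (intro CollectI ballI)
  fix u assume u: "u \<in> C"
  obtain i where i: "poly_on i (rel_interior (face u)) (f (face u))" by (rule face_polynomialsE[OF f u]) blast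
  obtain j where j: "poly_on j (rel_interior (face u)) (g (face u))" by (rule face_polynomialsE[OF g u]) blast
  show "\<exists>j. poly_on j (rel_interior (face u)) (\<lambda>x. s * f (face u) x + t * g (face u) x)"
    by (intro exI[of _ "max i j"] poly_on_add poly_on_scale poly_on_mono[OF i] poly_on_mono[OF j]) auto
qed

lemma face_polynomials_diff:
  assumes f: "f \<in> face_polynomials" and g: "g \<in> face_polynomials"
  shows "(\<lambda>F x. f F x - g F x) \<in> face_polynomials"
  using face_polynomials_comb[OF f g, of 1 "-1"] by simp

lemma bd_ip_sum: "bd_ip body f g = (\<Sum>u\<in>C. face_integral (face u) (\<lambda>x. f (face u) x * g (face u) x))"
  unfolding bd_ip_def by (rule sum_facets)

lemma integrable_face_poly_on:
  assumes "u \<in> C" "poly_on j (rel_interior (face u)) f"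
  shows "integrable (lebesgue_on (prism (normal u) (offset u) (face u))) (\<lambda>y. f (hyperplane_proj (normal u) (offset u) y))"
proof -
  obtain p where "p \<in> polynomials j" "\<And>x. x \<in> rel_interior (face u) \<Longrightarrow> f x = p x"
    using assms(2) unfolding poly_on_def by blast
  then show ?thesis by (intro integrable_face[OF flat_face[OF assms(1)]] polynomials_continuous_on) auto
qed

lemma bd_ip_comb:
  assumes f: "f \<in> face_polynomials" and g: "g \<in> face_polynomials" and h: "h \<in> face_polynomials"
  shows "bd_ip body (\<lambda>F x. s * f F x + t * g F x) h = s * bd_ip body f h + t * bd_ip body g h"
proof -
  have "face_integral (face u) (\<lambda>x. (s * f (face u) x + t * g (face u) x) * h (face u) x) =
      s * face_integral (face u) (\<lambda>x. f (face u) x * h (face u) x) +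
      t * face_integral (face u) (\<lambda>x. g (face u) x * h (face u) x)" if u: "u \<in> C" for u
  proof -
    obtain i where i: "poly_on i (rel_interior (face u)) (f (face u))" by (rule face_polynomialsE[OF f u]) blast
    obtain j where j: "poly_on j (rel_interior (face u)) (g (face u))" by (rule face_polynomialsE[OF g u]) blast
    obtain l where l: "poly_on l (rel_interior (face u)) (h (face u))" by (rule face_polynomialsE[OF h u]) blast
    show ?thesis
      using integrable_face_poly_on[OF u poly_on_mult[OF i l]] integrable_face_poly_on[OF u poly_on_mult[OF j l]]
      unfolding face_integral_flat[OF flat_face[OF u]] by (simp add: distrib_right mult.assoc)
  qed
  then show ?thesis unfolding bd_ip_sum by (simp add: sum.distrib sum_distrib_left)
qed

lemma bd_ip_diff:
  assumes "f \<in> face_polynomials" "g \<in> face_polynomials" "h \<in> face_polynomials"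
  shows "bd_ip body (\<lambda>F x. f F x - g F x) h = bd_ip body f h - bd_ip body g h"
  using bd_ip_comb[OF assms, of 1 "-1"] by simp

lemma bd_ip_add:
  assumes "f \<in> face_polynomials" "g \<in> face_polynomials" "h \<in> face_polynomials"
  shows "bd_ip body (\<lambda>F x. f F x + g F x) h = bd_ip body f h + bd_ip body g h"
  using bd_ip_comb[OF assms, of 1 1] by simp

lemma bd_ip_commute: "bd_ip K f g = bd_ip K g f"
  unfolding bd_ip_def by (simp add: mult.commute)

lemma bd_ip_cong:
  assumes "\<And>u x. u \<in> C \<Longrightarrow> x \<in> face u \<Longrightarrow> x \<in> body \<Longrightarrow> f (face u) x = f' (face u) x"
    and "\<And>u x. u \<in> C \<Longrightarrow> x \<in> face u \<Longrightarrow> x \<in> body \<Longrightarrow> g (face u) x = g' (face u) x"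
  shows "bd_ip body f g = bd_ip body f' g'"
  unfolding bd_ip_sum
proof (rule sum.cong[OF refl])
  fix u assume u: "u \<in> C"
  show "face_integral (face u) (\<lambda>x. f (face u) x * g (face u) x) = face_integral (face u) (\<lambda>x. f' (face u) x * g' (face u) x)"
    unfolding face_integral_flat[OF flat_face[OF u]]
    using assms[OF u] mem_face_iff[OF u] by (intro Bochner_Integration.integral_cong refl) (simp add: prism_def)
qed

end

section \<open>Square-integrable functions\<close>

lemma L2_mult_integrable:
  assumes "f \<in> L2 D" "g \<in> L2 D"
  shows "integrable (lebesgue_on D) (\<lambda>x. f x * g x)"
proof (rule Bochner_Integration.integrable_bound)
  show "integrable (lebesgue_on D) (\<lambda>x. (f x)\<^sup>2 + (g x)\<^sup>2)"
    using assms by (simp add: L2_def)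
  show "(\<lambda>x. f x * g x) \<in> borel_measurable (lebesgue_on D)"
    using assms by (auto simp: L2_def intro: borel_measurable_times)
  show "AE x in lebesgue_on D. norm (f x * g x) \<le> norm ((f x)\<^sup>2 + (g x)\<^sup>2)"
  proof (rule AE_I2)
    fix x
    have "0 \<le> (\<bar>f x\<bar> - \<bar>g x\<bar>)\<^sup>2" by simp
    then have "2 * (\<bar>f x\<bar> * \<bar>g x\<bar>) \<le> (f x)\<^sup>2 + (g x)\<^sup>2" by (simp add: power2_diff)
    moreover have "0 \<le> \<bar>f x\<bar> * \<bar>g x\<bar>" by simp
    ultimately show "norm (f x * g x) \<le> norm ((f x)\<^sup>2 + (g x)\<^sup>2)"
      unfolding real_norm_def abs_mult by linarith
  qed
qed

lemma L2_comb:
  assumes f: "f \<in> L2 D" and g: "g \<in> L2 D"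
  shows "(\<lambda>x. s * f x + t * g x) \<in> L2 D"
proof -
  have "integrable (lebesgue_on D) (\<lambda>x. s\<^sup>2 * (f x)\<^sup>2 + (2 * s * t) * (f x * g x) + t\<^sup>2 * (g x)\<^sup>2)"
    using f g L2_mult_integrable[OF f g] by (simp add: L2_def)
  moreover have "(s * f x + t * g x)\<^sup>2 = s\<^sup>2 * (f x)\<^sup>2 + (2 * s * t) * (f x * g x) + t\<^sup>2 * (g x)\<^sup>2" for x
    by (simp add: power2_eq_square algebra_simps)
  moreover have "(\<lambda>x. s * f x + t * g x) \<in> borel_measurable (lebesgue_on D)"
    using f g by (intro borel_measurable_add borel_measurable_times) (simp_all add: L2_def)
  ultimately show ?thesis by (simp add: L2_def)
qed

lemma vol_ip_comb:
  fixes f g h :: "real^'n \<Rightarrow> real"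
  assumes "f \<in> L2 D" "g \<in> L2 D" "h \<in> L2 D"
  shows "vol_ip D (\<lambda>x. s * f x + t * g x) h = s * vol_ip D f h + t * vol_ip D g h"
  using L2_mult_integrable[OF assms(1,3)] L2_mult_integrable[OF assms(2,3)]
  by (simp add: vol_ip_def distrib_right mult.assoc)

lemma vol_ip_commute: "vol_ip D f g = vol_ip D g f"
  by (simp add: vol_ip_def inner_commute)

lemma lin_on_plus: "lin_on X \<phi> \<Longrightarrow> lin_on X \<psi> \<Longrightarrow> lin_on X (\<lambda>f. \<phi> f + \<psi> f)"
  by (simp add: lin_on_def algebra_simps)

lemma lin_on_minus: "lin_on X \<phi> \<Longrightarrow> lin_on X \<psi> \<Longrightarrow> lin_on X (\<lambda>f. \<phi> f - \<psi> f)"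
  by (simp add: lin_on_def algebra_simps)

lemma lin_on_cmult: "lin_on X \<phi> \<Longrightarrow> lin_on X (\<lambda>f. s * \<phi> f)"
  by (simp add: lin_on_def algebra_simps)

context hdg_element
begin

section \<open>The forms of the local problems\<close>

text \<open>A is the energy of the coefficient, D the pairing with the divergence, S the stabilization by the
  penalty; N and T couple face data to the element through the normal trace and through the penalty.\<close>

definition formA where "formA q r = vol_ip body (\<lambda>x. c x *v q x) r"
definition formD where "formD u r = vol_ip body u (dive r)"
definition formS where "formS u w = bd_ip body (\<lambda>F x. tau F * trace body u x) (\<lambda>F. trace body w)"
definition formN where "formN \<mu> r = bd_ip body (\<lambda>F. \<mu>) (\<lambda>F x. trace body r x \<bullet> outward_normal body F)"
definition formT where "formT \<mu> w = bd_ip body (\<lambda>F x. tau F * \<mu> x) (\<lambda>F. trace body w)"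

text \<open>All forms are linear and see a function only in the interior of the element, so that extension by
  zero to the mesh and replacement by an actual polynomial do not change them.\<close>

definition functional_on :: "(real^'n \<Rightarrow> 'b::real_vector) set \<Rightarrow> ((real^'n \<Rightarrow> 'b) \<Rightarrow> real) \<Rightarrow> bool" where
  "functional_on X \<phi> \<longleftrightarrow> lin_on X \<phi> \<and>
     (\<forall>f\<in>X. \<forall>g\<in>X. (\<forall>x\<in>interior body. f x = g x) \<longrightarrow> \<phi> f = \<phi> g)"

lemma functional_onI:
  assumes "\<And>f g s t. f \<in> X \<Longrightarrow> g \<in> X \<Longrightarrow> \<phi> (\<lambda>x. s *\<^sub>R f x + t *\<^sub>R g x) = s * \<phi> f + t * \<phi> g"
    and "\<And>f g. f \<in> X \<Longrightarrow> g \<in> X \<Longrightarrow> (\<And>x. x \<in> interior body \<Longrightarrow> f x = g x) \<Longrightarrow> \<phi> f = \<phi> g"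
  shows "functional_on X \<phi>"
  unfolding functional_on_def lin_on_def using assms by blast

lemma functional_on_lin: "functional_on X \<phi> \<Longrightarrow> lin_on X \<phi>"
  unfolding functional_on_def by blast

lemma functional_on_cong:
  "functional_on X \<phi> \<Longrightarrow> f \<in> X \<Longrightarrow> g \<in> X \<Longrightarrow> (\<And>x. x \<in> interior body \<Longrightarrow> f x = g x) \<Longrightarrow> \<phi> f = \<phi> g"
  unfolding functional_on_def by blast

lemma V_zero: "(\<lambda>x. 0) \<in> V"
  by (simp add: V_def poly_on_zero)

lemma W_zero: "(\<lambda>x. 0) \<in> W"
  by (simp add: W_def poly_on_zero)

lemma functional_on_null_V: "functional_on V \<phi> \<Longrightarrow> f \<in> V \<Longrightarrow> (\<And>x. x \<in> interior body \<Longrightarrow> f x = 0) \<Longrightarrow> \<phi> f = 0"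
  using functional_on_cong[of V \<phi> f "\<lambda>x. 0"] lin_on_zero[OF functional_on_lin V_zero] V_zero by simp

lemma functional_on_null_W: "functional_on W \<phi> \<Longrightarrow> f \<in> W \<Longrightarrow> (\<And>x. x \<in> interior body \<Longrightarrow> f x = 0) \<Longrightarrow> \<phi> f = 0"
  using functional_on_cong[of W \<phi> f "\<lambda>x. 0"] lin_on_zero[OF functional_on_lin W_zero] W_zero by simp

lemma body_lebesgue: "body \<in> sets lebesgue"
  using convex_body compact_body by (simp add: measurable_convex compact_imp_bounded fmeasurableD)

lemma integrable_formA:
  assumes "q \<in> V" "r \<in> V"
  shows "integrable (lebesgue_on body) (\<lambda>x. (c x *v q x) \<bullet> r x)"
proof -
  have "integrable (lebesgue_on body) (\<lambda>x. c x $ i $ j * (q x $ j * r x $ i))" for i j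
  proof (rule Bochner_Integration.integrable_bound)
    have p: "poly_on (k + k) (interior body) (\<lambda>x. q x $ j * r x $ i)"
      using assms by (intro poly_on_mult) (auto simp: V_def)
    have g: "integrable (lebesgue_on body) (\<lambda>x. q x $ j * r x $ i)"
      by (rule integrable_poly_on[OF convex_body compact_body p])
    then show "integrable (lebesgue_on body) (\<lambda>x. B * (q x $ j * r x $ i))" by simp
    have "(\<lambda>x. c x $ i $ j) \<in> borel_measurable (lebesgue_on body)"
      using c_measurable by (simp add: borel_measurable_interior[OF convex_body compact_body])
    then show "(\<lambda>x. c x $ i $ j * (q x $ j * r x $ i)) \<in> borel_measurable (lebesgue_on body)"
      using borel_measurable_integrable[OF g] by (rule borel_measurable_times)
    show "AE x in lebesgue_on body. norm (c x $ i $ j * (q x $ j * r x $ i)) \<le> norm (B * (q x $ j * r x $ i))"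
    proof (rule AE_on_convex[OF convex_body compact_imp_bounded[OF compact_body]])
      fix x assume x: "x \<in> interior body"
      have "\<bar>c x $ i $ j\<bar> \<le> norm (c x $ i)" by (rule component_le_norm_cart)
      also have "\<dots> \<le> norm (c x)" by (rule Finite_Cartesian_Product.norm_nth_le)
      also have "\<dots> \<le> \<bar>B\<bar>" using c_bounded[OF x] by simp
      finally have "\<bar>c x $ i $ j\<bar> \<le> \<bar>B\<bar>" .
      then show "norm (c x $ i $ j * (q x $ j * r x $ i)) \<le> norm (B * (q x $ j * r x $ i))"
        unfolding real_norm_def abs_mult by (rule mult_right_mono) simp
    qed
  qed
  then have "integrable (lebesgue_on body) (\<lambda>x. \<Sum>i\<in>UNIV. \<Sum>j\<in>UNIV. c x $ i $ j * (q x $ j * r x $ i))"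
    by (intro Bochner_Integration.integrable_sum)
  moreover have "(c x *v q x) \<bullet> r x = (\<Sum>i\<in>UNIV. \<Sum>j\<in>UNIV. c x $ i $ j * (q x $ j * r x $ i))" for x
    by (simp add: inner_vec_def matrix_vector_mult_def sum_distrib_right mult.assoc)
  ultimately show ?thesis by simp
qed

lemma formA_commute: "formA q r = formA r q"
  unfolding formA_def vol_ip_def
proof (rule integral_cong_interior[OF convex_body compact_body])
  fix x assume x: "x \<in> interior body"
  have "(c x *v q x) \<bullet> r x = (r x v* c x) \<bullet> q x"
    by (metis dot_lmul_matrix inner_commute)
  also have "r x v* c x = c x *v r x"
    using c_symmetric[OF x] by (metis transpose_matrix_vector)
  finally show "(c x *v q x) \<bullet> r x = (c x *v r x) \<bullet> q x" .
qed

lemma formA_functional1: "r \<in> V \<Longrightarrow> functional_on V (\<lambda>q. formA q r)"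
proof (rule functional_onI)
  fix f g s t assume r: "r \<in> V" and fg: "f \<in> V" "g \<in> V"
  have "(c x *v (s *\<^sub>R f x + t *\<^sub>R g x)) \<bullet> r x = s * ((c x *v f x) \<bullet> r x) + t * ((c x *v g x) \<bullet> r x)" for x
    by (simp add: matrix_vector_right_distrib inner_add_left matrix_vector_mult_scaleR)
  then show "formA (\<lambda>x. s *\<^sub>R f x + t *\<^sub>R g x) r = s * formA f r + t * formA g r"
    using integrable_formA[OF fg(1) r] integrable_formA[OF fg(2) r] by (simp add: formA_def vol_ip_def)
qed (auto simp: formA_def vol_ip_def intro!: integral_cong_interior[OF convex_body compact_body])

lemma formA_functional2: "q \<in> V \<Longrightarrow> functional_on V (formA q)"
  using formA_functional1[of q] formA_commute by (metis (no_types, lifting) ext)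

lemma integrable_formD:
  assumes "u \<in> W" "r \<in> V"
  shows "integrable (lebesgue_on body) (\<lambda>x. u x * dive r x)"
proof -
  have "poly_on (k + k) (interior body) (\<lambda>x. u x * dive r x)"
    using assms(1) dive_poly_on[OF assms(2)] by (intro poly_on_mult) (auto simp: W_def)
  then show ?thesis by (rule integrable_poly_on[OF convex_body compact_body])
qed

lemma formD_functional1: "r \<in> V \<Longrightarrow> functional_on W (\<lambda>u. formD u r)"
proof (rule functional_onI)
  fix f g s t assume r: "r \<in> V" and fg: "f \<in> W" "g \<in> W"
  show "formD (\<lambda>x. s *\<^sub>R f x + t *\<^sub>R g x) r = s * formD f r + t * formD g r"
    using integrable_formD[OF fg(1) r] integrable_formD[OF fg(2) r]
    by (simp add: formD_def vol_ip_def distrib_right mult.assoc)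
qed (auto simp: formD_def vol_ip_def intro!: integral_cong_interior[OF convex_body compact_body])

lemma formD_functional2: "u \<in> W \<Longrightarrow> functional_on V (formD u)"
proof (rule functional_onI)
  fix f g s t assume u: "u \<in> W" and fg: "f \<in> V" "g \<in> V"
  have "formD u (\<lambda>x. s *\<^sub>R f x + t *\<^sub>R g x) = (LINT x|lebesgue_on body. s * (u x * dive f x) + t * (u x * dive g x))"
    unfolding formD_def vol_ip_def
    by (rule integral_cong_interior[OF convex_body compact_body]) (simp add: dive_V_comb[OF fg] algebra_simps)
  then show "formD u (\<lambda>x. s *\<^sub>R f x + t *\<^sub>R g x) = s * formD u f + t * formD u g"
    using integrable_formD[OF u fg(1)] integrable_formD[OF u fg(2)] by (simp add: formD_def vol_ip_def)
next
  fix f g assume "f \<in> V" "g \<in> V" "\<And>x. x \<in> interior body \<Longrightarrow> f x = g x"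
  then show "formD u f = formD u g"
    unfolding formD_def vol_ip_def
    by (intro integral_cong_interior[OF convex_body compact_body]) (simp add: dive_V_cong[of g f])
qed

lemma formS_commute: "formS u w = formS w u"
  unfolding formS_def bd_ip_sum by (simp add: mult_ac)

lemma formS_functional1: "w \<in> W \<Longrightarrow> functional_on W (\<lambda>u. formS u w)"
proof (rule functional_onI)
  fix f g s t assume w: "w \<in> W" and fg: "f \<in> W" "g \<in> W"
  have "formS (\<lambda>x. s *\<^sub>R f x + t *\<^sub>R g x) w =
      bd_ip body (\<lambda>F x. s * (tau F * trace body f x) + t * (tau F * trace body g x)) (\<lambda>F. trace body w)"
    unfolding formS_def by (rule bd_ip_cong) (simp_all add: trace_W_comb[OF fg, simplified] algebra_simps)
  then show "formS (\<lambda>x. s *\<^sub>R f x + t *\<^sub>R g x) w = s * formS f w + t * formS g w"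
    unfolding formS_def
    by (simp add: bd_ip_comb face_polynomials_tau face_polynomials_trace w fg)
next
  fix f g assume "f \<in> W" "g \<in> W" "\<And>x. x \<in> interior body \<Longrightarrow> f x = g x"
  then show "formS f w = formS g w"
    unfolding formS_def by (intro bd_ip_cong) (simp_all add: trace_W_cong[of g f])
qed

lemma formS_functional2: "u \<in> W \<Longrightarrow> functional_on W (formS u)"
  using formS_functional1[of u] formS_commute by (metis (no_types, lifting) ext)

lemma formN_functional: "\<mu> \<in> M \<Longrightarrow> functional_on V (formN \<mu>)"
proof (rule functional_onI)
  fix f g s t assume mu: "\<mu> \<in> M" and fg: "f \<in> V" "g \<in> V"
  have "formN \<mu> (\<lambda>x. s *\<^sub>R f x + t *\<^sub>R g x) =
      bd_ip body (\<lambda>F. \<mu>) (\<lambda>F x. s * (trace body f x \<bullet> outward_normal body F) + t * (trace body g x \<bullet> outward_normal body F))"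
    unfolding formN_def by (rule bd_ip_cong) (simp_all add: trace_V_comb[OF fg] inner_add_left)
  also have "\<dots> = s * formN \<mu> f + t * formN \<mu> g"
    unfolding formN_def bd_ip_commute[of body "\<lambda>F. \<mu>"]
    by (rule bd_ip_comb) (intro face_polynomials_normal_trace face_polynomials_M mu fg)+
  finally show "formN \<mu> (\<lambda>x. s *\<^sub>R f x + t *\<^sub>R g x) = s * formN \<mu> f + t * formN \<mu> g" .
next
  fix f g assume "f \<in> V" "g \<in> V" "\<And>x. x \<in> interior body \<Longrightarrow> f x = g x"
  then show "formN \<mu> f = formN \<mu> g"
    unfolding formN_def by (intro bd_ip_cong) (simp_all add: trace_V_cong[of g f])
qed

lemma formT_functional: "\<mu> \<in> M \<Longrightarrow> functional_on W (formT \<mu>)"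
proof (rule functional_onI)
  fix f g s t assume mu: "\<mu> \<in> M" and fg: "f \<in> W" "g \<in> W"
  have "formT \<mu> (\<lambda>x. s *\<^sub>R f x + t *\<^sub>R g x) =
      bd_ip body (\<lambda>F x. tau F * \<mu> x) (\<lambda>F x. s * trace body f x + t * trace body g x)"
    unfolding formT_def by (rule bd_ip_cong) (simp_all add: trace_W_comb[OF fg, simplified])
  also have "\<dots> = s * formT \<mu> f + t * formT \<mu> g"
    unfolding formT_def bd_ip_commute[of body "\<lambda>F x. tau F * \<mu> x"]
    by (rule bd_ip_comb) (intro face_polynomials_tau face_polynomials_trace face_polynomials_M mu fg)+
  finally show "formT \<mu> (\<lambda>x. s *\<^sub>R f x + t *\<^sub>R g x) = s * formT \<mu> f + t * formT \<mu> g" .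
next
  fix f g assume "f \<in> W" "g \<in> W" "\<And>x. x \<in> interior body \<Longrightarrow> f x = g x"
  then show "formT \<mu> f = formT \<mu> g"
    unfolding formT_def by (intro bd_ip_cong) (simp_all add: trace_W_cong[of g f])
qed

lemma W_subset_L2: "w \<in> W \<Longrightarrow> w \<in> L2 body"
proof -
  assume w: "w \<in> W"
  have "integrable (lebesgue_on body) w"
    using w by (intro integrable_poly_on[OF convex_body compact_body]) (simp add: W_def)
  moreover have "integrable (lebesgue_on body) (\<lambda>x. w x * w x)"
    using w integrable_poly_on[OF convex_body compact_body poly_on_mult] by (auto simp: W_def)
  ultimately show ?thesis by (simp add: L2_def power2_eq_square borel_measurable_integrable)
qed

lemma vol_ip_functional: "f \<in> L2 body \<Longrightarrow> functional_on W (vol_ip body f)"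
proof (rule functional_onI)
  fix g h s t assume "f \<in> L2 body" "g \<in> W" "h \<in> W"
  then show "vol_ip body f (\<lambda>x. s *\<^sub>R g x + t *\<^sub>R h x) = s * vol_ip body f g + t * vol_ip body f h"
    using vol_ip_comb[of g body h f s t] by (simp add: vol_ip_commute[of body f] W_subset_L2)
next
  fix g h assume "g \<in> W" "h \<in> W" "\<And>x. x \<in> interior body \<Longrightarrow> g x = h x"
  then show "vol_ip body f g = vol_ip body f h"
    unfolding vol_ip_def by (intro integral_cong_interior[OF convex_body compact_body]) simp
qed

section \<open>Integration by parts\<close>

text \<open>The divergence theorem for the products of \<open>w\<close> with the components of \<open>q\<close>.\<close>

lemma integration_by_parts:
  assumes q: "q \<in> V" and w: "w \<in> W"
  shows "vol_ip body w (dive q) = - vol_ip body q (grad w) +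
    bd_ip body (\<lambda>F x. trace body q x \<bullet> outward_normal body F) (\<lambda>F. trace body w)"
proof -
  obtain p where p: "\<And>i. (\<lambda>x. p x $ i) \<in> polynomials k" "\<And>x. x \<in> interior body \<Longrightarrow> q x = p x"
    by (rule V_rep[OF q]) blast
  obtain s where s: "s \<in> polynomials k" "\<And>x. x \<in> interior body \<Longrightarrow> w x = s x" by (rule W_rep[OF w]) blast
  have "\<forall>i. \<exists>D. (\<forall>j. D j \<in> polynomials k) \<and> (\<forall>x. ((\<lambda>x. p x $ i) has_derivative (\<lambda>h. \<Sum>j\<in>UNIV. h $ j * D j x)) (at x))"
    using polynomials_derivative[OF p(1)] by blast
  from choice[OF this] obtain D where "\<forall>i. (\<forall>j. D i j \<in> polynomials k) \<and>
      (\<forall>x. ((\<lambda>x. p x $ i) has_derivative (\<lambda>h. \<Sum>j\<in>UNIV. h $ j * D i j x)) (at x))" by (elim exE)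
  then have D: "\<And>i j. D i j \<in> polynomials k"
    "\<And>i x. ((\<lambda>x. p x $ i) has_derivative (\<lambda>h. \<Sum>j\<in>UNIV. h $ j * D i j x)) (at x)" by simp_all
  obtain E where E: "\<And>j. E j \<in> polynomials k" "\<And>x. (s has_derivative (\<lambda>h. \<Sum>j\<in>UNIV. h $ j * E j x)) (at x)"
    using polynomials_derivative[OF s(1)] by blast
  note cont = polynomials_continuous_on[of _ k UNIV]
  have part: "(LINT x|lebesgue_on body. p x $ i * E i x + D i i x * s x)
      = (\<Sum>u\<in>C. normal u $ i * face_integral (face u) (\<lambda>x. p x $ i * s x))" for i
  proof (rule partial_derivative_integral[where D="\<lambda>j x. p x $ i * E j x + D i j x * s x"])
    show "continuous_on UNIV (\<lambda>x. p x $ i * s x)"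
      by (intro continuous_on_mult cont p(1) s(1))
    show "continuous_on UNIV (\<lambda>x. p x $ i * E j x + D i j x * s x)" for j
      by (intro continuous_on_mult continuous_on_add cont p(1) s(1) D(1) E(1))
    fix x
    have "((\<lambda>x. p x $ i * s x) has_derivative
        (\<lambda>h. p x $ i * (\<Sum>j\<in>UNIV. h $ j * E j x) + (\<Sum>j\<in>UNIV. h $ j * D i j x) * s x)) (at x)"
      by (rule has_derivative_mult[OF D(2) E(2)])
    then show "((\<lambda>x. p x $ i * s x) has_derivative (\<lambda>h. \<Sum>j\<in>UNIV. h $ j * (p x $ i * E j x + D i j x * s x))) (at x)"
      by (rule has_derivative_eq_rhs) (simp add: fun_eq_iff sum_distrib_left sum_distrib_right sum.distrib algebra_simps)
  qed
  have int: "integrable (lebesgue_on body) (\<lambda>x. f x * g x)" if "f \<in> polynomials k" "g \<in> polynomials k" for f g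
    using integrable_poly_on[OF convex_body compact_body poly_on_polynomials[OF polynomials_mult[OF that]]] .
  have intD: "integrable (lebesgue_on body) (\<lambda>x. D i i x * s x)" for i by (rule int[OF D(1) s(1)])
  have intE: "integrable (lebesgue_on body) (\<lambda>x. p x $ i * E i x)" for i by (rule int[OF p(1) E(1)])
  have "vol_ip body w (dive q) = (LINT x|lebesgue_on body. (\<Sum>i\<in>UNIV. D i i x * s x))"
    unfolding vol_ip_def
    by (rule integral_cong_interior[OF convex_body compact_body])
       (simp add: s(2) dive_eq[OF p(2) _ D(2)] sum_distrib_left mult.commute)
  moreover have "vol_ip body q (grad w) = (LINT x|lebesgue_on body. (\<Sum>i\<in>UNIV. p x $ i * E i x))"
    unfolding vol_ip_def
    by (rule integral_cong_interior[OF convex_body compact_body])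
       (simp add: p(2) grad_eq[OF s(2) _ E(2)] inner_vec_def)
  ultimately have "vol_ip body w (dive q) + vol_ip body q (grad w) =
      (\<Sum>i\<in>UNIV. (LINT x|lebesgue_on body. p x $ i * E i x + D i i x * s x))"
    using intD intE by (simp add: sum.distrib)
  also have "\<dots> = (\<Sum>u\<in>C. \<Sum>i\<in>UNIV. normal u $ i * face_integral (face u) (\<lambda>x. p x $ i * s x))"
    unfolding part by (rule sum.swap)
  also have "\<dots> = (\<Sum>u\<in>C. face_integral (face u) (\<lambda>x. (p x \<bullet> normal u) * s x))"
  proof (rule sum.cong[OF refl])
    fix u assume u: "u \<in> C"
    let ?P = "lebesgue_on (prism (normal u) (offset u) (face u))" and ?h = "hyperplane_proj (normal u) (offset u)"
    have "integrable ?P (\<lambda>y. p (?h y) $ i * s (?h y))" for i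
      by (rule integrable_face_poly_on[OF u poly_on_polynomials[OF polynomials_mult[OF p(1) s(1)]]])
    then have "(\<Sum>i\<in>UNIV. normal u $ i * (LINT y|?P. p (?h y) $ i * s (?h y))) =
        (LINT y|?P. (\<Sum>i\<in>UNIV. normal u $ i * (p (?h y) $ i * s (?h y))))"
      by simp
    also have "\<dots> = (LINT y|?P. (p (?h y) \<bullet> normal u) * s (?h y))"
      by (intro Bochner_Integration.integral_cong refl) (simp add: inner_vec_def sum_distrib_left mult_ac)
    finally show "(\<Sum>i\<in>UNIV. normal u $ i * face_integral (face u) (\<lambda>x. p x $ i * s x)) =
        face_integral (face u) (\<lambda>x. (p x \<bullet> normal u) * s x)"
      unfolding face_integral_flat[OF flat_face[OF u]] .
  qed
  also have "\<dots> = bd_ip body (\<lambda>F x. p x \<bullet> outward_normal body F) (\<lambda>F. s)"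
    unfolding bd_ip_sum normal_def ..
  also have "\<dots> = bd_ip body (\<lambda>F x. trace body q x \<bullet> outward_normal body F) (\<lambda>F. trace body w)"
    by (rule bd_ip_cong) (simp_all add: trace_V[OF p] trace_W[OF s])
  finally show ?thesis by simp
qed

end

section \<open>The local problems are uniquely solvable\<close>

context hdg_element
begin

lemma formA_nonneg: "q \<in> V \<Longrightarrow> 0 \<le> formA q q"
  unfolding formA_def vol_ip_def
proof (rule integral_nonneg_AE, rule AE_on_convex[OF convex_body compact_imp_bounded[OF compact_body]])
  fix x assume "x \<in> interior body"
  then show "0 \<le> (c x *v q x) \<bullet> q x"
    using c_positive[of x "q x"] by (cases "q x = 0") (auto simp: inner_commute)
qed

text \<open>The coefficient need not be continuous, so vanishing energy first gives \<open>q = 0\<close> almost everywhere; the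
  field itself is continuous in the interior.\<close>

lemma formA_zero:
  assumes q: "q \<in> V" and z: "formA q q = 0" and x: "x \<in> interior body"
  shows "q x = 0"
proof -
  obtain p where p: "\<And>i. (\<lambda>x. p x $ i) \<in> polynomials k" "\<And>x. x \<in> interior body \<Longrightarrow> q x = p x"
    by (rule V_rep[OF q]) blast
  have nn: "AE x in lebesgue_on body. 0 \<le> (c x *v q x) \<bullet> q x"
  proof (rule AE_on_convex[OF convex_body compact_imp_bounded[OF compact_body]])
    fix x assume "x \<in> interior body"
    then show "0 \<le> (c x *v q x) \<bullet> q x"
      using c_positive[of x "q x"] by (cases "q x = 0") (auto simp: inner_commute)
  qed
  have "AE x in lebesgue_on body. (c x *v q x) \<bullet> q x = 0"
    using integral_nonneg_eq_0_iff_AE[OF integrable_formA[OF q q] nn] z by (simp add: formA_def vol_ip_def)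
  moreover have "AE x in lebesgue_on body. x \<in> interior body"
    by (rule AE_on_convex[OF convex_body compact_imp_bounded[OF compact_body]])
  ultimately have "AE x in lebesgue_on body. q x = 0"
  proof eventually_elim
    case (elim x)
    then show ?case using c_positive[of x "q x"] by (metis inner_commute less_irrefl)
  qed
  moreover have "continuous_on (interior body) q"
    using polynomial_vector_isCont[OF p(1)] p(2)
    by (subst continuous_on_cong[where g=p]) (auto intro: continuous_at_imp_continuous_on)
  ultimately show ?thesis using AE_zero_imp_zero_interior[OF body_lebesgue _ _ x] by blast
qed

lemma formS_summand_nonneg:
  assumes u: "u \<in> C" shows "0 \<le> face_integral (face u) (\<lambda>x. tau (face u) * trace body w x * trace body w x)"
  using tau_nonneg[OF u] by (intro face_integral_nonneg[OF flat_face[OF u]]) (simp add: mult.assoc)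

lemma formS_nonneg: "0 \<le> formS w w"
  unfolding formS_def bd_ip_sum by (intro sum_nonneg formS_summand_nonneg)

text \<open>The stabilization is a sum of nonnegative face terms, so each of them vanishes.  Where the penalty is
  positive this forces the trace to vanish on the face, and then the polynomial vanishes on the whole
  hyperplane of the face.\<close>

lemma formS_zero:
  assumes w: "w \<in> W" and p: "p \<in> polynomials k" "\<And>x. x \<in> interior body \<Longrightarrow> w x = p x"
    and z: "formS w w = 0" and u: "u \<in> C" "0 < tau (face u)" and x: "normal u \<bullet> x = offset u"
  shows "p x = 0"
proof -
  have F: "flat_body (normal u) (offset u) (face u)" by (rule flat_face[OF u(1)])
  have zero: "p y = 0" if "y \<in> rel_interior (face u)" for y
  proof -
    have "face_integral (face u) (\<lambda>x. tau (face u) * trace body w x * trace body w x) = 0"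
    proof (rule ccontr)
      assume "\<not> ?thesis"
      then have "0 < face_integral (face u) (\<lambda>x. tau (face u) * trace body w x * trace body w x)"
        using formS_summand_nonneg[OF u(1), of w] by simp
      also have "\<dots> \<le> formS w w"
        unfolding formS_def bd_ip_sum using u(1) finite_vertices formS_summand_nonneg
        by (intro member_le_sum[of u C "\<lambda>u. face_integral (face u) (\<lambda>x. tau (face u) * trace body w x * trace body w x)"]) auto
      finally show False using z by simp
    qed
    moreover have "face_integral (face u) (\<lambda>x. tau (face u) * trace body w x * trace body w x) =
        face_integral (face u) (\<lambda>x. tau (face u) * (p x * p x))"
      by (rule face_integral_cong[OF F])
         (use trace_W[OF p] rel_interior_face_subset[OF u(1)] in
           \<open>auto intro!: continuous_intros polynomials_continuous_on[OF p(1)]\<close>)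
    ultimately have "tau (face u) * (p y * p y) = 0"
      using u(2) by (intro face_integral_zero_imp_zero[OF F, where g="\<lambda>x. tau (face u) * (p x * p x)"] that)
        (auto intro!: continuous_intros polynomials_continuous_on[OF p(1)])
    then show ?thesis using u(2) by simp
  qed
  have "rel_interior (face u) \<noteq> {}"
    using rel_interior_eq_empty flat_bodyD(2,4)[OF F] by blast
  then show ?thesis
    using polynomials_zero_on_affine[OF p(1) affine_affine_hull openin_rel_interior[of "face u"] _ zero]
      flat_bodyD(5)[OF F] x by auto
qed

text \<open>The divergence maps vector fields of degree \<open>k\<close> onto polynomials of lower degree; a polynomial
  that vanishes on a face and is orthogonal to all those is zero, because dividing it by the distance
  to the face, which has one sign in the element, gives one of them.\<close>

lemma polynomial_zero_if_orthogonal_to_divergences: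
  assumes w: "w \<in> W" and p: "p \<in> polynomials k" "\<And>x. x \<in> interior body \<Longrightarrow> w x = p x"
    and u: "u \<in> C" and z: "\<And>x. normal u \<bullet> x = offset u \<Longrightarrow> p x = 0"
    and ortho: "\<And>r. r \<in> V \<Longrightarrow> formD w r = 0" and x: "x \<in> interior body"
  shows "w x = 0"
proof -
  have "normal u \<noteq> 0" using normal_facts(1)[OF u] by auto
  from polynomials_factor_hyperplane[OF p(1) this z]
  obtain g where g: "if k = 0 then g = (\<lambda>_. 0) else g \<in> polynomials (k - 1)"
    "\<And>x. p x = (normal u \<bullet> x - offset u) * g x" by blast
  show ?thesis
  proof (cases "k = 0")
    case True
    then show ?thesis using g p(2)[OF x] by simp
  next
    case False
    fix i :: 'n
    have gk: "g \<in> polynomials (k - 1)" using g(1) False by simp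
    obtain P where P: "P \<in> polynomials k" "\<And>x. ((\<lambda>t. P (x + t *\<^sub>R axis i 1)) has_real_derivative g x) (at 0)"
      using polynomials_antiderivative[OF gk, of i] False by auto
    obtain E where E: "\<And>j. E j \<in> polynomials k" "\<And>x. (P has_derivative (\<lambda>h. \<Sum>j\<in>UNIV. h $ j * E j x)) (at x)"
      using polynomials_derivative[OF P(1)] by blast
    have Ei: "E i x = g x" for x
    proof -
      have "((\<lambda>t. x + t *\<^sub>R axis i 1) has_derivative (\<lambda>s. s *\<^sub>R axis i 1)) (at 0)"
        by (auto intro!: derivative_eq_intros)
      moreover have "(P has_derivative (\<lambda>h. \<Sum>j\<in>UNIV. h $ j * E j x)) (at (x + 0 *\<^sub>R axis i 1))"
        using E(2)[of x] by simp
      ultimately have "((\<lambda>t. P (x + t *\<^sub>R axis i 1)) has_derivative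
          (\<lambda>s. \<Sum>j\<in>UNIV. (s *\<^sub>R axis i 1) $ j * E j x)) (at 0)"
        by (rule has_derivative_compose)
      moreover have "(\<lambda>s. \<Sum>j\<in>UNIV. (s *\<^sub>R axis i 1 :: real^'n) $ j * E j x) = (*) (E i x)"
      proof
        fix s
        have "(\<Sum>j\<in>UNIV. (s *\<^sub>R axis i 1 :: real^'n) $ j * E j x) = (\<Sum>j\<in>UNIV. if j = i then E j x * s else 0)"
          by (rule sum.cong) (auto simp: axis_def)
        then show "(\<Sum>j\<in>UNIV. (s *\<^sub>R axis i 1 :: real^'n) $ j * E j x) = E i x * s" by simp
      qed
      ultimately have "((\<lambda>t. P (x + t *\<^sub>R axis i 1)) has_real_derivative E i x) (at 0)"
        by (simp add: has_field_derivative_def)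
      then show ?thesis using P(2) DERIV_unique by blast
    qed
    define r where "r x = P x *\<^sub>R (axis i 1 :: real^'n)" for x :: "real^'n"
    have rj: "(\<lambda>x. r x $ j) = (if j = i then P else (\<lambda>x. 0))" for j
      by (auto simp: r_def axis_def fun_eq_iff)
    have rV: "r \<in> V"
      unfolding V_def using P(1) by (auto simp: rj intro: poly_on_polynomials poly_on_zero)
    have der: "((\<lambda>x. r x $ j) has_derivative (\<lambda>h. \<Sum>l\<in>UNIV. h $ l * (if j = i then E l y else 0))) (at y)" for j y
      using E(2)[of y] by (cases "j = i") (simp_all add: rj)
    have "dive r y = g y" for y
    proof -
      have "dive r y = (\<Sum>l\<in>UNIV. if l = i then E l y else 0)"
        by (rule dive_eq[where K=UNIV and p=r and D="\<lambda>j l. if j = i then E l y else 0"]) (auto intro: der)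
      then show ?thesis by (simp add: Ei)
    qed
    then have "(LINT x|lebesgue_on body. (offset u - normal u \<bullet> x) * (g x * g x)) = - formD w r"
      unfolding formD_def vol_ip_def
      by (subst integral_cong_interior[OF convex_body compact_body, of _ "\<lambda>x. - (w x \<bullet> dive r x)"])
         (auto simp: p(2) g(2) algebra_simps)
    then have zero: "(LINT x|lebesgue_on body. (offset u - normal u \<bullet> x) * (g x * g x)) = 0"
      using ortho[OF rV] by simp
    have "(offset u - normal u \<bullet> x) * (g x * g x) = 0"
    proof (rule nonneg_integral_zero_imp_zero[OF convex_body compact_body, where f="\<lambda>x. (offset u - normal u \<bullet> x) * (g x * g x)"
          and g="\<lambda>x. (offset u - normal u \<bullet> x) * (g x * g x)"])
      show "continuous_on body (\<lambda>x. (offset u - normal u \<bullet> x) * (g x * g x))"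
        by (intro continuous_intros polynomials_continuous_on[OF gk])
      show "0 \<le> (offset u - normal u \<bullet> y) * (g y * g y)" if "y \<in> body" for y
        using that u by (simp add: mem_body_iff)
    qed (use zero x in auto)
    then show ?thesis using p(2)[OF x] g(2)[of x] by auto
  qed
qed

text \<open>Testing with the solution itself cancels the divergence terms and leaves two nonnegative energies.\<close>

lemma local_unique:
  assumes q: "q \<in> V" and w: "w \<in> W"
    and eq1: "\<And>r. r \<in> V \<Longrightarrow> formA q r - formD w r = 0"
    and eq2: "\<And>v. v \<in> W \<Longrightarrow> formD v q + formS w v = 0"
    and x: "x \<in> interior body"
  shows "q x = 0" "w x = 0"
proof -
  have "formA q q + formS w w = 0" using eq1[OF q] eq2[OF w] by simp
  then have z: "formA q q = 0" "formS w w = 0"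
    using formA_nonneg[OF q] formS_nonneg[of w] by simp_all
  then show "q x = 0" using formA_zero[OF q _ x] by simp
  obtain p where p: "p \<in> polynomials k" "\<And>x. x \<in> interior body \<Longrightarrow> w x = p x" by (rule W_rep[OF w]) blast
  obtain u where u: "u \<in> C" "0 < tau (face u)" using tau_positive by blast
  have ortho: "formD w r = 0" if r: "r \<in> V" for r
    using eq1[OF r] functional_on_null_V[OF formA_functional1[OF r] q] formA_zero[OF q z(1)] by simp
  show "w x = 0"
    by (rule polynomial_zero_if_orthogonal_to_divergences[OF w p u(1) formS_zero[OF w p z(2) u] ortho x])
qed

text \<open>Pairs of a polynomial vector field and a polynomial have one coefficient for each monomial and each
  component, where \<open>None\<close> stands for the scalar component.\<close>

definition coefficients :: "(('n \<Rightarrow> nat) \<times> 'n option) set" where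
  "coefficients = {m. sum m UNIV \<le> k} \<times> UNIV"

definition vec_of :: "(('n \<Rightarrow> nat) \<times> 'n option \<Rightarrow> real) \<Rightarrow> real^'n \<Rightarrow> real^'n" where
  "vec_of a x = (\<chi> i. \<Sum>m | sum m UNIV \<le> k. a (m, Some i) * monomial_fun m x)"

definition scal_of :: "(('n \<Rightarrow> nat) \<times> 'n option \<Rightarrow> real) \<Rightarrow> real^'n \<Rightarrow> real" where
  "scal_of a x = (\<Sum>m | sum m UNIV \<le> k. a (m, None) * monomial_fun m x)"

lemma finite_coefficients: "finite coefficients"
  unfolding coefficients_def by (intro finite_cartesian_product finite_exponents finite)

lemma vec_of_V: "vec_of a \<in> V"
  unfolding V_def vec_of_def by (auto intro!: poly_on_polynomials simp: polynomials_iff)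

lemma scal_of_W: "scal_of a \<in> W"
  unfolding W_def scal_of_def[abs_def] by (auto intro!: poly_on_polynomials simp: polynomials_iff)

lemma vec_of_comb: "vec_of (\<lambda>j. s *\<^sub>R a j + t *\<^sub>R b j) = (\<lambda>x. s *\<^sub>R vec_of a x + t *\<^sub>R vec_of b x)"
  by (simp add: vec_of_def fun_eq_iff vec_eq_iff sum_distrib_left sum.distrib distrib_right mult.assoc)

lemma scal_of_comb: "scal_of (\<lambda>j. s *\<^sub>R a j + t *\<^sub>R b j) = (\<lambda>x. s *\<^sub>R scal_of a x + t *\<^sub>R scal_of b x)"
  by (simp add: scal_of_def fun_eq_iff sum_distrib_left sum.distrib distrib_right mult.assoc)

lemma vec_of_cong: "(\<And>i. i \<in> coefficients \<Longrightarrow> a i = b i) \<Longrightarrow> vec_of a = vec_of b"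
  by (auto simp: vec_of_def fun_eq_iff vec_eq_iff coefficients_def intro!: sum.cong)

lemma scal_of_cong: "(\<And>i. i \<in> coefficients \<Longrightarrow> a i = b i) \<Longrightarrow> scal_of a = scal_of b"
  by (auto simp: scal_of_def fun_eq_iff coefficients_def intro!: sum.cong)

lemma V_coefficients:
  assumes "v \<in> V" obtains a where "scal_of a = (\<lambda>x. 0)" "\<And>x. x \<in> interior body \<Longrightarrow> v x = vec_of a x"
proof -
  obtain p where p: "\<And>i. (\<lambda>x. p x $ i) \<in> polynomials k" "\<And>x. x \<in> interior body \<Longrightarrow> v x = p x"
    by (rule V_rep[OF assms]) blast
  have "\<forall>i. \<exists>a. (\<lambda>x. p x $ i) = (\<lambda>x. \<Sum>m | sum m UNIV \<le> k. a m * monomial_fun m x)"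
    using p(1) unfolding polynomials_iff by blast
  from choice[OF this] obtain a where a: "\<And>i. (\<lambda>x. p x $ i) = (\<lambda>x. \<Sum>m | sum m UNIV \<le> k. a i m * monomial_fun m x)"
    by blast
  define b where "b = (\<lambda>(m, j). case j of None \<Rightarrow> 0 | Some i \<Rightarrow> a i m)"
  have "p x $ i = (\<Sum>m | sum m UNIV \<le> k. a i m * monomial_fun m x)" for x i using fun_cong[OF a[of i]] .
  then have "p x = vec_of b x" for x by (simp add: vec_of_def b_def vec_eq_iff)
  then show ?thesis using p(2) by (intro that[of b]) (auto simp: scal_of_def b_def)
qed

lemma W_coefficients:
  assumes "w \<in> W" obtains a where "vec_of a = (\<lambda>x. 0)" "\<And>x. x \<in> interior body \<Longrightarrow> w x = scal_of a x"
proof -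
  obtain p where p: "p \<in> polynomials k" "\<And>x. x \<in> interior body \<Longrightarrow> w x = p x"
    by (rule W_rep[OF assms]) blast
  obtain a where a: "p = (\<lambda>x. \<Sum>m | sum m UNIV \<le> k. a m * monomial_fun m x)"
    using p(1) unfolding polynomials_iff by blast
  define b where "b = (\<lambda>(m, j). case j of None \<Rightarrow> a m | Some (i :: 'n) \<Rightarrow> 0)"
  show ?thesis
    using p(2) by (intro that[of b]) (auto simp: scal_of_def vec_of_def b_def a vec_eq_iff fun_eq_iff)
qed

lemma lin_on_vec_of: "functional_on V \<phi> \<Longrightarrow> lin_on UNIV (\<lambda>a. \<phi> (vec_of a))"
  using lin_onD[OF functional_on_lin vec_of_V vec_of_V] by (simp add: lin_on_def vec_of_comb[simplified])

lemma lin_on_scal_of: "functional_on W \<phi> \<Longrightarrow> lin_on UNIV (\<lambda>a. \<phi> (scal_of a))"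
  using lin_onD[OF functional_on_lin scal_of_W scal_of_W] by (simp add: lin_on_def scal_of_comb[simplified])

text \<open>The adjoint of the (possibly shifted) local problem is the same problem with the sign of the
  vector component changed, so uniqueness for the problem gives solvability.\<close>

lemma local_solvable:
  assumes unique: "\<And>q w x. q \<in> V \<Longrightarrow> w \<in> W \<Longrightarrow> (\<And>r. r \<in> V \<Longrightarrow> formA q r - formD w r = 0) \<Longrightarrow>
      (\<And>v. v \<in> W \<Longrightarrow> formD v q + formS w v - \<sigma> * vol_ip body w v = 0) \<Longrightarrow> x \<in> interior body \<Longrightarrow> w x = 0"
    and l1: "functional_on V l1" and l2: "functional_on W l2"
  shows "\<exists>q\<in>V. \<exists>w\<in>W. (\<forall>r\<in>V. formA q r - formD w r = l1 r) \<and>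
      (\<forall>v\<in>W. formD v q + formS w v - \<sigma> * vol_ip body w v = l2 v)"
proof -
  have volf: "functional_on W (vol_ip body w)" if "w \<in> W" for w
    by (rule vol_ip_functional[OF W_subset_L2[OF that]])
  define \<beta> where "\<beta> a b = formA (vec_of a) (vec_of b) - formD (scal_of a) (vec_of b) + formD (scal_of b) (vec_of a)
      + formS (scal_of a) (scal_of b) - \<sigma> * vol_ip body (scal_of a) (scal_of b)" for a b
  have "\<exists>a. \<forall>b. \<beta> a b = l1 (vec_of b) + l2 (scal_of b)"
  proof (rule bilinear_solvable[OF finite_coefficients])
    show "lin_on UNIV (\<lambda>a. \<beta> a b)" for b
      unfolding \<beta>_def vol_ip_commute[of body _ "scal_of b"]
      by (intro lin_on_plus lin_on_minus lin_on_cmult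
          lin_on_vec_of[OF formA_functional1[OF vec_of_V]] lin_on_scal_of[OF formD_functional1[OF vec_of_V]]
          lin_on_vec_of[OF formD_functional2[OF scal_of_W]] lin_on_scal_of[OF formS_functional1[OF scal_of_W]]
          lin_on_scal_of[OF volf[OF scal_of_W]])
    show "lin_on UNIV (\<beta> a)" for a
      unfolding \<beta>_def
      by (intro lin_on_plus lin_on_minus lin_on_cmult
          lin_on_vec_of[OF formA_functional2[OF vec_of_V]] lin_on_vec_of[OF formD_functional2[OF scal_of_W]]
          lin_on_scal_of[OF formD_functional1[OF vec_of_V]] lin_on_scal_of[OF formS_functional2[OF scal_of_W]]
          lin_on_scal_of[OF volf[OF scal_of_W]])
    show "lin_on UNIV (\<lambda>b. l1 (vec_of b) + l2 (scal_of b))"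
      by (intro lin_on_plus lin_on_vec_of lin_on_scal_of l1 l2)
    show "\<beta> a b = \<beta> a' b" if "\<And>i. i \<in> coefficients \<Longrightarrow> a i = a' i" for a a' b
      using vec_of_cong[of a a'] scal_of_cong[of a a'] that by (simp add: \<beta>_def)
    show "\<beta> a b = \<beta> a b'" if "\<And>i. i \<in> coefficients \<Longrightarrow> b i = b' i" for a b b'
      using vec_of_cong[of b b'] scal_of_cong[of b b'] that by (simp add: \<beta>_def)
    show "l1 (vec_of b) + l2 (scal_of b) = l1 (vec_of b') + l2 (scal_of b')"
      if "\<And>i. i \<in> coefficients \<Longrightarrow> b i = b' i" for b b'
      using vec_of_cong[of b b'] scal_of_cong[of b b'] that by simp
    fix b assume ker: "\<And>a. \<beta> a b = 0"
    let ?q = "vec_of b" and ?w = "scal_of b"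
    \<comment> \<open>\<open>b\<close> is in the kernel of the transposed form: changing the sign of its field turns the equations
      into those of the homogeneous problem, because \<open>formA\<close> and \<open>formS\<close> are symmetric\<close>
    define q' where "q' = (\<lambda>x. (-1) *\<^sub>R ?q x)"
    have q': "q' \<in> V" using V_comb[OF vec_of_V vec_of_V, of "-1" b 0 b] by (simp add: q'_def)
    have neg: "\<phi> q' = - \<phi> ?q" if "functional_on V \<phi>" for \<phi>
      using lin_on_scale[OF functional_on_lin[OF that] vec_of_V, of "-1" b] by (simp add: q'_def)
    have z1: "formA q' r - formD ?w r = 0" if r: "r \<in> V" for r
    proof -
      obtain a where a: "scal_of a = (\<lambda>x. 0)" "\<And>x. x \<in> interior body \<Longrightarrow> r x = vec_of a x"
        by (rule V_coefficients[OF r]) blast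
      have "formD (\<lambda>x. 0) ?q = 0" "formS (\<lambda>x. 0) ?w = 0" "vol_ip body (\<lambda>x. 0) ?w = 0"
        using lin_on_zero[OF functional_on_lin[OF formD_functional1[OF vec_of_V]] W_zero]
          lin_on_zero[OF functional_on_lin[OF formS_functional1[OF scal_of_W]] W_zero]
        by (simp_all add: vol_ip_def)
      then have "formA (vec_of a) ?q + formD ?w (vec_of a) = 0"
        using ker[of a] by (simp add: \<beta>_def a(1))
      moreover have "formA r ?q = formA (vec_of a) ?q"
        by (rule functional_on_cong[OF formA_functional1[OF vec_of_V] r vec_of_V a(2)])
      moreover have "formD ?w r = formD ?w (vec_of a)"
        by (rule functional_on_cong[OF formD_functional2[OF scal_of_W] r vec_of_V a(2)])
      ultimately show ?thesis using neg[OF formA_functional1[OF r]] by (simp add: formA_commute[of r])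
    qed
    have z2: "formD v q' + formS ?w v - \<sigma> * vol_ip body ?w v = 0" if v: "v \<in> W" for v
    proof -
      obtain a where a: "vec_of a = (\<lambda>x. 0)" "\<And>x. x \<in> interior body \<Longrightarrow> v x = scal_of a x"
        by (rule W_coefficients[OF v]) blast
      have "formA (\<lambda>x. 0) ?q = 0" "formD ?w (\<lambda>x. 0) = 0"
        using lin_on_zero[OF functional_on_lin[OF formA_functional1[OF vec_of_V]] V_zero]
          lin_on_zero[OF functional_on_lin[OF formD_functional2[OF scal_of_W]] V_zero] by simp_all
      then have "- formD (scal_of a) ?q + formS (scal_of a) ?w - \<sigma> * vol_ip body (scal_of a) ?w = 0"
        using ker[of a] by (simp add: \<beta>_def a(1))
      moreover have "formD v ?q = formD (scal_of a) ?q"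
        by (rule functional_on_cong[OF formD_functional1[OF vec_of_V] v scal_of_W a(2)])
      moreover have "formS v ?w = formS (scal_of a) ?w"
        by (rule functional_on_cong[OF formS_functional1[OF scal_of_W] v scal_of_W a(2)])
      moreover have "vol_ip body ?w v = vol_ip body ?w (scal_of a)"
        by (rule functional_on_cong[OF volf[OF scal_of_W] v scal_of_W a(2)])
      ultimately show ?thesis
        using neg[OF formD_functional2[OF v]] by (simp add: formS_commute[of ?w] vol_ip_commute[of body ?w])
    qed
    have w0: "?w x = 0" if "x \<in> interior body" for x
      using unique[OF q' scal_of_W z1 z2 that] by blast
    have "formA q' q' = 0"
      using z1[OF q'] functional_on_null_W[OF formD_functional1[OF q'] scal_of_W w0] by simp
    then have "?q x = 0" if "x \<in> interior body" for x
      using formA_zero[OF q' _ that] by (simp add: q'_def)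
    then show "l1 ?q + l2 ?w = 0"
      using functional_on_null_V[OF l1 vec_of_V] functional_on_null_W[OF l2 scal_of_W w0] by simp
  qed
  then obtain a where a: "\<And>b. \<beta> a b = l1 (vec_of b) + l2 (scal_of b)" by blast
  let ?q = "vec_of a" and ?w = "scal_of a"
  have "formA ?q r - formD ?w r = l1 r" if r: "r \<in> V" for r
  proof -
    obtain b where b: "scal_of b = (\<lambda>x. 0)" "\<And>x. x \<in> interior body \<Longrightarrow> r x = vec_of b x"
      by (rule V_coefficients[OF r]) blast
    have "formD (\<lambda>x. 0) ?q = 0" "formS ?w (\<lambda>x. 0) = 0" "vol_ip body ?w (\<lambda>x. 0) = 0" "l2 (\<lambda>x. 0) = 0"
      using lin_on_zero[OF functional_on_lin[OF formD_functional1[OF vec_of_V]] W_zero]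
        lin_on_zero[OF functional_on_lin[OF formS_functional2[OF scal_of_W]] W_zero]
        lin_on_zero[OF functional_on_lin[OF l2] W_zero]
      by (simp_all add: vol_ip_def)
    then have "formA ?q (vec_of b) - formD ?w (vec_of b) = l1 (vec_of b)"
      using a[of b] by (simp add: \<beta>_def b(1))
    then show ?thesis
      using functional_on_cong[OF formA_functional2[OF vec_of_V] r vec_of_V b(2)]
        functional_on_cong[OF formD_functional2[OF scal_of_W] r vec_of_V b(2)]
        functional_on_cong[OF l1 r vec_of_V b(2)] by simp
  qed
  moreover have "formD v ?q + formS ?w v - \<sigma> * vol_ip body ?w v = l2 v" if v: "v \<in> W" for v
  proof -
    obtain b where b: "vec_of b = (\<lambda>x. 0)" "\<And>x. x \<in> interior body \<Longrightarrow> v x = scal_of b x"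
      by (rule W_coefficients[OF v]) blast
    have "formA ?q (\<lambda>x. 0) = 0" "formD ?w (\<lambda>x. 0) = 0" "l1 (\<lambda>x. 0) = 0"
      using lin_on_zero[OF functional_on_lin[OF formA_functional2[OF vec_of_V]] V_zero]
        lin_on_zero[OF functional_on_lin[OF formD_functional2[OF scal_of_W]] V_zero]
        lin_on_zero[OF functional_on_lin[OF l1] V_zero] by simp_all
    then have "formD (scal_of b) ?q + formS ?w (scal_of b) - \<sigma> * vol_ip body ?w (scal_of b) = l2 (scal_of b)"
      using a[of b] by (simp add: \<beta>_def b(1))
    then show ?thesis
      using functional_on_cong[OF formD_functional1[OF vec_of_V] v scal_of_W b(2)]
        functional_on_cong[OF formS_functional2[OF scal_of_W] v scal_of_W b(2)]
        functional_on_cong[OF volf[OF scal_of_W] v scal_of_W b(2)]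
        functional_on_cong[OF l2 v scal_of_W b(2)] by simp
  qed
  ultimately show ?thesis using vec_of_V scal_of_W by blast
qed

end

section \<open>The inverse of the coefficient\<close>

lemma matrix_inv_spd:
  fixes A :: "real^'n^'n"
  assumes sym: "transpose A = A" and pos: "\<And>v. v \<noteq> 0 \<Longrightarrow> 0 < v \<bullet> (A *v v)"
  shows "A ** matrix_inv A = mat 1" "matrix_inv A ** A = mat 1" "transpose (matrix_inv A) = matrix_inv A"
    "\<And>v. v \<noteq> 0 \<Longrightarrow> 0 < v \<bullet> (matrix_inv A *v v)" "det A \<noteq> 0"
proof -
  have "x = 0" if "A *v x = 0" for x using pos[of x] that by (cases "x = 0") auto
  then have inv: "invertible A" unfolding invertible_left_inverse matrix_left_invertible_ker by blast
  then show "det A \<noteq> 0" by (simp add: invertible_det_nz)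
  show 1: "A ** matrix_inv A = mat 1" and 2: "matrix_inv A ** A = mat 1"
    using someI_ex[of "\<lambda>A'. A ** A' = mat 1 \<and> A' ** A = mat 1"] inv
    unfolding invertible_def matrix_inv_def by blast+
  have "transpose (matrix_inv A) ** A = mat 1"
    using arg_cong[OF 1, of transpose] sym by (simp add: matrix_transpose_mul transpose_mat)
  then have "transpose (matrix_inv A) ** A ** matrix_inv A = matrix_inv A" by simp
  then show "transpose (matrix_inv A) = matrix_inv A"
    by (simp add: matrix_mul_assoc[symmetric] 1)
  fix v :: "real^'n" assume v: "v \<noteq> 0"
  let ?w = "matrix_inv A *v v"
  have Aw: "A *v ?w = v" by (simp add: matrix_vector_mul_assoc 1)
  then have "?w \<noteq> 0" using v by auto
  from pos[OF this] show "0 < v \<bullet> ?w" by (simp add: Aw inner_commute)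
qed

text \<open>Cramer's rule; it makes the entries of the inverse measurable functions of the matrix.\<close>

lemma matrix_inv_entry:
  fixes A :: "real^'n^'n"
  assumes "A ** matrix_inv A = mat 1" "det A \<noteq> 0"
  shows "matrix_inv A $ i $ j = det (\<chi> i' j'. if j' = i then axis j 1 $ i' else A $ i' $ j') / det A"
proof -
  have "A *v (matrix_inv A *v axis j 1) = axis j 1" using assms(1) by (simp add: matrix_vector_mul_assoc)
  then have "matrix_inv A *v axis j 1 = (\<chi> k. det (\<chi> i' j'. if j' = k then axis j 1 $ i' else A $ i' $ j') / det A)"
    using cramer[OF assms(2)] by blast
  then have "(matrix_inv A *v axis j 1) $ i = det (\<chi> i' j'. if j' = i then axis j 1 $ i' else A $ i' $ j') / det A"
    by simp
  then show ?thesis by (simp add: matrix_vector_mul_component matrix_vector_mult_basis column_def)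
qed

lemma borel_measurable_det:
  fixes f :: "'a \<Rightarrow> real^'n^'n"
  assumes "\<And>i j. (\<lambda>x. f x $ i $ j) \<in> borel_measurable M"
  shows "(\<lambda>x. det (f x)) \<in> borel_measurable M"
  unfolding det_def by (intro borel_measurable_sum borel_measurable_times borel_measurable_prod borel_measurable_const assms)

section \<open>The mesh\<close>

locale hdg_mesh =
  fixes \<Omega> :: "(real^'n) set" and T :: "(real^'n) set set" and \<alpha> :: "real^'n \<Rightarrow> real^'n^'n"
    and \<tau> :: "'n penalty" and k :: nat and B :: real
  assumes domain: "polyhedral_domain \<Omega>" and mesh: "simplicial_mesh \<Omega> T"
    and coefficient: "admissible_coefficient \<Omega> B \<alpha>" and penalty: "admissible_penalty T \<tau>"
begin

definition vertices :: "(real^'n) set \<Rightarrow> (real^'n) set" where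
  "vertices K = (SOME C. \<not> affine_dependent C \<and> card C = Suc CARD('n) \<and> K = convex hull C)"

lemma vertices:
  assumes "K \<in> T"
  shows "\<not> affine_dependent (vertices K)" "card (vertices K) = Suc CARD('n)" "convex hull (vertices K) = K"
proof -
  obtain C where "\<not> affine_dependent C" "int (card C) = int CARD('n) + 1" "K = convex hull C"
    using assms mesh unfolding simplicial_mesh_def simplex_def by blast
  then have "\<exists>C. \<not> affine_dependent C \<and> card C = Suc CARD('n) \<and> K = convex hull C" by (intro exI[of _ C]) auto
  from someI_ex[OF this]
  show "\<not> affine_dependent (vertices K)" "card (vertices K) = Suc CARD('n)" "convex hull (vertices K) = K"
    unfolding vertices_def by auto
qed

lemma finite_T: "finite T"
  using mesh unfolding simplicial_mesh_def triangulation_def by blast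

lemma interior_subset_domain: "K \<in> T \<Longrightarrow> interior K \<subseteq> \<Omega>"
  using mesh unfolding simplicial_mesh_def by blast

text \<open>The intersection of two elements is a face of both, and a face that contains an interior point is
  the whole element.\<close>

lemma interiors_disjoint:
  assumes "K \<in> T" "K' \<in> T" "x \<in> interior K" "x \<in> interior K'"
  shows "K = K'"
proof -
  have f: "(K \<inter> K') face_of K" "(K \<inter> K') face_of K'"
    using mesh assms(1,2) unfolding simplicial_mesh_def triangulation_def by (metis inf_commute)+
  have x: "x \<in> K \<inter> K'" using assms(3,4) interior_subset by blast
  have "K \<inter> K' = K" using face_of_disjoint_interior[OF f(1)] x assms(3) by blast
  moreover have "K \<inter> K' = K'" using face_of_disjoint_interior[OF f(2)] x assms(4) by blast
  ultimately show ?thesis by simp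
qed

lemma domain_lebesgue: "\<Omega> \<in> sets lebesgue"
  using domain unfolding polyhedral_domain_def by (simp add: borel_open)

abbreviation cc :: "real^'n \<Rightarrow> real^'n^'n" where "cc x \<equiv> matrix_inv (\<alpha> x)"

lemma alpha_spd:
  assumes "x \<in> \<Omega>"
  shows "transpose (\<alpha> x) = \<alpha> x" "\<And>v. v \<noteq> 0 \<Longrightarrow> 0 < v \<bullet> (\<alpha> x *v v)" "norm (cc x) \<le> B"
  using coefficient assms unfolding admissible_coefficient_def by auto

lemma full_simplex: "K \<in> T \<Longrightarrow> full_simplex (vertices K)"
  using vertices by unfold_locales auto

lemma element:
  assumes K: "K \<in> T"
  shows "hdg_element (vertices K) cc (\<tau> K) B"
proof -
  interpret full_simplex "vertices K" rewrites "convex hull (vertices K) = K"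
    using full_simplex[OF K] vertices(3)[OF K] by simp_all
  have sub: "interior K \<subseteq> \<Omega>" by (rule interior_subset_domain[OF K])
  have facet: "F facet_of K \<longleftrightarrow> (\<exists>u\<in>vertices K. F = face u)" for F
    using facets by blast
  show ?thesis
  proof (intro hdg_element.intro full_simplex[OF K] hdg_element_axioms.intro, unfold vertices(3)[OF K])
    have ent: "(\<lambda>x. \<alpha> x $ i $ j) \<in> borel_measurable (lebesgue_on (interior K))" for i j
    proof -
      have "(\<lambda>A :: real^'n^'n. A $ i $ j) \<in> borel_measurable borel"
        by (intro borel_measurable_continuous_onI continuous_intros)
      moreover have "\<alpha> \<in> borel_measurable (lebesgue_on \<Omega>)"
        using coefficient unfolding admissible_coefficient_def by blast
      ultimately have "(\<lambda>x. \<alpha> x $ i $ j) \<in> borel_measurable (lebesgue_on \<Omega>)"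
        using measurable_compose by blast
      then show ?thesis by (rule measurable_restrict_mono[OF _ sub])
    qed
    fix i j
    have "(\<lambda>x. det (\<chi> i' j'. if j' = i then axis j 1 $ i' else \<alpha> x $ i' $ j') / det (\<alpha> x))
        \<in> borel_measurable (lebesgue_on (interior K))"
    proof (intro borel_measurable_divide borel_measurable_det)
      show "(\<lambda>x. (\<chi> i' j'. if j' = i then axis j 1 $ i' else \<alpha> x $ i' $ j') $ i' $ j')
          \<in> borel_measurable (lebesgue_on (interior K))" for i' j'
        using ent[of i' j'] by (cases "j' = i") auto
    qed (rule ent)
    then show "(\<lambda>x. cc x $ i $ j) \<in> borel_measurable (lebesgue_on (interior K))"
    proof (rule measurable_cong[THEN iffD1, rotated])
      fix x assume "x \<in> space (lebesgue_on (interior K))"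
      then have "x \<in> \<Omega>" using sub by auto
      note spd = alpha_spd[OF this]
      show "det (\<chi> i' j'. if j' = i then axis j 1 $ i' else \<alpha> x $ i' $ j') / det (\<alpha> x) = cc x $ i $ j"
        by (rule matrix_inv_entry[symmetric]) (rule matrix_inv_spd[OF spd(1) spd(2)], assumption)+
    qed
  next
    fix x assume "x \<in> interior K"
    then have x: "x \<in> \<Omega>" using sub by blast
    show "transpose (cc x) = cc x" by (rule matrix_inv_spd(3)[OF alpha_spd(1,2)[OF x]])
    show "0 < v \<bullet> (cc x *v v)" if "v \<noteq> 0" for v by (rule matrix_inv_spd(4)[OF alpha_spd(1,2)[OF x] that])
    show "norm (cc x) \<le> B" by (rule alpha_spd(3)[OF x])
  next
    have pen: "\<And>F. F facet_of K \<Longrightarrow> 0 \<le> \<tau> K F" "\<exists>F. F facet_of K \<and> 0 < \<tau> K F"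
      using penalty K unfolding admissible_penalty_def by blast+
    show "0 \<le> \<tau> K (face u)" if "u \<in> vertices K" for u
      using pen(1) that facet by blast
    obtain F where F: "F facet_of K" "0 < \<tau> K F" using pen(2) by auto
    then obtain u where "u \<in> vertices K" "F = face u" using facet[of F] by auto
    then show "\<exists>u\<in>vertices K. 0 < \<tau> K (face u)" using F by auto
  qed
qed

lemma Wh_zero_outside: "w \<in> Wh k T \<Longrightarrow> (\<And>K. K \<in> T \<Longrightarrow> x \<notin> interior K) \<Longrightarrow> w x = 0"
  unfolding Wh_def by blast

lemma Vh_zero_outside: "v \<in> Vh k T \<Longrightarrow> (\<And>K. K \<in> T \<Longrightarrow> x \<notin> interior K) \<Longrightarrow> v x = 0"
  unfolding Vh_def by blast

lemma Wh_eqI: "w \<in> Wh k T \<Longrightarrow> w' \<in> Wh k T \<Longrightarrow> (\<And>K x. K \<in> T \<Longrightarrow> x \<in> interior K \<Longrightarrow> w x = w' x) \<Longrightarrow> w = w'"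
  by (rule ext) (metis Wh_zero_outside)

lemma Vh_eqI: "v \<in> Vh k T \<Longrightarrow> v' \<in> Vh k T \<Longrightarrow> (\<And>K x. K \<in> T \<Longrightarrow> x \<in> interior K \<Longrightarrow> v x = v' x) \<Longrightarrow> v = v'"
  by (rule ext) (metis Vh_zero_outside)

lemma Wh_comb: "f \<in> Wh k T \<Longrightarrow> g \<in> Wh k T \<Longrightarrow> (\<lambda>x. s * f x + t * g x) \<in> Wh k T"
  unfolding Wh_def by (simp add: poly_on_add poly_on_scale)

lemma Vh_comb: "f \<in> Vh k T \<Longrightarrow> g \<in> Vh k T \<Longrightarrow> (\<lambda>x. s *\<^sub>R f x + t *\<^sub>R g x) \<in> Vh k T"
  unfolding Vh_def by (simp add: poly_on_add poly_on_scale)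

lemma Wh_zero: "(\<lambda>x. 0) \<in> Wh k T"
  unfolding Wh_def by (simp add: poly_on_zero)

lemma Vh_zero: "(\<lambda>x. 0) \<in> Vh k T"
  unfolding Vh_def by (simp add: poly_on_zero)

text \<open>Outside the interiors of the elements the value is zero, as the discrete spaces prescribe.\<close>

definition glue :: "((real^'n) set \<Rightarrow> real^'n \<Rightarrow> 'b::zero) \<Rightarrow> real^'n \<Rightarrow> 'b" where
  "glue f x = (if \<exists>K\<in>T. x \<in> interior K then f (THE K. K \<in> T \<and> x \<in> interior K) x else 0)"

lemma glue_eq:
  assumes "K \<in> T" "x \<in> interior K" shows "glue f x = f K x"
proof -
  have "(THE K. K \<in> T \<and> x \<in> interior K) = K"
    using assms interiors_disjoint by (intro the_equality) blast+
  then show ?thesis using assms unfolding glue_def by auto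
qed

lemma glue_outside: "(\<And>K. K \<in> T \<Longrightarrow> x \<notin> interior K) \<Longrightarrow> glue f x = 0"
  unfolding glue_def by auto

lemma glue_Wh: "(\<And>K. K \<in> T \<Longrightarrow> poly_on k (interior K) (f K)) \<Longrightarrow> glue f \<in> Wh k T"
  unfolding Wh_def by (auto intro: poly_on_cong glue_eq glue_outside)

lemma glue_Vh: "(\<And>K i. K \<in> T \<Longrightarrow> poly_on k (interior K) (\<lambda>x. f K x $ i)) \<Longrightarrow> glue f \<in> Vh k T"
proof -
  assume p: "\<And>K i. K \<in> T \<Longrightarrow> poly_on k (interior K) (\<lambda>x. f K x $ i)"
  have "poly_on k (interior K) (\<lambda>x. glue f x $ i)" if K: "K \<in> T" for K i
    by (rule poly_on_cong[OF p[OF K]]) (simp add: glue_eq[OF K])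
  moreover have "glue f x = 0" if "x \<notin> (\<Union>K\<in>T. interior K)" for x
    using that by (intro glue_outside) blast
  ultimately show ?thesis unfolding Vh_def by simp
qed

section \<open>Square-integrable functions on the mesh\<close>

lemma integrable_piecewise_polynomial:
  assumes p: "\<And>K. K \<in> T \<Longrightarrow> poly_on j (interior K) g" and z: "\<And>x. (\<And>K. K \<in> T \<Longrightarrow> x \<notin> interior K) \<Longrightarrow> g x = 0"
  shows "integrable (lebesgue_on \<Omega>) g"
proof -
  have "integrable lebesgue (\<lambda>x. indicator (interior K) x *\<^sub>R g x)" if K: "K \<in> T" for K
  proof -
    interpret full_simplex "vertices K" rewrites "convex hull (vertices K) = K"
      using full_simplex[OF K] vertices(3)[OF K] by simp_all
    have "integrable (lebesgue_on K) g" by (rule integrable_poly_on[OF convex_body compact_body p[OF K]])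
    moreover have "K \<in> sets lebesgue" using compact_body by (simp add: borel_closed compact_imp_closed)
    ultimately have "set_integrable lebesgue K g" by (simp add: integrable_restrict_space set_integrable_def)
    then have "set_integrable lebesgue (interior K) g"
      by (rule set_integrable_subset) (auto intro: interior_subset[THEN subsetD])
    then show ?thesis by (simp add: set_integrable_def)
  qed
  then have "integrable lebesgue (\<lambda>x. \<Sum>K\<in>T. indicator (interior K) x *\<^sub>R g x)" by simp
  moreover have "(\<Sum>K\<in>T. indicator (interior K) x *\<^sub>R g x) = g x" for x
  proof (cases "\<exists>K\<in>T. x \<in> interior K")
    case True
    then obtain K where K: "K \<in> T" "x \<in> interior K" by blast
    then have "(\<Sum>K\<in>T. indicator (interior K) x *\<^sub>R g x) = (\<Sum>K'\<in>T. if K' = K then g x else 0)"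
      using interiors_disjoint by (intro sum.cong) (auto simp: indicator_def)
    then show ?thesis using K finite_T by simp
  next
    case False
    then show ?thesis using z by (auto simp: indicator_def intro!: sum.neutral)
  qed
  ultimately have "integrable lebesgue g" by simp
  then show ?thesis
    using integrable_mult_indicator[OF domain_lebesgue \<open>integrable lebesgue g\<close>]
    by (simp add: integrable_restrict_space domain_lebesgue)
qed

lemma Wh_subset_L2: "w \<in> Wh k T \<Longrightarrow> w \<in> L2 \<Omega>"
proof -
  assume w: "w \<in> Wh k T"
  then have "integrable (lebesgue_on \<Omega>) w"
    by (intro integrable_piecewise_polynomial[of k]) (auto simp: Wh_def)
  moreover have "integrable (lebesgue_on \<Omega>) (\<lambda>x. w x * w x)"
    using w by (intro integrable_piecewise_polynomial[of "k + k"] poly_on_mult) (auto simp: Wh_def)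
  ultimately show ?thesis by (simp add: L2_def power2_eq_square borel_measurable_integrable)
qed

text \<open>An element leaves the open domain only in its own boundary.\<close>

lemma integrable_on_element:
  fixes f :: "real^'n \<Rightarrow> real"
  assumes K: "K \<in> T" and f: "integrable (lebesgue_on \<Omega>) f"
  shows "integrable (lebesgue_on K) f"
proof -
  interpret full_simplex "vertices K" rewrites "convex hull (vertices K) = K"
    using full_simplex[OF K] vertices(3)[OF K] by simp_all
  have "set_integrable lebesgue \<Omega> f" using f by (simp add: integrable_restrict_space domain_lebesgue set_integrable_def)
  then have "set_integrable lebesgue (interior K) f"
    by (rule set_integrable_subset) (auto intro: interior_subset_domain[OF K, THEN subsetD])
  moreover have "negligible {x \<in> K - interior K. f x \<noteq> 0}"
    by (rule negligible_subset[OF negligible_convex_frontier[OF convex_body]])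
       (use closure_subset in \<open>auto simp: frontier_def\<close>)
  moreover have "negligible {x \<in> interior K - K. f x \<noteq> 0}"
    by (rule negligible_subset[OF negligible_empty]) (use interior_subset[of K] in auto)
  ultimately have "set_integrable lebesgue K f"
    using absolutely_integrable_spike_set[where f=f and S="interior K" and T=K] by blast
  moreover have "K \<in> sets lebesgue" using compact_body by (simp add: borel_closed compact_imp_closed)
  ultimately show ?thesis by (simp add: integrable_restrict_space set_integrable_def)
qed

lemma L2_on_element:
  assumes K: "K \<in> T" and f: "f \<in> L2 \<Omega>"
  shows "f \<in> L2 K"
proof -
  interpret full_simplex "vertices K" rewrites "convex hull (vertices K) = K"
    using full_simplex[OF K] vertices(3)[OF K] by simp_all
  have "f \<in> borel_measurable (lebesgue_on \<Omega>)" using f by (simp add: L2_def)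
  then have "f \<in> borel_measurable (lebesgue_on (interior K))"
    by (rule measurable_restrict_mono[OF _ interior_subset_domain[OF K]])
  then have "f \<in> borel_measurable (lebesgue_on K)"
    by (simp add: borel_measurable_interior[OF convex_body compact_body])
  then show ?thesis using f integrable_on_element[OF K] by (simp add: L2_def)
qed

lemma L2_norm_zero:
  assumes K: "K \<in> T" and f: "f \<in> L2 \<Omega>" and z: "L2_norm K f = 0"
  shows "AE x in lebesgue_on K. f x = 0"
proof -
  have int: "integrable (lebesgue_on K) (\<lambda>x. (f x)\<^sup>2)" using L2_on_element[OF K f] by (simp add: L2_def)
  have "(LINT x|lebesgue_on K. (f x)\<^sup>2) = 0" using z by (simp add: L2_norm_def)
  then have "AE x in lebesgue_on K. (f x)\<^sup>2 = 0"
    using integral_nonneg_eq_0_iff_AE[OF int] by simp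
  then show ?thesis by simp
qed

end

context hdg_element
begin

section \<open>One local problem in terms of the forms\<close>

lemma functional_on_uminus:
  assumes "functional_on X \<phi>" shows "functional_on X (\<lambda>f. - \<phi> f)"
proof (rule functional_onI)
  fix f g s t assume "f \<in> X" "g \<in> X"
  then show "- \<phi> (\<lambda>x. s *\<^sub>R f x + t *\<^sub>R g x) = s * - \<phi> f + t * - \<phi> g"
    using lin_onD[OF functional_on_lin[OF assms], of f g s t] by (simp add: algebra_simps)
next
  fix f g assume "f \<in> X" "g \<in> X" "\<And>x. x \<in> interior body \<Longrightarrow> f x = g x"
  then show "- \<phi> f = - \<phi> g" using functional_on_cong[OF assms, of f g] by simp
qed

lemma functional_on_plus:
  assumes "functional_on X \<phi>" "functional_on X \<psi>" shows "functional_on X (\<lambda>f. \<phi> f + \<psi> f)"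
proof (rule functional_onI)
  fix f g s t assume "f \<in> X" "g \<in> X"
  then show "\<phi> (\<lambda>x. s *\<^sub>R f x + t *\<^sub>R g x) + \<psi> (\<lambda>x. s *\<^sub>R f x + t *\<^sub>R g x) = s * (\<phi> f + \<psi> f) + t * (\<phi> g + \<psi> g)"
    using lin_onD[OF functional_on_lin[OF assms(1)], of f g s t] lin_onD[OF functional_on_lin[OF assms(2)], of f g s t]
    by (simp add: algebra_simps)
next
  fix f g assume "f \<in> X" "g \<in> X" "\<And>x. x \<in> interior body \<Longrightarrow> f x = g x"
  then show "\<phi> f + \<psi> f = \<phi> g + \<psi> g"
    using functional_on_cong[OF assms(1), of f g] functional_on_cong[OF assms(2), of f g] by simp
qed

abbreviation jump :: "(real^'n \<Rightarrow> real) \<Rightarrow> (real^'n \<Rightarrow> real) \<Rightarrow> (real^'n) set \<Rightarrow> real^'n \<Rightarrow> real" where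
  "jump u \<mu> \<equiv> (\<lambda>F x. tau F * (trace body u x - \<mu> x))"

lemma face_polynomials_jump: "u \<in> W \<Longrightarrow> \<mu> \<in> M \<Longrightarrow> jump u \<mu> \<in> face_polynomials"
  by (intro face_polynomials_tau face_polynomials_diff face_polynomials_trace face_polynomials_M)

lemma bd_ip_jump:
  assumes "u \<in> W" "\<mu> \<in> M" "w \<in> W"
  shows "bd_ip body (jump u \<mu>) (\<lambda>F. trace body w) = formS u w - formT \<mu> w"
  unfolding formS_def formT_def right_diff_distrib
  by (intro bd_ip_diff face_polynomials_tau face_polynomials_trace face_polynomials_M assms)

lemma bd_ip_flux:
  assumes "q \<in> V" "u \<in> W" "\<eta> \<in> M" "h \<in> face_polynomials"
  shows "bd_ip body (\<lambda>F x. (trace body q x + jump u \<eta> F x *\<^sub>R outward_normal body F) \<bullet> outward_normal body F) h =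
    bd_ip body (\<lambda>F x. trace body q x \<bullet> outward_normal body F) h + bd_ip body (jump u \<eta>) h"
proof -
  have "outward_normal body (face v) \<bullet> outward_normal body (face v) = 1" if "v \<in> C" for v
    using normal_facts(1)[OF that] by (simp add: normal_def norm_eq_1)
  then have "bd_ip body (\<lambda>F x. (trace body q x + jump u \<eta> F x *\<^sub>R outward_normal body F) \<bullet> outward_normal body F) h
    = bd_ip body (\<lambda>F x. trace body q x \<bullet> outward_normal body F + jump u \<eta> F x) h"
    by (intro bd_ip_cong) (simp_all add: inner_add_left)
  also have "\<dots> = bd_ip body (\<lambda>F x. trace body q x \<bullet> outward_normal body F) h + bd_ip body (jump u \<eta>) h"
    by (intro bd_ip_add face_polynomials_normal_trace face_polynomials_jump assms)
  finally show ?thesis .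
qed

lemma formN_comb:
  assumes "\<mu> \<in> M" "\<mu>' \<in> M" "r \<in> V"
  shows "formN (\<lambda>x. s * \<mu> x + t * \<mu>' x) r = s * formN \<mu> r + t * formN \<mu>' r"
  unfolding formN_def by (intro bd_ip_comb face_polynomials_M face_polynomials_normal_trace assms)

lemma formT_comb:
  assumes "\<mu> \<in> M" "\<mu>' \<in> M" "w \<in> W"
  shows "formT (\<lambda>x. s * \<mu> x + t * \<mu>' x) w = s * formT \<mu> w + t * formT \<mu>' w"
proof -
  have "formT (\<lambda>x. s * \<mu> x + t * \<mu>' x) w =
      bd_ip body (\<lambda>F x. s * (tau F * \<mu> x) + t * (tau F * \<mu>' x)) (\<lambda>F. trace body w)"
    unfolding formT_def by (rule bd_ip_cong) (simp_all add: algebra_simps)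
  also have "\<dots> = s * formT \<mu> w + t * formT \<mu>' w"
    unfolding formT_def by (intro bd_ip_comb face_polynomials_tau face_polynomials_M face_polynomials_trace assms)
  finally show ?thesis .
qed

lemma form_zero [simp]: "formN (\<lambda>x. 0) r = 0" "formT (\<lambda>x. 0) w = 0" "vol_ip body (\<lambda>x. 0) w = 0"
  by (simp_all add: formN_def formT_def bd_ip_sum vol_ip_def face_integral_def)

definition solves_element :: "real \<Rightarrow> (real^'n \<Rightarrow> real) \<Rightarrow> (real^'n \<Rightarrow> real) \<Rightarrow> (real^'n \<Rightarrow> real^'n) \<Rightarrow> (real^'n \<Rightarrow> real) \<Rightarrow> bool" where
  "solves_element \<sigma> \<mu> f q w \<longleftrightarrow> (\<forall>r\<in>V. formA q r - formD w r = - formN \<mu> r) \<and>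
     (\<forall>v\<in>W. formD v q + formS w v - \<sigma> * vol_ip body w v = formT \<mu> v + vol_ip body f v)"

lemma solves_element_cong:
  assumes "q \<in> V" "q' \<in> V" "w \<in> W" "w' \<in> W"
    and "\<And>x. x \<in> interior body \<Longrightarrow> q x = q' x" "\<And>x. x \<in> interior body \<Longrightarrow> w x = w' x"
  shows "solves_element \<sigma> \<mu> f q w \<longleftrightarrow> solves_element \<sigma> \<mu> f q' w'"
proof -
  have "formA q r = formA q' r" "formD w r = formD w' r" if "r \<in> V" for r
    by (rule functional_on_cong[OF formA_functional1[OF that] assms(1,2,5)]
        functional_on_cong[OF formD_functional1[OF that] assms(3,4,6)]; assumption)+
  moreover have "formD v q = formD v q'" "formS w v = formS w' v" if "v \<in> W" for v
    by (rule functional_on_cong[OF formD_functional2[OF that] assms(1,2,5)]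
        functional_on_cong[OF formS_functional1[OF that] assms(3,4,6)]; assumption)+
  moreover have "vol_ip body w v = vol_ip body w' v" if "v \<in> W" for v
    using functional_on_cong[OF vol_ip_functional[OF W_subset_L2[OF that]] assms(3,4,6)]
    by (simp add: vol_ip_commute[of body _ v])
  ultimately show ?thesis unfolding solves_element_def by simp
qed

lemma solves_element_zero: "solves_element \<sigma> (\<lambda>x. 0) (\<lambda>x. 0) (\<lambda>x. 0) (\<lambda>x. 0)"
proof -
  have "formA (\<lambda>x. 0) r = 0" "formD (\<lambda>x. 0) r = 0" if "r \<in> V" for r
    using functional_on_null_V[OF formA_functional1[OF that] V_zero]
      functional_on_null_W[OF formD_functional1[OF that] W_zero] by simp_all
  moreover have "formD v (\<lambda>x. 0) = 0" "formS (\<lambda>x. 0) v = 0" if "v \<in> W" for v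
    using functional_on_null_V[OF formD_functional2[OF that] V_zero]
      functional_on_null_W[OF formS_functional1[OF that] W_zero] by simp_all
  ultimately show ?thesis unfolding solves_element_def by simp
qed

lemma solves_element_comb:
  assumes s: "solves_element \<sigma> \<mu> f q u" "solves_element \<sigma> \<mu>' f' q' u'"
    and m: "\<mu> \<in> M" "\<mu>' \<in> M" and f: "f \<in> L2 body" "f' \<in> L2 body"
    and q: "q \<in> V" "q' \<in> V" and u: "u \<in> W" "u' \<in> W"
  shows "solves_element \<sigma> (\<lambda>x. s * \<mu> x + t * \<mu>' x) (\<lambda>x. s * f x + t * f' x)
    (\<lambda>x. s *\<^sub>R q x + t *\<^sub>R q' x) (\<lambda>x. s * u x + t * u' x)"
  unfolding solves_element_def
proof (intro conjI ballI)
  let ?q = "\<lambda>x. s *\<^sub>R q x + t *\<^sub>R q' x" and ?u = "\<lambda>x. s * u x + t * u' x"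
  show "formA ?q r - formD ?u r = - formN (\<lambda>x. s * \<mu> x + t * \<mu>' x) r" if r: "r \<in> V" for r
  proof -
    have "formA ?q r = s * formA q r + t * formA q' r" "formD ?u r = s * formD u r + t * formD u' r"
      using lin_onD[OF functional_on_lin[OF formA_functional1[OF r]] q]
        lin_onD[OF functional_on_lin[OF formD_functional1[OF r]] u] by simp_all
    moreover have "formD u r = formA q r + formN \<mu> r" "formD u' r = formA q' r + formN \<mu>' r"
      using s r unfolding solves_element_def by force+
    ultimately show ?thesis by (simp add: formN_comb[OF m r] algebra_simps)
  qed
  show "formD v ?q + formS ?u v - \<sigma> * vol_ip body ?u v =
      formT (\<lambda>x. s * \<mu> x + t * \<mu>' x) v + vol_ip body (\<lambda>x. s * f x + t * f' x) v" if v: "v \<in> W" for v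
  proof -
    have "formD v ?q = s * formD v q + t * formD v q'" "formS ?u v = s * formS u v + t * formS u' v"
      using lin_onD[OF functional_on_lin[OF formD_functional2[OF v]] q]
        lin_onD[OF functional_on_lin[OF formS_functional1[OF v]] u] by simp_all
    moreover have "vol_ip body ?u v = s * vol_ip body u v + t * vol_ip body u' v"
      "vol_ip body (\<lambda>x. s * f x + t * f' x) v = s * vol_ip body f v + t * vol_ip body f' v"
      by (rule vol_ip_comb[OF W_subset_L2[OF u(1)] W_subset_L2[OF u(2)] W_subset_L2[OF v]]
          vol_ip_comb[OF f W_subset_L2[OF v]])+
    moreover have "vol_ip body f v = formD v q + formS u v - \<sigma> * vol_ip body u v - formT \<mu> v"
      "vol_ip body f' v = formD v q' + formS u' v - \<sigma> * vol_ip body u' v - formT \<mu>' v"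
      using s v unfolding solves_element_def by force+
    ultimately show ?thesis by (simp add: formT_comb[OF m v] algebra_simps)
  qed
qed

lemma solves_element_exists:
  assumes unique: "\<And>q w x. q \<in> V \<Longrightarrow> w \<in> W \<Longrightarrow> solves_element \<sigma> (\<lambda>x. 0) (\<lambda>x. 0) q w \<Longrightarrow> x \<in> interior body \<Longrightarrow> w x = 0"
    and m: "\<mu> \<in> M" and f: "f \<in> L2 body"
  shows "\<exists>q\<in>V. \<exists>w\<in>W. solves_element \<sigma> \<mu> f q w"
  unfolding solves_element_def
proof (rule local_solvable)
  show "functional_on V (\<lambda>r. - formN \<mu> r)" by (rule functional_on_uminus[OF formN_functional[OF m]])
  show "functional_on W (\<lambda>v. formT \<mu> v + vol_ip body f v)"
    by (rule functional_on_plus[OF formT_functional[OF m] vol_ip_functional[OF f]])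
  fix q w x
  assume a: "q \<in> V" "w \<in> W" "\<And>r. r \<in> V \<Longrightarrow> formA q r - formD w r = 0"
    "\<And>v. v \<in> W \<Longrightarrow> formD v q + formS w v - \<sigma> * vol_ip body w v = 0" "x \<in> interior body"
  have "solves_element \<sigma> (\<lambda>x. 0) (\<lambda>x. 0) q w" using a(3,4) by (simp add: solves_element_def)
  from unique[OF a(1,2) this a(5)] show "w x = 0" .
qed

end

section \<open>The local problems on the mesh\<close>

context hdg_mesh
begin

abbreviation energy_ip :: "(real^'n) set \<Rightarrow> (real^'n \<Rightarrow> real^'n) \<Rightarrow> (real^'n \<Rightarrow> real^'n) \<Rightarrow> real" where
  "energy_ip K q r \<equiv> vol_ip K (\<lambda>x. cc x *v q x) r"

abbreviation normal_trace :: "(real^'n) set \<Rightarrow> (real^'n \<Rightarrow> real^'n) \<Rightarrow> (real^'n) set \<Rightarrow> real^'n \<Rightarrow> real" where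
  "normal_trace K r \<equiv> (\<lambda>F x. trace K r x \<bullet> outward_normal K F)"

abbreviation jump :: "(real^'n) set \<Rightarrow> (real^'n \<Rightarrow> real) \<Rightarrow> (real^'n \<Rightarrow> real) \<Rightarrow> (real^'n) set \<Rightarrow> real^'n \<Rightarrow> real" where
  "jump K u \<mu> \<equiv> (\<lambda>F x. \<tau> K F * (trace K u x - \<mu> x))"

definition solves_on :: "(real^'n) set \<Rightarrow> real \<Rightarrow> (real^'n \<Rightarrow> real) \<Rightarrow> (real^'n \<Rightarrow> real) \<Rightarrow> (real^'n \<Rightarrow> real^'n) \<Rightarrow> (real^'n \<Rightarrow> real) \<Rightarrow> bool" where
  "solves_on K \<sigma> \<mu> f q u \<longleftrightarrow>
     (\<forall>r\<in>Vh k T. energy_ip K q r - vol_ip K u (dive r) = - bd_ip K (\<lambda>F. \<mu>) (normal_trace K r)) \<and>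
     (\<forall>w\<in>Wh k T. vol_ip K w (dive q) + bd_ip K (jump K u \<mu>) (\<lambda>F. trace K w) - \<sigma> * vol_ip K u w = vol_ip K f w)"

text \<open>Both pairs of local solution operators solve this system: \<open>(\<Q> \<mu>, \<U> \<mu>)\<close> for the data \<open>\<mu>\<close> on the faces,
  \<open>(\<Q>\<^sub>W f, \<U>\<^sub>W f)\<close> for the data \<open>f\<close> in the elements, in either case with shift zero.  The shift \<open>\<sigma>\<close> turns it into the problem that inverts \<open>I - \<sigma> \<U>\<^sub>W\<close>.\<close>

definition solves_local :: "real \<Rightarrow> (real^'n \<Rightarrow> real) \<Rightarrow> (real^'n \<Rightarrow> real) \<Rightarrow> (real^'n \<Rightarrow> real^'n) \<Rightarrow> (real^'n \<Rightarrow> real) \<Rightarrow> bool" where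
  "solves_local \<sigma> \<mu> f q u \<longleftrightarrow> q \<in> Vh k T \<and> u \<in> Wh k T \<and> (\<forall>K\<in>T. solves_on K \<sigma> \<mu> f q u)"

lemma solves_localD:
  assumes "solves_local \<sigma> \<mu> f q u"
  shows "q \<in> Vh k T" "u \<in> Wh k T"
    "\<And>K r. K \<in> T \<Longrightarrow> r \<in> Vh k T \<Longrightarrow> energy_ip K q r - vol_ip K u (dive r) = - bd_ip K (\<lambda>F. \<mu>) (normal_trace K r)"
    "\<And>K w. K \<in> T \<Longrightarrow> w \<in> Wh k T \<Longrightarrow>
      vol_ip K w (dive q) + bd_ip K (jump K u \<mu>) (\<lambda>F. trace K w) - \<sigma> * vol_ip K u w = vol_ip K f w"
  using assms unfolding solves_local_def solves_on_def by blast+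

lemma Mh_zero: "(\<lambda>x. 0) \<in> Mh \<Omega> k T"
  unfolding Mh_def by (simp add: poly_on_zero)

lemma L2_zero: "(\<lambda>x. 0) \<in> L2 D"
  by (simp add: L2_def)

lemma Vh_element: "v \<in> Vh k T \<Longrightarrow> K \<in> T \<Longrightarrow> v \<in> hdg_element.V (vertices K) k"
  using hdg_element.V_def[OF element] vertices(3) by (simp add: Vh_def)

lemma Wh_element: "w \<in> Wh k T \<Longrightarrow> K \<in> T \<Longrightarrow> w \<in> hdg_element.W (vertices K) k"
  using hdg_element.W_def[OF element] vertices(3) by (simp add: Wh_def)

lemma Mh_element:
  assumes mu: "\<mu> \<in> Mh \<Omega> k T" and K: "K \<in> T" shows "\<mu> \<in> hdg_element.M (vertices K) k"
proof -
  interpret E: hdg_element "vertices K" cc "\<tau> K" k B rewrites "convex hull (vertices K) = K"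
    by (rule element[OF K]) (rule vertices(3)[OF K])
  have "E.face v \<in> mesh_faces T" if "v \<in> vertices K" for v
    using E.facets that K unfolding mesh_faces_def by blast
  then show ?thesis using mu unfolding E.M_def Mh_def by blast
qed

lemma V_extend:
  assumes K: "K \<in> T" and v: "v \<in> hdg_element.V (vertices K) k"
  obtains v' where "v' \<in> Vh k T" "\<And>x. x \<in> interior K \<Longrightarrow> v' x = v x"
    "\<And>K' x. K' \<in> T \<Longrightarrow> K' \<noteq> K \<Longrightarrow> x \<in> interior K' \<Longrightarrow> v' x = 0"
proof -
  let ?v = "glue (\<lambda>K'. if K' = K then v else (\<lambda>x. 0))"
  have "?v \<in> Vh k T"
    using v hdg_element.V_def[OF element[OF K]] vertices(3)[OF K] by (intro glue_Vh) (auto simp: poly_on_zero)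
  then show ?thesis using K by (intro that[of ?v]) (auto simp: glue_eq)
qed

lemma W_extend:
  assumes K: "K \<in> T" and w: "w \<in> hdg_element.W (vertices K) k"
  obtains w' where "w' \<in> Wh k T" "\<And>x. x \<in> interior K \<Longrightarrow> w' x = w x"
    "\<And>K' x. K' \<in> T \<Longrightarrow> K' \<noteq> K \<Longrightarrow> x \<in> interior K' \<Longrightarrow> w' x = 0"
proof -
  let ?w = "glue (\<lambda>K'. if K' = K then w else (\<lambda>x. 0))"
  have "?w \<in> Wh k T"
    using w hdg_element.W_def[OF element[OF K]] vertices(3)[OF K] by (intro glue_Wh) (auto simp: poly_on_zero)
  then show ?thesis using K by (intro that[of ?w]) (auto simp: glue_eq)
qed

text \<open>Test functions on the mesh and test functions on one element are interchangeable, since a polynomial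
  on one element extends by zero to the mesh.\<close>

lemma solves_on_iff:
  assumes K: "K \<in> T" and q: "q \<in> Vh k T" and u: "u \<in> Wh k T" and mu: "\<mu> \<in> Mh \<Omega> k T" and f: "f \<in> L2 \<Omega>"
  shows "solves_on K \<sigma> \<mu> f q u \<longleftrightarrow> hdg_element.solves_element (vertices K) cc (\<tau> K) k \<sigma> \<mu> f q u"
proof -
  interpret E: hdg_element "vertices K" cc "\<tau> K" k B rewrites "convex hull (vertices K) = K"
    by (rule element[OF K]) (rule vertices(3)[OF K])
  note qV = Vh_element[OF q K] and uW = Wh_element[OF u K] and muM = Mh_element[OF mu K]
    and fL = L2_on_element[OF K f]
  have "(\<forall>r\<in>Vh k T. E.formA q r - E.formD u r = - E.formN \<mu> r) \<longleftrightarrow> (\<forall>r\<in>E.V. E.formA q r - E.formD u r = - E.formN \<mu> r)"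
    (is "?L \<longleftrightarrow> ?R")
  proof
    assume all: ?L
    show ?R
    proof
      fix r assume r: "r \<in> E.V"
      from V_extend[OF K r] obtain r' where r': "r' \<in> Vh k T" "\<And>x. x \<in> interior K \<Longrightarrow> r' x = r x" by metis
      note r'V = Vh_element[OF r'(1) K]
      have "E.formA q r' = E.formA q r" "E.formD u r' = E.formD u r" "E.formN \<mu> r' = E.formN \<mu> r"
        by (rule E.functional_on_cong[OF E.formA_functional2[OF qV] r'V r r'(2)]
             E.functional_on_cong[OF E.formD_functional2[OF uW] r'V r r'(2)]
             E.functional_on_cong[OF E.formN_functional[OF muM] r'V r r'(2)]; assumption)+
      then show "E.formA q r - E.formD u r = - E.formN \<mu> r" using all r'(1) by auto
    qed
  qed (use Vh_element K in blast)
  moreover have "(\<forall>w\<in>Wh k T. E.formD w q + E.formS u w - \<sigma> * vol_ip K u w = E.formT \<mu> w + vol_ip K f w) \<longleftrightarrow>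
      (\<forall>w\<in>E.W. E.formD w q + E.formS u w - \<sigma> * vol_ip K u w = E.formT \<mu> w + vol_ip K f w)" (is "?L \<longleftrightarrow> ?R")
  proof
    assume all: ?L
    show ?R
    proof
      fix w assume w: "w \<in> E.W"
      from W_extend[OF K w] obtain w' where w': "w' \<in> Wh k T" "\<And>x. x \<in> interior K \<Longrightarrow> w' x = w x" by metis
      note w'W = Wh_element[OF w'(1) K]
      have "E.formD w' q = E.formD w q" "E.formS u w' = E.formS u w" "vol_ip K u w' = vol_ip K u w"
        "E.formT \<mu> w' = E.formT \<mu> w" "vol_ip K f w' = vol_ip K f w"
        by (rule E.functional_on_cong[OF E.formD_functional1[OF qV] w'W w w'(2)]
            E.functional_on_cong[OF E.formS_functional2[OF uW] w'W w w'(2)]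
            E.functional_on_cong[OF E.vol_ip_functional[OF E.W_subset_L2[OF uW]] w'W w w'(2)]
            E.functional_on_cong[OF E.formT_functional[OF muM] w'W w w'(2)]
            E.functional_on_cong[OF E.vol_ip_functional[OF fL] w'W w w'(2)]; assumption)+
      then show "E.formD w q + E.formS u w - \<sigma> * vol_ip K u w = E.formT \<mu> w + vol_ip K f w"
        using all w'(1) by auto
    qed
  qed (use Wh_element K in blast)
  moreover have "solves_on K \<sigma> \<mu> f q u \<longleftrightarrow> (\<forall>r\<in>Vh k T. E.formA q r - E.formD u r = - E.formN \<mu> r) \<and>
      (\<forall>w\<in>Wh k T. E.formD w q + E.formS u w - \<sigma> * vol_ip K u w = E.formT \<mu> w + vol_ip K f w)"
  proof -
    have "vol_ip K w (dive q) + bd_ip K (jump K u \<mu>) (\<lambda>F. trace K w) = E.formD w q + E.formS u w - E.formT \<mu> w"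
      if "w \<in> Wh k T" for w
      using E.bd_ip_jump[OF uW muM Wh_element[OF that K]] by (simp add: E.formD_def)
    then have "vol_ip K w (dive q) + bd_ip K (jump K u \<mu>) (\<lambda>F. trace K w) - \<sigma> * vol_ip K u w = vol_ip K f w \<longleftrightarrow>
        E.formD w q + E.formS u w - \<sigma> * vol_ip K u w = E.formT \<mu> w + vol_ip K f w" if "w \<in> Wh k T" for w
      using that by auto
    then show ?thesis
      unfolding solves_on_def by (simp add: E.formA_def E.formN_def E.formD_def[of u])
  qed
  ultimately show ?thesis unfolding E.solves_element_def by blast
qed

lemma solves_local_comb:
  assumes s1: "solves_local \<sigma> \<mu> f q u" and s2: "solves_local \<sigma> \<mu>' f' q' u'"
    and mu: "\<mu> \<in> Mh \<Omega> k T" "\<mu>' \<in> Mh \<Omega> k T" and f: "f \<in> L2 \<Omega>" "f' \<in> L2 \<Omega>"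
  shows "solves_local \<sigma> (\<lambda>x. s * \<mu> x + t * \<mu>' x) (\<lambda>x. s * f x + t * f' x)
    (\<lambda>x. s *\<^sub>R q x + t *\<^sub>R q' x) (\<lambda>x. s * u x + t * u' x)"
proof -
  note q = solves_localD(1)[OF s1] solves_localD(1)[OF s2] and u = solves_localD(2)[OF s1] solves_localD(2)[OF s2]
  have mu': "(\<lambda>x. s * \<mu> x + t * \<mu>' x) \<in> Mh \<Omega> k T"
    using mu unfolding Mh_def by (simp add: poly_on_add poly_on_scale)
  show ?thesis
    unfolding solves_local_def
  proof (intro conjI ballI Vh_comb[OF q] Wh_comb[OF u])
    fix K assume K: "K \<in> T"
    interpret E: hdg_element "vertices K" cc "\<tau> K" k B rewrites "convex hull (vertices K) = K"
      by (rule element[OF K]) (rule vertices(3)[OF K])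
    have "E.solves_element \<sigma> \<mu> f q u"
      using s1 K solves_on_iff[OF K q(1) u(1) mu(1) f(1), of \<sigma>] unfolding solves_local_def by blast
    moreover have "E.solves_element \<sigma> \<mu>' f' q' u'"
      using s2 K solves_on_iff[OF K q(2) u(2) mu(2) f(2), of \<sigma>] unfolding solves_local_def by blast
    ultimately show "solves_on K \<sigma> (\<lambda>x. s * \<mu> x + t * \<mu>' x) (\<lambda>x. s * f x + t * f' x)
        (\<lambda>x. s *\<^sub>R q x + t *\<^sub>R q' x) (\<lambda>x. s * u x + t * u' x)"
      unfolding solves_on_iff[OF K Vh_comb[OF q] Wh_comb[OF u] mu' L2_comb[OF f]]
      by (rule E.solves_element_comb[OF _ _ Mh_element[OF mu(1) K] Mh_element[OF mu(2) K]
            L2_on_element[OF K f(1)] L2_on_element[OF K f(2)] Vh_element[OF q(1) K] Vh_element[OF q(2) K]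
            Wh_element[OF u(1) K] Wh_element[OF u(2) K]])
  qed
qed

lemma solves_local_homogeneous:
  assumes s: "solves_local 0 (\<lambda>x. 0) (\<lambda>x. 0) q u"
  shows "q = (\<lambda>x. 0)" "u = (\<lambda>x. 0)"
proof -
  note q = solves_localD(1)[OF s] and u = solves_localD(2)[OF s]
  have z: "q x = 0 \<and> u x = 0" if K: "K \<in> T" and x: "x \<in> interior K" for K x
  proof -
    interpret E: hdg_element "vertices K" cc "\<tau> K" k B rewrites "convex hull (vertices K) = K"
      by (rule element[OF K]) (rule vertices(3)[OF K])
    have "E.solves_element 0 (\<lambda>x. 0) (\<lambda>x. 0) q u"
      using s K solves_on_iff[OF K q u Mh_zero L2_zero, of 0] unfolding solves_local_def by blast
    then have "E.formA q r - E.formD u r = 0" "E.formD w q + E.formS u w = 0" if "r \<in> E.V" "w \<in> E.W" for r w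
      using that unfolding E.solves_element_def by simp_all
    then show ?thesis
      using E.local_unique[OF Vh_element[OF q K] Wh_element[OF u K] _ _ x] E.V_zero E.W_zero by blast
  qed
  show "q = (\<lambda>x. 0)" by (rule Vh_eqI[OF q Vh_zero]) (use z in blast)
  show "u = (\<lambda>x. 0)" by (rule Wh_eqI[OF u Wh_zero]) (use z in blast)
qed

lemma solves_local_unique:
  assumes s: "solves_local 0 \<mu> f q u" "solves_local 0 \<mu> f q' u'" and mu: "\<mu> \<in> Mh \<Omega> k T" and f: "f \<in> L2 \<Omega>"
  shows "q = q' \<and> u = u'"
proof -
  have "solves_local 0 (\<lambda>x. 0) (\<lambda>x. 0) (\<lambda>x. q x - q' x) (\<lambda>x. u x - u' x)"
    using solves_local_comb[OF s mu mu f f, of 1 "-1"] by simp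
  from solves_local_homogeneous[OF this] show ?thesis by (simp add: fun_eq_iff)
qed

text \<open>The elements decouple.  Uniqueness is assumed for the whole mesh and passes to one element by
  extension by zero; the solutions on the elements are glued together.\<close>

lemma solves_local_exists:
  assumes unique: "\<And>q u. solves_local \<sigma> (\<lambda>x. 0) (\<lambda>x. 0) q u \<Longrightarrow> u = (\<lambda>x. 0)"
    and mu: "\<mu> \<in> Mh \<Omega> k T" and f: "f \<in> L2 \<Omega>"
  shows "\<exists>q u. solves_local \<sigma> \<mu> f q u"
proof -
  let ?V = "\<lambda>K. hdg_element.V (vertices K) k" and ?W = "\<lambda>K. hdg_element.W (vertices K) k"
  let ?sol = "\<lambda>K. hdg_element.solves_element (vertices K) cc (\<tau> K) k \<sigma>"
  have "\<exists>q\<in>?V K. \<exists>u\<in>?W K. ?sol K \<mu> f q u" if K: "K \<in> T" for K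
  proof -
    interpret E: hdg_element "vertices K" cc "\<tau> K" k B rewrites "convex hull (vertices K) = K"
      by (rule element[OF K]) (rule vertices(3)[OF K])
    show ?thesis
    proof (rule E.solves_element_exists[OF _ Mh_element[OF mu K] L2_on_element[OF K f]])
      fix q w x assume q: "q \<in> E.V" and w: "w \<in> E.W" and s: "E.solves_element \<sigma> (\<lambda>x. 0) (\<lambda>x. 0) q w" and x: "x \<in> interior K"
      from V_extend[OF K q] obtain q' where q': "q' \<in> Vh k T" "\<And>x. x \<in> interior K \<Longrightarrow> q' x = q x"
        "\<And>K' x. K' \<in> T \<Longrightarrow> K' \<noteq> K \<Longrightarrow> x \<in> interior K' \<Longrightarrow> q' x = 0" by metis
      from W_extend[OF K w] obtain w' where w': "w' \<in> Wh k T" "\<And>x. x \<in> interior K \<Longrightarrow> w' x = w x"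
        "\<And>K' x. K' \<in> T \<Longrightarrow> K' \<noteq> K \<Longrightarrow> x \<in> interior K' \<Longrightarrow> w' x = 0" by metis
      have "solves_on K' \<sigma> (\<lambda>x. 0) (\<lambda>x. 0) q' w'" if K': "K' \<in> T" for K'
        unfolding solves_on_iff[OF K' q'(1) w'(1) Mh_zero L2_zero]
      proof (cases "K' = K")
        case True
        then show "?sol K' (\<lambda>x. 0) (\<lambda>x. 0) q' w'"
          using E.solves_element_cong[OF Vh_element[OF q'(1) K] q Wh_element[OF w'(1) K] w q'(2) w'(2)] s by simp
      next
        case False
        interpret E': hdg_element "vertices K'" cc "\<tau> K'" k B rewrites "convex hull (vertices K') = K'"
          by (rule element[OF K']) (rule vertices(3)[OF K'])
        show "?sol K' (\<lambda>x. 0) (\<lambda>x. 0) q' w'"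
          using E'.solves_element_cong[OF Vh_element[OF q'(1) K'] E'.V_zero Wh_element[OF w'(1) K'] E'.W_zero
              q'(3)[OF K' False] w'(3)[OF K' False]] E'.solves_element_zero by blast
      qed
      then have "solves_local \<sigma> (\<lambda>x. 0) (\<lambda>x. 0) q' w'" using q'(1) w'(1) by (simp add: solves_local_def)
      then have "w' = (\<lambda>x. 0)" by (rule unique)
      then show "w x = 0" using w'(2)[OF x] by simp
    qed
  qed
  then have "\<exists>q u. \<forall>K\<in>T. q K \<in> ?V K \<and> u K \<in> ?W K \<and> ?sol K \<mu> f (q K) (u K)" by metis
  then obtain q u where qu: "\<And>K. K \<in> T \<Longrightarrow> q K \<in> ?V K" "\<And>K. K \<in> T \<Longrightarrow> u K \<in> ?W K"
    "\<And>K. K \<in> T \<Longrightarrow> ?sol K \<mu> f (q K) (u K)" by blast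
  have g: "glue q \<in> Vh k T" "glue u \<in> Wh k T"
    using qu(1,2) hdg_element.V_def[OF element] hdg_element.W_def[OF element] vertices(3)
    by (auto intro!: glue_Vh glue_Wh)
  have "solves_on K \<sigma> \<mu> f (glue q) (glue u)" if K: "K \<in> T" for K
  proof -
    interpret E: hdg_element "vertices K" cc "\<tau> K" k B rewrites "convex hull (vertices K) = K"
      by (rule element[OF K]) (rule vertices(3)[OF K])
    show ?thesis
      unfolding solves_on_iff[OF K g mu f]
      using E.solves_element_cong[OF Vh_element[OF g(1) K] qu(1)[OF K] Wh_element[OF g(2) K] qu(2)[OF K]
          glue_eq[OF K] glue_eq[OF K]] qu(3)[OF K] by blast
  qed
  then show ?thesis using g unfolding solves_local_def by blast
qed

end

context hdg_mesh
begin

abbreviation Q where "Q \<equiv> Q_op \<alpha> \<tau> k T"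
abbreviation U where "U \<equiv> U_op \<alpha> \<tau> k T"
abbreviation QW where "QW \<equiv> QW_op \<alpha> \<tau> k T"
abbreviation UW where "UW \<equiv> UW_op \<alpha> \<tau> k T"

lemma vol_ip_zero [simp]: "vol_ip K (\<lambda>x. 0) w = 0"
  by (simp add: vol_ip_def)

lemma bd_ip_zero [simp]: "bd_ip K (\<lambda>F x. 0) w = 0"
  by (simp add: bd_ip_def face_integral_def)

section \<open>The local solution operators\<close>

lemma solves_local_lift_M:
  assumes mu: "\<mu> \<in> Mh \<Omega> k T"
  shows "solves_local 0 \<mu> (\<lambda>x. 0) (Q \<mu>) (U \<mu>)"
proof -
  have "\<exists>q u. solves_local 0 \<mu> (\<lambda>x. 0) q u"
    by (rule solves_local_exists[OF _ mu L2_zero]) (rule solves_local_homogeneous(2))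
  then obtain q u where s: "solves_local 0 \<mu> (\<lambda>x. 0) q u" by blast
  have "lift_M \<alpha> \<tau> k T \<mu> = (THE p. case p of (q, u) \<Rightarrow> solves_local 0 \<mu> (\<lambda>x. 0) q u)"
    unfolding lift_M_def by (simp add: solves_local_def solves_on_def)
  also have "\<dots> = (q, u)"
  proof (rule the_equality)
    show "case (q, u) of (q, u) \<Rightarrow> solves_local 0 \<mu> (\<lambda>x. 0) q u" using s by simp
    fix p assume p: "case p of (q, u) \<Rightarrow> solves_local 0 \<mu> (\<lambda>x. 0) q u"
    obtain q' u' where pq: "p = (q', u')" by (cases p)
    have "solves_local 0 \<mu> (\<lambda>x. 0) q' u'" using p unfolding pq by simp
    from solves_local_unique[OF this s mu L2_zero] show "p = (q, u)" by (simp add: pq)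
  qed
  finally show ?thesis using s by (simp add: Q_op_def U_op_def)
qed

lemma solves_local_lift_W:
  assumes f: "f \<in> L2 \<Omega>"
  shows "solves_local 0 (\<lambda>x. 0) f (QW f) (UW f)"
proof -
  have "\<exists>q u. solves_local 0 (\<lambda>x. 0) f q u"
    by (rule solves_local_exists[OF _ Mh_zero f]) (rule solves_local_homogeneous(2))
  then obtain q u where s: "solves_local 0 (\<lambda>x. 0) f q u" by blast
  have "lift_W \<alpha> \<tau> k T f = (THE p. case p of (q, u) \<Rightarrow> solves_local 0 (\<lambda>x. 0) f q u)"
    unfolding lift_W_def by (simp add: solves_local_def solves_on_def)
  also have "\<dots> = (q, u)"
  proof (rule the_equality)
    show "case (q, u) of (q, u) \<Rightarrow> solves_local 0 (\<lambda>x. 0) f q u" using s by simp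
    fix p assume p: "case p of (q, u) \<Rightarrow> solves_local 0 (\<lambda>x. 0) f q u"
    obtain q' u' where pq: "p = (q', u')" by (cases p)
    have "solves_local 0 (\<lambda>x. 0) f q' u'" using p unfolding pq by simp
    from solves_local_unique[OF this s Mh_zero f] show "p = (q, u)" by (simp add: pq)
  qed
  finally show ?thesis using s by (simp add: QW_op_def UW_op_def)
qed

lemma lift_W_eqI:
  assumes "f \<in> L2 \<Omega>" "solves_local 0 (\<lambda>x. 0) f q u"
  shows "QW f = q" "UW f = u"
  using solves_local_unique[OF solves_local_lift_W[OF assms(1)] assms(2) Mh_zero assms(1)] by auto

lemma UW_in_Wh: "f \<in> L2 \<Omega> \<Longrightarrow> UW f \<in> Wh k T"
  using solves_localD(2)[OF solves_local_lift_W] .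

text \<open>The data enter only through integrals, so the operators are defined on classes of functions.\<close>

lemma lift_W_cong_AE:
  assumes f: "f \<in> L2 \<Omega>" and g: "g \<in> L2 \<Omega>" and ae: "\<And>K. K \<in> T \<Longrightarrow> AE x in lebesgue_on K. f x = g x"
  shows "QW f = QW g" "UW f = UW g"
proof -
  have "vol_ip K f w = vol_ip K g w" if K: "K \<in> T" and w: "w \<in> Wh k T" for K w
    unfolding vol_ip_def
  proof (rule integral_cong_AE)
    have "f \<in> L2 K" "g \<in> L2 K" "w \<in> L2 K" using L2_on_element[OF K] f g Wh_subset_L2[OF w] by blast+
    then show "(\<lambda>x. f x \<bullet> w x) \<in> borel_measurable (lebesgue_on K)" "(\<lambda>x. g x \<bullet> w x) \<in> borel_measurable (lebesgue_on K)"
      using L2_mult_integrable borel_measurable_integrable by (metis (no_types, lifting) inner_real_def measurable_cong)+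
    show "AE x in lebesgue_on K. f x \<bullet> w x = g x \<bullet> w x" using ae[OF K] by eventually_elim simp
  qed
  then have "solves_local 0 (\<lambda>x. 0) f (QW g) (UW g)"
    using solves_local_lift_W[OF g] unfolding solves_local_def solves_on_def by auto
  from lift_W_eqI[OF f this] show "QW f = QW g" "UW f = UW g" .
qed

lemma AE_element_of_AE_domain:
  assumes K: "K \<in> T" and ae: "AE x in lebesgue_on \<Omega>. P x"
  shows "AE x in lebesgue_on K. P x"
proof -
  interpret full_simplex "vertices K" rewrites "convex hull (vertices K) = K"
    using full_simplex[OF K] vertices(3)[OF K] by simp_all
  have Kl: "K \<in> sets lebesgue" using compact_body by (simp add: borel_closed compact_imp_closed)
  have "AE x in lebesgue. x \<in> \<Omega> \<longrightarrow> P x" using ae by (simp add: AE_restrict_space_iff domain_lebesgue)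
  moreover have "AE x in lebesgue. x \<in> K \<longrightarrow> x \<in> interior K"
    using AE_on_convex[OF convex_body compact_imp_bounded[OF compact_body], of "\<lambda>x. x \<in> interior K"] Kl
    by (simp add: AE_restrict_space_iff)
  ultimately have "AE x in lebesgue. x \<in> K \<longrightarrow> P x"
    by eventually_elim (use interior_subset_domain[OF K] in blast)
  then show ?thesis using Kl by (simp add: AE_restrict_space_iff)
qed

lemma AE_domain_of_AE_elements:
  assumes ae: "\<And>K. K \<in> T \<Longrightarrow> AE x in lebesgue_on K. P x"
  shows "AE x in lebesgue_on \<Omega>. P x"
proof -
  have "AE x in lebesgue. x \<in> K \<longrightarrow> P x" if K: "K \<in> T" for K
  proof -
    have "compact K" using vertices[OF K] by (metis aff_independent_finite finite_imp_compact_convex_hull)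
    then have "K \<in> sets lebesgue" by (simp add: borel_closed compact_imp_closed)
    then show ?thesis using ae[OF K] by (simp add: AE_restrict_space_iff)
  qed
  then have "AE x in lebesgue. \<forall>K\<in>T. x \<in> K \<longrightarrow> P x" by (rule AE_finite_allI[OF finite_T])
  then have "AE x in lebesgue. x \<in> \<Omega> \<longrightarrow> P x"
  proof eventually_elim
    case (elim x)
    have "\<Omega> \<subseteq> \<Union>T" using mesh closure_subset unfolding simplicial_mesh_def by metis
    then show ?case using elim by blast
  qed
  then show ?thesis by (simp add: AE_restrict_space_iff domain_lebesgue)
qed

section \<open>The numerical flux\<close>

lemma flux_against_trace:
  assumes K: "K \<in> T" and q: "q \<in> Vh k T" and u: "u \<in> Wh k T" and eta: "\<eta> \<in> Mh \<Omega> k T" and w: "w \<in> Wh k T"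
  shows "- vol_ip K q (grad w) + bd_ip K (flux_normal \<tau> q u \<eta> K) (\<lambda>F. trace K w) =
    vol_ip K w (dive q) + bd_ip K (jump K u \<eta>) (\<lambda>F. trace K w)"
proof -
  interpret E: hdg_element "vertices K" cc "\<tau> K" k B rewrites "convex hull (vertices K) = K"
    by (rule element[OF K]) (rule vertices(3)[OF K])
  have m: "q \<in> E.V" "u \<in> E.W" "w \<in> E.W"
    by (intro Vh_element Wh_element q u w K)+
  note etaM = Mh_element[OF eta K]
  show ?thesis
    unfolding flux_normal_def[abs_def] E.bd_ip_flux[OF m(1,2) etaM E.face_polynomials_trace[OF m(3)]]
      E.integration_by_parts[OF m(1,3)] by simp
qed

text \<open>Testing with \<open>\<mu>\<close> on the faces equals testing with the pair \<open>(\<Q> \<mu>, \<U> \<mu>)\<close> in the element.\<close>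

lemma flux_against_face_function:
  assumes K: "K \<in> T" and s: "solves_local 0 \<eta> f q u" and eta: "\<eta> \<in> Mh \<Omega> k T" and mu: "\<mu> \<in> Mh \<Omega> k T"
  shows "bd_ip K (\<lambda>F. \<mu>) (flux_normal \<tau> q u \<eta> K) = vol_ip K f (U \<mu>) - energy_ip K q (Q \<mu>)
    - bd_ip K (jump K u \<eta>) (\<lambda>F x. trace K (U \<mu>) x - \<mu> x)"
proof -
  interpret E: hdg_element "vertices K" cc "\<tau> K" k B rewrites "convex hull (vertices K) = K"
    by (rule element[OF K]) (rule vertices(3)[OF K])
  note M = Mh_element[OF _ K]
  note s' = solves_local_lift_M[OF mu]
  let ?z = "jump K u \<eta>"
  have m: "q \<in> E.V" "u \<in> E.W" "U \<mu> \<in> E.W"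
    by (intro Vh_element Wh_element solves_localD(1,2)[OF s] solves_localD(2)[OF s'] K)+
  have z: "?z \<in> E.face_polynomials" by (rule E.face_polynomials_jump[OF m(2) M[OF eta]])
  have "bd_ip K (\<lambda>F. \<mu>) (flux_normal \<tau> q u \<eta> K) =
      bd_ip K (\<lambda>F. \<mu>) (normal_trace K q) + bd_ip K ?z (\<lambda>F. \<mu>)"
    unfolding flux_normal_def[abs_def] E.bd_ip_commute[of _ "\<lambda>F. \<mu>"]
    by (rule E.bd_ip_flux[OF m(1,2) M[OF eta] E.face_polynomials_M[OF M[OF mu]]])
  moreover have "energy_ip K (Q \<mu>) q - vol_ip K (U \<mu>) (dive q)
      = - bd_ip K (\<lambda>F. \<mu>) (normal_trace K q)"
    by (rule solves_localD(3)[OF s' K solves_localD(1)[OF s]])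
  moreover have "energy_ip K (Q \<mu>) q = energy_ip K q (Q \<mu>)"
    using E.formA_commute[of "Q \<mu>" q] by (simp add: E.formA_def)
  moreover have "vol_ip K (U \<mu>) (dive q) + bd_ip K ?z (\<lambda>F. trace K (U \<mu>)) = vol_ip K f (U \<mu>)"
    using solves_localD(4)[OF s K solves_localD(2)[OF s']] by simp
  moreover have "bd_ip K ?z (\<lambda>F x. trace K (U \<mu>) x - \<mu> x) = bd_ip K ?z (\<lambda>F. trace K (U \<mu>)) - bd_ip K ?z (\<lambda>F. \<mu>)"
    unfolding E.bd_ip_commute[of _ ?z]
    by (rule E.bd_ip_diff[OF E.face_polynomials_trace[OF m(3)] E.face_polynomials_M[OF M[OF mu]] z])
  ultimately show ?thesis by simp
qed

text \<open>The part of the solution that comes from the volume data is orthogonal to the liftings of face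
  functions.\<close>

lemma lift_W_orthogonal_lift_M:
  assumes K: "K \<in> T" and f: "f \<in> L2 \<Omega>" and mu: "\<mu> \<in> Mh \<Omega> k T"
  shows "energy_ip K (QW f) (Q \<mu>) +
    bd_ip K (\<lambda>F x. \<tau> K F * trace K (UW f) x) (\<lambda>F x. trace K (U \<mu>) x - \<mu> x) = 0"
proof -
  interpret E: hdg_element "vertices K" cc "\<tau> K" k B rewrites "convex hull (vertices K) = K"
    by (rule element[OF K]) (rule vertices(3)[OF K])
  note s = solves_local_lift_W[OF f] and s' = solves_local_lift_M[OF mu]
  have "energy_ip K (QW f) (Q \<mu>) = vol_ip K (UW f) (dive (Q \<mu>))"
    using solves_localD(3)[OF s K solves_localD(1)[OF s']] by simp
  moreover have "vol_ip K (UW f) (dive (Q \<mu>)) + bd_ip K (jump K (U \<mu>) \<mu>) (\<lambda>F. trace K (UW f)) = 0"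
    using solves_localD(4)[OF s' K solves_localD(2)[OF s]] by simp
  moreover have "bd_ip K (jump K (U \<mu>) \<mu>) (\<lambda>F. trace K (UW f)) =
      bd_ip K (\<lambda>F x. \<tau> K F * trace K (UW f) x) (\<lambda>F x. trace K (U \<mu>) x - \<mu> x)"
    by (simp add: bd_ip_def mult_ac)
  ultimately show ?thesis by simp
qed

end

section \<open>Inverting the shifted operator\<close>

text \<open>The bound on \<open>\<theta>\<close> makes \<open>lam \<U>\<^sub>W\<close> a contraction on every element.\<close>

locale hdg_shift = hdg_mesh \<Omega> T \<alpha> \<tau> k B for \<Omega> :: "(real^'n) set" and T \<alpha> \<tau> k B +
  fixes lam \<theta> :: real
  assumes lam_pos: "0 < lam" and theta: "\<theta> < 1"
    and contraction: "\<And>K f. K \<in> T \<Longrightarrow> f \<in> L2 \<Omega> \<Longrightarrow> lam * L2_norm K (UW_op \<alpha> \<tau> k T f) \<le> \<theta> * L2_norm K f"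
begin

lemma fixed_point_zero:
  assumes f: "f \<in> L2 \<Omega>" and K: "K \<in> T" and ae: "AE x in lebesgue_on K. f x = lam * UW f x"
  shows "AE x in lebesgue_on K. f x = 0"
proof -
  have m: "f \<in> borel_measurable (lebesgue_on K)" "UW f \<in> borel_measurable (lebesgue_on K)"
    using L2_on_element[OF K f] L2_on_element[OF K Wh_subset_L2[OF UW_in_Wh[OF f]]] by (simp_all add: L2_def)
  have "(LINT x|lebesgue_on K. (f x)\<^sup>2) = (LINT x|lebesgue_on K. lam\<^sup>2 * (UW f x)\<^sup>2)"
  proof (rule integral_cong_AE)
    show "AE x in lebesgue_on K. (f x)\<^sup>2 = lam\<^sup>2 * (UW f x)\<^sup>2"
      using ae by eventually_elim (simp only: power_mult_distrib)
  qed (use m in \<open>auto intro!: borel_measurable_times borel_measurable_power\<close>)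
  then have "L2_norm K f = lam * L2_norm K (UW f)"
    using lam_pos by (simp add: L2_norm_def real_sqrt_mult)
  also have "\<dots> \<le> \<theta> * L2_norm K f" by (rule contraction[OF K f])
  finally have "(1 - \<theta>) * L2_norm K f \<le> 0" by (simp add: algebra_simps)
  moreover have "0 \<le> L2_norm K f" by (simp add: L2_norm_def)
  ultimately have "L2_norm K f = 0" using theta by (simp add: mult_le_0_iff)
  then show ?thesis by (rule L2_norm_zero[OF K f])
qed

lemma fixed_point_lifts_zero:
  assumes f: "f \<in> L2 \<Omega>" and fp: "\<And>x. f x = lam * UW f x"
  shows "f = (\<lambda>x. 0)" "QW f = (\<lambda>x. 0)"
proof -
  have z: "QW f = QW (\<lambda>x. 0)" "UW f = UW (\<lambda>x. 0)"
    using fixed_point_zero[OF f] fp by (intro lift_W_cong_AE[OF f L2_zero]; simp)+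
  have "QW (\<lambda>x. 0) = (\<lambda>x. 0)" "UW (\<lambda>x. 0) = (\<lambda>x. 0)"
    using solves_local_homogeneous[OF solves_local_lift_W[OF L2_zero]] .
  then show "f = (\<lambda>x. 0)" "QW f = (\<lambda>x. 0)" using z fp by auto
qed

text \<open>A solution of the homogeneous problem with shift \<open>lam\<close> is a solution without shift for the data \<open>lam u\<close>, so
  \<open>lam u\<close> is a fixed point of the contraction.\<close>

lemma shifted_homogeneous:
  assumes s: "solves_local lam (\<lambda>x. 0) (\<lambda>x. 0) q u"
  shows "u = (\<lambda>x. 0)"
proof -
  have u: "u \<in> Wh k T" by (rule solves_localD(2)[OF s])
  have f: "(\<lambda>x. lam * u x) \<in> L2 \<Omega>" using L2_comb[OF Wh_subset_L2[OF u] Wh_subset_L2[OF u], of lam 0] by simp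
  have "vol_ip K (\<lambda>x. lam * u x) w = lam * vol_ip K u w" for K w
    by (simp add: vol_ip_def mult.assoc)
  then have "solves_local 0 (\<lambda>x. 0) (\<lambda>x. lam * u x) q u"
    using s unfolding solves_local_def solves_on_def by simp
  from lift_W_eqI(2)[OF f this] have "UW (\<lambda>x. lam * u x) = u" .
  then have "(\<lambda>x. lam * u x) = (\<lambda>x. 0)" using fixed_point_lifts_zero(1)[OF f] by simp
  then show ?thesis using lam_pos by (simp add: fun_eq_iff)
qed

lemma I_minus_UW_L2: "f \<in> L2 \<Omega> \<Longrightarrow> I_minus_UW \<alpha> \<tau> k T lam f \<in> L2 \<Omega>"
  unfolding I_minus_UW_def using L2_comb[of f \<Omega> "UW f" 1 "- lam"] Wh_subset_L2[OF UW_in_Wh] by simp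

lemma I_minus_UW_AE:
  assumes f: "f \<in> L2 \<Omega>" and g: "g \<in> L2 \<Omega>"
  shows "(AE x in lebesgue_on \<Omega>. I_minus_UW \<alpha> \<tau> k T lam f x = I_minus_UW \<alpha> \<tau> k T lam g x)
    \<longleftrightarrow> (AE x in lebesgue_on \<Omega>. f x = g x)" (is "?A \<longleftrightarrow> ?B")
proof
  assume ?B
  then have "UW f = UW g" using AE_element_of_AE_domain by (intro lift_W_cong_AE(2)[OF f g])
  then show ?A using \<open>?B\<close> by (simp add: I_minus_UW_def)
next
  assume A: ?A
  let ?d = "\<lambda>x. f x - g x"
  have d: "?d \<in> L2 \<Omega>" using L2_comb[OF f g, of 1 "-1"] by simp
  have "solves_local 0 (\<lambda>x. 0) ?d (\<lambda>x. QW f x - QW g x) (\<lambda>x. UW f x - UW g x)"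
    using solves_local_comb[OF solves_local_lift_W[OF f] solves_local_lift_W[OF g] Mh_zero Mh_zero f g, of 1 "-1"] by simp
  from lift_W_eqI(2)[OF d this] have Ud: "UW ?d = (\<lambda>x. UW f x - UW g x)" .
  show ?B
  proof (rule AE_domain_of_AE_elements)
    fix K assume K: "K \<in> T"
    have "AE x in lebesgue_on K. ?d x = lam * UW ?d x"
      using AE_element_of_AE_domain[OF K A] by eventually_elim (simp add: I_minus_UW_def Ud algebra_simps)
    from fixed_point_zero[OF d K this] show "AE x in lebesgue_on K. f x = g x" by simp
  qed
qed

text \<open>Injectivity is the contraction property.  For surjectivity, \<open>f - lam \<U>\<^sub>W f = g\<close> is solved by
  \<open>f = g + lam u\<close> with \<open>u\<close> from the local problem with shift \<open>lam\<close> and data \<open>g\<close>; that problem is uniquely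
  solvable by \<open>shifted_homogeneous\<close> and \<open>solves_local_exists\<close>.\<close>

theorem I_minus_UW_invertible: "L2_invertible \<Omega> (I_minus_UW \<alpha> \<tau> k T lam)"
proof -
  let ?A = "I_minus_UW \<alpha> \<tau> k T lam"
  have "inj_on ?A (L2 \<Omega>)"
  proof (rule inj_onI)
    fix f g assume fg: "f \<in> L2 \<Omega>" "g \<in> L2 \<Omega>" "?A f = ?A g"
    then have "AE x in lebesgue_on \<Omega>. f x = g x" using I_minus_UW_AE[OF fg(1,2)] by simp
    then have "UW f = UW g" using AE_element_of_AE_domain fg by (intro lift_W_cong_AE(2))
    then show "f = g" using fg(3) by (simp add: I_minus_UW_def fun_eq_iff)
  qed
  moreover have "?A ` L2 \<Omega> = L2 \<Omega>"
  proof (intro equalityI subsetI)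
    fix g assume g: "g \<in> L2 \<Omega>"
    have "\<exists>q u. solves_local lam (\<lambda>x. 0) g q u"
      by (rule solves_local_exists[OF _ Mh_zero g]) (rule shifted_homogeneous)
    then obtain q u where s: "solves_local lam (\<lambda>x. 0) g q u" by blast
    have u: "u \<in> L2 \<Omega>" by (rule Wh_subset_L2[OF solves_localD(2)[OF s]])
    let ?f = "\<lambda>x. g x + lam * u x"
    have f: "?f \<in> L2 \<Omega>" using L2_comb[OF g u, of 1 lam] by simp
    have "vol_ip K ?f w = vol_ip K g w + lam * vol_ip K u w" if "K \<in> T" "w \<in> Wh k T" for K w
      using vol_ip_comb[OF L2_on_element[OF that(1) g] L2_on_element[OF that(1) u]
          L2_on_element[OF that(1) Wh_subset_L2[OF that(2)]], of 1 lam] by simp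
    then have "solves_local 0 (\<lambda>x. 0) ?f q u"
      using s unfolding solves_local_def solves_on_def by (simp add: algebra_simps)
    from lift_W_eqI(2)[OF f this] have "?A ?f = g" by (simp add: I_minus_UW_def)
    then show "g \<in> ?A ` L2 \<Omega>" using f by (metis image_eqI)
  qed (auto intro: I_minus_UW_L2)
  ultimately show ?thesis
    unfolding L2_invertible_def bij_betw_def using I_minus_UW_AE by blast
qed

section \<open>Equivalence of the condensed and the full eigenproblem\<close>

text \<open>By linearity \<open>(q, u)\<close> solves the local system with data \<open>\<eta>\<close> on the faces and \<open>lam u\<close> in the elements.  This
  gives the first two equations of the eigenproblem for every \<open>\<eta>\<close>.  The third one, tested with \<open>\<mu>\<close>, differs
  from the condensed equation only by terms that cancel, and it is the only one that restricts \<open>\<eta>\<close>.  If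
  \<open>\<eta>\<close> is zero then so are \<open>u\<close> and \<open>q\<close>, so the two notions of nontriviality agree.\<close>

theorem condensed_iff_HDG:
  assumes eta: "\<eta> \<in> Mh \<Omega> k T"
  defines "u \<equiv> inv_into (L2 \<Omega>) (I_minus_UW \<alpha> \<tau> k T lam) (U \<eta>)"
  defines "q \<equiv> (\<lambda>x. Q \<eta> x + lam *\<^sub>R QW u x)"
  shows "(\<eta> \<noteq> (\<lambda>_. 0) \<and> (\<forall>\<mu>\<in>Mh \<Omega> k T. a_h \<alpha> \<tau> k T \<eta> \<mu> = lam * mesh_ip T u (U \<mu>)))
    \<longleftrightarrow> solves_HDG \<Omega> \<alpha> \<tau> k T lam q u \<eta>"
proof -
  note sM = solves_local_lift_M[OF eta]
  have im: "I_minus_UW \<alpha> \<tau> k T lam ` L2 \<Omega> = L2 \<Omega>"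
    using I_minus_UW_invertible unfolding L2_invertible_def bij_betw_def by blast
  have Ueta: "U \<eta> \<in> I_minus_UW \<alpha> \<tau> k T lam ` L2 \<Omega>"
    unfolding im by (rule Wh_subset_L2[OF solves_localD(2)[OF sM]])
  have uL: "u \<in> L2 \<Omega>" unfolding u_def by (rule inv_into_into[OF Ueta])
  have "I_minus_UW \<alpha> \<tau> k T lam u = U \<eta>" unfolding u_def by (rule f_inv_into_f[OF Ueta])
  then have ux: "u x = U \<eta> x + lam * UW u x" for x
    by (simp add: I_minus_UW_def fun_eq_iff algebra_simps)
  note sW = solves_local_lift_W[OF uL]
  have "solves_local 0 (\<lambda>x. 1 * \<eta> x + lam * 0) (\<lambda>x. 1 * 0 + lam * u x)
      (\<lambda>x. 1 *\<^sub>R Q \<eta> x + lam *\<^sub>R QW u x) (\<lambda>x. 1 * U \<eta> x + lam * UW u x)"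
    by (rule solves_local_comb[OF sM sW eta Mh_zero L2_zero uL])
  then have s: "solves_local 0 \<eta> (\<lambda>x. lam * u x) q u"
    by (simp add: q_def ux[symmetric])
  have vol: "vol_ip K (\<lambda>x. lam * u x) w = lam * vol_ip K u w" for K w
    by (simp add: vol_ip_def mult.assoc)
  have "mesh_ip T (\<lambda>x. cc x *v q x) r - mesh_ip T u (dive r)
        + (\<Sum>K\<in>T. bd_ip K (\<lambda>F. \<eta>) (normal_trace K r)) = 0" if "r \<in> Vh k T" for r
    using solves_localD(3)[OF s _ that] unfolding mesh_ip_def
    by (simp flip: sum_subtractf sum.distrib)
  moreover have "- mesh_ip T q (grad w)
        + (\<Sum>K\<in>T. bd_ip K (flux_normal \<tau> q u \<eta> K) (\<lambda>F. trace K w)) = lam * mesh_ip T u w" if w: "w \<in> Wh k T" for w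
  proof -
    have "- mesh_ip T q (grad w) + (\<Sum>K\<in>T. bd_ip K (flux_normal \<tau> q u \<eta> K) (\<lambda>F. trace K w))
        = (\<Sum>K\<in>T. - vol_ip K q (grad w) + bd_ip K (flux_normal \<tau> q u \<eta> K) (\<lambda>F. trace K w))"
      unfolding mesh_ip_def by (simp add: sum_subtractf)
    also have "\<dots> = (\<Sum>K\<in>T. lam * vol_ip K u w)"
    proof (rule sum.cong[OF refl])
      fix K assume K: "K \<in> T"
      show "- vol_ip K q (grad w) + bd_ip K (flux_normal \<tau> q u \<eta> K) (\<lambda>F. trace K w) = lam * vol_ip K u w"
        using solves_localD(4)[OF s K w] flux_against_trace[OF K solves_localD(1,2)[OF s] eta w] by (simp add: vol)
    qed
    finally show ?thesis by (simp add: mesh_ip_def sum_distrib_left)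
  qed
  moreover have "(\<Sum>K\<in>T. bd_ip K (\<lambda>F. \<mu>) (flux_normal \<tau> q u \<eta> K)) = lam * mesh_ip T u (U \<mu>) - a_h \<alpha> \<tau> k T \<eta> \<mu>"
    if mu: "\<mu> \<in> Mh \<Omega> k T" for \<mu>
  proof -
    have "bd_ip K (\<lambda>F. \<mu>) (flux_normal \<tau> q u \<eta> K) = lam * vol_ip K u (U \<mu>) -
        (energy_ip K (Q \<eta>) (Q \<mu>) +
         bd_ip K (jump K (U \<eta>) \<eta>) (\<lambda>F x. trace K (U \<mu>) x - \<mu> x))" if K: "K \<in> T" for K
    proof -
      interpret E: hdg_element "vertices K" cc "\<tau> K" k B rewrites "convex hull (vertices K) = K"
        by (rule element[OF K]) (rule vertices(3)[OF K])
      note M = Mh_element[OF _ K]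
      note sm = solves_local_lift_M[OF mu]
      have m: "Q \<eta> \<in> E.V" "QW u \<in> E.V" "Q \<mu> \<in> E.V" "U \<eta> \<in> E.W" "UW u \<in> E.W" "U \<mu> \<in> E.W"
        by (intro Vh_element Wh_element solves_localD(1,2)[OF sM] solves_localD(1,2)[OF sW] solves_localD(1,2)[OF sm] K)+
      have "energy_ip K q (Q \<mu>) = energy_ip K (Q \<eta>) (Q \<mu>) + lam * energy_ip K (QW u) (Q \<mu>)"
        using lin_onD[OF E.functional_on_lin[OF E.formA_functional1[OF m(3)]] m(1,2), of 1 lam]
        by (simp add: E.formA_def q_def)
      moreover have "bd_ip K (jump K u \<eta>) (\<lambda>F x. trace K (U \<mu>) x - \<mu> x) =
          bd_ip K (jump K (U \<eta>) \<eta>) (\<lambda>F x. trace K (U \<mu>) x - \<mu> x) +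
          lam * bd_ip K (\<lambda>F x. \<tau> K F * trace K (UW u) x) (\<lambda>F x. trace K (U \<mu>) x - \<mu> x)"
      proof -
        have "trace K u x = trace K (U \<eta>) x + lam * trace K (UW u) x" if "x \<in> K" for x
        proof -
          have "u = (\<lambda>x. 1 *\<^sub>R U \<eta> x + lam *\<^sub>R UW u x)" using ux by auto
          then show ?thesis using E.trace_W_comb[OF m(4,5) that, of 1 lam] by simp
        qed
        then have "bd_ip K (jump K u \<eta>) (\<lambda>F x. trace K (U \<mu>) x - \<mu> x) =
            bd_ip K (\<lambda>F x. 1 * (\<tau> K F * (trace K (U \<eta>) x - \<eta> x)) + lam * (\<tau> K F * trace K (UW u) x)) (\<lambda>F x. trace K (U \<mu>) x - \<mu> x)"
          by (intro E.bd_ip_cong) (simp_all add: algebra_simps)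
        also have "\<dots> = 1 * bd_ip K (jump K (U \<eta>) \<eta>) (\<lambda>F x. trace K (U \<mu>) x - \<mu> x) +
          lam * bd_ip K (\<lambda>F x. \<tau> K F * trace K (UW u) x) (\<lambda>F x. trace K (U \<mu>) x - \<mu> x)"
          by (intro E.bd_ip_comb E.face_polynomials_jump E.face_polynomials_tau E.face_polynomials_trace
              E.face_polynomials_diff E.face_polynomials_M m M eta mu)
        finally show ?thesis by simp
      qed
      moreover have "lam * energy_ip K (QW u) (Q \<mu>) +
          lam * bd_ip K (\<lambda>F x. \<tau> K F * trace K (UW u) x) (\<lambda>F x. trace K (U \<mu>) x - \<mu> x) = 0"
        using lift_W_orthogonal_lift_M[OF K uL mu] by (simp flip: distrib_left)
      ultimately show ?thesis
        using flux_against_face_function[OF K s eta mu] by (simp add: vol)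
    qed
    then show ?thesis
      unfolding a_h_def mesh_ip_def
      by (simp add: sum.distrib sum_subtractf sum_distrib_left)
  qed
  moreover have "\<not> (q = (\<lambda>_. 0) \<and> u = (\<lambda>_. 0) \<and> \<eta> = (\<lambda>_. 0)) \<longleftrightarrow> \<eta> \<noteq> (\<lambda>_. 0)"
  proof -
    have "q = (\<lambda>_. 0)" "u = (\<lambda>_. 0)" if "\<eta> = (\<lambda>_. 0)"
    proof -
      have "Q \<eta> = (\<lambda>x. 0)" "U \<eta> = (\<lambda>x. 0)"
        using sM unfolding that by (rule solves_local_homogeneous)+
      moreover from this have "u = (\<lambda>x. 0)" "QW u = (\<lambda>x. 0)"
        using fixed_point_lifts_zero[OF uL] ux by simp_all
      ultimately show "q = (\<lambda>_. 0)" "u = (\<lambda>_. 0)" by (simp_all add: q_def)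
    qed
    then show ?thesis by blast
  qed
  ultimately show ?thesis
    unfolding solves_HDG_def using solves_localD(1,2)[OF s] eta by auto
qed

end

theorem theorem5p3:
  fixes \<Omega> :: "(real^'n) set" and T :: "(real^'n) set set" and \<alpha> :: "real^'n \<Rightarrow> real^'n^'n"
    and \<tau> :: "'n penalty" and k :: nat and B C0 Cs C3 lam :: real
  assumes "2 \<le> CARD('n)"
    and "polyhedral_domain \<Omega>"
    and "simplicial_mesh \<Omega> T"
    and "admissible_coefficient \<Omega> B \<alpha>"
    and "admissible_penalty T \<tau>"
    and "0 < Cs"
    and "\<And>K. K \<in> T \<Longrightarrow> (d_const \<tau> K)\<^sup>2 * diameter K \<le> Cs"
    and "\<And>K. K \<in> T \<Longrightarrow> c_const \<tau> K \<le> Cs"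
    and "0 < C0"
    and "\<And>K f. K \<in> T \<Longrightarrow> f \<in> L2 \<Omega> \<Longrightarrow>
           L2_norm K (UW_op \<alpha> \<tau> k T f) \<le> C0 * (d_const \<tau> K)\<^sup>2 * (diameter K)\<^sup>2 * L2_norm K f"
    and "0 < C3" and "C3 < inverse (C0 * Cs)"
    and "0 < lam" and "lam < C3 / mesh_size T"
  shows "L2_invertible \<Omega> (I_minus_UW \<alpha> \<tau> k T lam) \<and>
    (\<forall>\<eta>\<in>Mh \<Omega> k T.
       let u = inv_into (L2 \<Omega>) (I_minus_UW \<alpha> \<tau> k T lam) (U_op \<alpha> \<tau> k T \<eta>);
           q = (\<lambda>x. Q_op \<alpha> \<tau> k T \<eta> x + lam *\<^sub>R QW_op \<alpha> \<tau> k T u x)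
       in (\<eta> \<noteq> (\<lambda>_. 0) \<and>
           (\<forall>\<mu>\<in>Mh \<Omega> k T. a_h \<alpha> \<tau> k T \<eta> \<mu> = lam * mesh_ip T u (U_op \<alpha> \<tau> k T \<mu>)))
          \<longleftrightarrow> solves_HDG \<Omega> \<alpha> \<tau> k T lam q u \<eta>)"
proof -
  interpret hdg_mesh \<Omega> T \<alpha> \<tau> k B by unfold_locales (fact assms)+
  \<comment> \<open>the contraction factor: on each element \<open>C0 d\<^sup>2 h\<^sup>2\<close> is at most \<open>C0 Cs h\<close>\<close>
  define \<theta> where "\<theta> = lam * mesh_size T * (C0 * Cs)"
  have C: "0 < C0 * Cs" using assms by simp
  have "0 < C3 / mesh_size T" using assms by linarith
  \<comment> \<open>a mesh size that is not positive would make the bound on \<open>lam\<close> nonpositive, also by \<open>C3 / 0 = 0\<close>\<close>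
  then have h: "0 < mesh_size T" using \<open>0 < C3\<close> by (simp add: zero_less_divide_iff)
  then have "lam * mesh_size T < C3" using assms by (simp add: pos_less_divide_eq)
  then have "\<theta> < C3 * (C0 * Cs)" unfolding \<theta>_def using C by (rule mult_strict_right_mono)
  also have "\<dots> < inverse (C0 * Cs) * (C0 * Cs)" using assms C by (intro mult_strict_right_mono) auto
  also have "\<dots> = 1" using C by (intro left_inverse) auto
  finally have theta: "\<theta> < 1" .
  interpret hdg_shift \<Omega> T \<alpha> \<tau> k B lam \<theta>
  proof unfold_locales
    show "0 < lam" "\<theta> < 1" by (fact assms theta)+
    fix K f assume K: "K \<in> T" and f: "f \<in> L2 \<Omega>"
    have "compact K" using vertices[OF K] by (metis aff_independent_finite finite_imp_compact_convex_hull)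
    then have d0: "0 \<le> diameter K" by (simp add: diameter_ge_0 compact_imp_bounded)
    have dh: "diameter K \<le> mesh_size T" unfolding mesh_size_def using K finite_T by simp
    have n0: "0 \<le> L2_norm K f" by (simp add: L2_norm_def)
    have "(d_const \<tau> K)\<^sup>2 * (diameter K)\<^sup>2 = ((d_const \<tau> K)\<^sup>2 * diameter K) * diameter K"
      by (simp add: power2_eq_square)
    also have "\<dots> \<le> Cs * mesh_size T"
      using assms(7)[OF K] d0 dh \<open>0 < Cs\<close> by (intro mult_mono) auto
    finally have "lam * (C0 * ((d_const \<tau> K)\<^sup>2 * (diameter K)\<^sup>2) * L2_norm K f) \<le> lam * (C0 * (Cs * mesh_size T) * L2_norm K f)"
      using \<open>0 < lam\<close> \<open>0 < C0\<close> n0 by (intro mult_left_mono mult_right_mono) auto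
    moreover have "lam * L2_norm K (UW f) \<le> lam * (C0 * ((d_const \<tau> K)\<^sup>2 * (diameter K)\<^sup>2) * L2_norm K f)"
      using assms(10)[OF K f] \<open>0 < lam\<close> by (intro mult_left_mono) (auto simp: mult.assoc)
    ultimately show "lam * L2_norm K (UW f) \<le> \<theta> * L2_norm K f"
      by (simp add: \<theta>_def mult_ac)
  qed
  show ?thesis
    unfolding Let_def using I_minus_UW_invertible condensed_iff_HDG by blast
qed

end
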